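(* Let $B$ be a closed braid, let $H(B)$ be its middle HOMFLYPT homology and $H_r(B)$ the reduction of $H(B)$, and let $\beta_B(p,q,j,k)$ and $\beta_{B,r}(p,q,j,k)$ be the Betti numbers of $H(B)$ over $R_B$ and of $H_r(B)$ over $R_{B,r}$, respectively. Then $\beta_B(p,q,j,k)=\beta_{B,r}(p,q-1,j,k)$ for all $(p,q,j,k)\in\mathbb{Z}_{\geq 0}\times\mathbb{Z}^3$. In particular, if $B$ is a knot, then $\beta_B(0,q,j,k)=\dim_{\mathbb{Q}}H_r^{q-1,j,k}(B)=\dim_{\mathbb{Q}}\overline{H}^{q-1,j,k}(B)$ for all $(q,j,k)\in\mathbb{Z}^3$, and $\beta_B(p,q,j,k)=0$ whenever $p>0$, where $\overline{H}$ is Rasmussen's reduced HOMFLYPT homology.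
   Context: Edge rings. Let $B$ be a closed braid diagram with $s$ strands, writhe $w$, crossings $c_1,\dots,c_n$ and components $K_1,\dots,K_m$. An edge of $B$ is an arc of the diagram that starts and ends at crossings and has no crossing in its interior (a component of the diagram without crossings counts as one edge). Number the edges $1,\dots,M$ so that edge $l$ lies on $K_l$ for $1\le l\le m$, and give edge $l$ a variable $X_l$ of degree $2$. For a crossing $c$ with outgoing edges $k$ (left), $l$ (right) and incoming edges $i$ (left), $j$ (right), put $\rho(c)=X_k+X_l-X_i-X_j$. The edge ring is $R(B)=\mathbb{Q}[X_1,\dots,X_M]/(\rho(c_1),\dots,\rho(c_n))$ and the reduced edge ring is $R_r(B)=\mathbb{Q}[X_2-X_1,\dots,X_M-X_1]/(\rho(c_1),\dots,\rho(c_n))$. Complexes. Write $R=R(B)$, and let $R\{s_1,s_2,s_3\}$ denote $R$ with $\mathbb{Z}^3$-grading shifted so that $1$ has degree $(s_1,s_2,s_3)$; the first grading is the polynomial grading, the second is horizontal, the third is vertical. To a crossing $c$ with outgoing edges $k$ (left), $l$ (right) and incoming edges $i$ (left), $j$ (right) assign a double complex $C_0(c)$ of free $R$-modules with horizontal differential $d_+$ of degree $(2,2,0)$ and vertical differential $d_v$ of degree $(0,0,2)$. If $c$ is positive: the row $R\{2,-2,-2\}\to R\{0,0,-2\}$ with $d_+=(X_k-X_i)(X_j-X_k)$; the row $R\{0,-2,0\}\to R\{0,0,0\}$ with $d_+=X_k-X_i$; and $d_v$ from the first row to the second is $X_j-X_k$ on the left column and $1$ on the right column. If $c$ is negative: the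 row $R\{0,-2,0\}\to R\{0,0,0\}$ with $d_+=X_k-X_i$; the row $R\{0,-2,2\}\to R\{-2,0,2\}$ with $d_+=(X_k-X_i)(X_j-X_k)$; and $d_v$ from the first row to the second is $1$ on the left column and $X_j-X_k$ on the right column. Let $C_0(B)=\bigotimes_{R(B)}C_0(c)$ over all crossings (equal to $R(B)$ if there are none), with $d_+$ and $d_v$ extended by the usual sign rules in each direction so that $d_+^2=d_v^2=0$ and $d_+d_v=d_vd_+$. Let $C_r(B)$ be obtained from $C_0(B)$ by replacing each summand $R(B)$ by $R_r(B)$; thus $C_r(B)\cong C_0(B)/X_1C_0(B)$ and $C_0(B)\cong C_r(B)\otimes_{\mathbb{Q}}\mathbb{Q}[X_1]$. Homologies. The middle HOMFLYPT homology and its reduction are $$H(B)=H(H(C_0(B),d_+),d_v)\{-w+s,\,w+s-1,\,w-s+1\},\qquad H_r(B)=H(H(C_r(B),d_+),d_v)\{-w+s-1,\,w+s-1,\,w-s+1\}.$$ Write $H^{i,j,k}(B)$, $H_r^{i,j,k}(B)$ for homogeneous components and $H^{\star,j,k}(B)=\bigoplus_i H^{i,j,k}(B)$, $H_r^{\star,j,k}(B)=\bigoplus_i H_r^{i,j,k}(B)$. If the diagram $B$ is connected (in particular, if $B$ is a knot), Rasmussen's reduced HOMFLYPT homology $\overline{H}(B)$ is given by the same formula as $H_r(B)$, so $\overline{H}(B)=H_r(B)$. Module structure. Variables of edges on the same component act identically on $H(B)$ (Rasmussen). Hence $H(B)$ is a finitely generated graded module over $R_B=\mathbb{Q}[X_1,\dots,X_m]$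 (one variable of degree $2$ per component) and $H_r(B)$ is a finitely generated graded module over $R_{B,r}=\mathbb{Q}[X_2-X_1,\dots,X_m-X_1]$; homogeneous ring elements shift the first grading by their degree and preserve the other two. Betti numbers. Let $\mathfrak{m}=(X_1,\dots,X_m)\subset R_B$ and $\mathfrak{m}_r=(X_2-X_1,\dots,X_m-X_1)\subset R_{B,r}$. For $(p,q,j,k)\in\mathbb{Z}_{\ge0}\times\mathbb{Z}^3$, $$\beta_B(p,q,j,k)=\dim_{\mathbb{Q}}\mathrm{Tor}^{R_B}_p(R_B/\mathfrak{m},H^{\star,j,k}(B))^q,\qquad \beta_{B,r}(p,q,j,k)=\dim_{\mathbb{Q}}\mathrm{Tor}^{R_{B,r}}_p(R_{B,r}/\mathfrak{m}_r,H_r^{\star,j,k}(B))^q,$$ where the superscript $q$ denotes the homogeneous component of degree $q$. *)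

theory Defs
  imports Complex_Main "HOL-Library.Poly_Mapping" "HOL-Library.Product_Plus"
    "HOL-Library.Extended_Nat"
begin

section \<open>Polynomials and free modules\<close>

text \<open>
  All coefficient rings below are \<open>\<rat>\<close>-subalgebras of the polynomial ring over \<open>\<rat>\<close> in the variables
  \<open>X\<^sub>0, X\<^sub>1, \<dots>\<close>; they are represented by their carrier sets.
\<close>

type_synonym mpoly = "(nat \<Rightarrow>\<^sub>0 nat) \<Rightarrow>\<^sub>0 rat"

definition Cst :: "rat \<Rightarrow> mpoly" where
  "Cst c = Poly_Mapping.single 0 c"

definition Var :: "nat \<Rightarrow> mpoly" where
  "Var l = Poly_Mapping.single (Poly_Mapping.single l 1) 1"

text \<open>Every variable has degree 2. The zero polynomial is homogeneous of every degree.\<close>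

definition homogeneous :: "int \<Rightarrow> mpoly \<Rightarrow> bool" where
  "homogeneous d f \<longleftrightarrow>
     (\<forall>\<mu> \<in> Poly_Mapping.keys f. (\<Sum>l \<in> Poly_Mapping.keys \<mu>. 2 * int (Poly_Mapping.lookup \<mu> l)) = d)"

text \<open>\<open>adjoin G\<close> is the subalgebra \<open>\<rat>[G]\<close>.\<close>

inductive_set adjoin :: "mpoly set \<Rightarrow> mpoly set" for G where
  const: "Cst c \<in> adjoin G"
| gen: "g \<in> G \<Longrightarrow> g \<in> adjoin G"
| add: "f \<in> adjoin G \<Longrightarrow> g \<in> adjoin G \<Longrightarrow> f + g \<in> adjoin G"
| mult: "f \<in> adjoin G \<Longrightarrow> g \<in> adjoin G \<Longrightarrow> f * g \<in> adjoin G"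

text \<open>The ideal of the ring \<open>A\<close> generated by \<open>G\<close>, where \<open>G \<subseteq> A\<close>.\<close>

inductive_set ideal_gen :: "mpoly set \<Rightarrow> mpoly set \<Rightarrow> mpoly set" for A G where
  zero: "0 \<in> ideal_gen A G"
| step: "f \<in> ideal_gen A G \<Longrightarrow> a \<in> A \<Longrightarrow> g \<in> G \<Longrightarrow> f + a * g \<in> ideal_gen A G"

text \<open>
  Elements of free modules with basis in \<open>'b\<close> are finitely supported coefficient functions.
  For an additive subgroup \<open>A\<close>, \<open>vecs A S\<close> is the direct sum of copies of \<open>A\<close> indexed by \<open>S\<close>.
\<close>

type_synonym 'b vec = "'b \<Rightarrow>\<^sub>0 mpoly"

definition smult :: "mpoly \<Rightarrow> 'b vec \<Rightarrow> 'b vec" where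
  "smult a = Poly_Mapping.map ((*) a)"

definition vecs :: "mpoly set \<Rightarrow> 'b set \<Rightarrow> 'b vec set" where
  "vecs A S = {x. Poly_Mapping.keys x \<subseteq> S \<and> (\<forall>b. Poly_Mapping.lookup x b \<in> A)}"

definition linear_over :: "mpoly set \<Rightarrow> 'b vec set \<Rightarrow> ('b vec \<Rightarrow> 'c vec) \<Rightarrow> bool" where
  "linear_over A U f \<longleftrightarrow>
     (\<forall>x \<in> U. \<forall>y \<in> U. f (x + y) = f x + f y) \<and>
     (\<forall>a \<in> A. \<forall>x \<in> U. f (smult a x) = smult a (f x))"

definition scaleQ :: "rat \<Rightarrow> 'b vec \<Rightarrow> 'b vec" where
  "scaleQ c = smult (Cst c)"

lemma lookup_smult: "Poly_Mapping.lookup (smult a x) b = a * Poly_Mapping.lookup x b"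
  by (simp add: smult_def Poly_Mapping.map.rep_eq when_def)

global_interpretation vecQ: vector_space scaleQ
  by standard
    (auto intro!: poly_mapping_eqI simp: scaleQ_def lookup_smult lookup_add Cst_def
      single_add distrib_left distrib_right mult_single simp flip: mult.assoc)

section \<open>Graded subquotients\<close>

text \<open>
  A graded module is presented as a subquotient \<open>num / den\<close> of a free module, where
  \<open>den \<subseteq> num\<close> are graded submodules; \<open>cmp g\<close> is the degree \<open>g\<close> component of the ambient free
  module, so that the degree \<open>g\<close> component of the subquotient is
  \<open>(num \<inter> cmp g) / (den \<inter> cmp g)\<close>. The ring acts by \<^const>\<open>smult\<close>.
\<close>

record ('g, 'v) grmod =
  num :: "'v set"
  den :: "'v set"
  cmp :: "'g \<Rightarrow> 'v set"

text \<open>\<open>X\<close> represents a rational basis of \<open>U / W\<close>, with distinct elements of \<open>X\<close> in distinct cosets.\<close>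

definition quot_basis :: "'b vec set \<Rightarrow> 'b vec set \<Rightarrow> 'b vec set \<Rightarrow> bool" where
  "quot_basis U W X \<longleftrightarrow>
     X \<subseteq> U \<and> vecQ.independent X \<and> vecQ.span X \<inter> W \<subseteq> {0} \<and> U \<subseteq> vecQ.span (X \<union> W)"

definition quot_dim :: "'b vec set \<Rightarrow> 'b vec set \<Rightarrow> enat" where
  "quot_dim U W = (let X = SOME X. quot_basis U W X in if finite X then enat (card X) else \<infinity>)"

definition comp_dim :: "('g, 'b vec) grmod \<Rightarrow> 'g \<Rightarrow> enat" where
  "comp_dim M g = quot_dim (num M \<inter> cmp M g) (den M \<inter> cmp M g)"

text \<open>
  For an endomorphism \<open>d\<close> inducing a differential on \<open>M = num / den\<close>: the kernel of the induced map
  is \<open>{x \<in> num. d x \<in> den} / den\<close> and its image is \<open>(den + d num) / den\<close>.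
\<close>

definition homology :: "('v \<Rightarrow> 'v) \<Rightarrow> ('g, 'v::plus) grmod \<Rightarrow> ('g, 'v) grmod" where
  "homology d M = M\<lparr>num := {x \<in> num M. d x \<in> den M},
                    den := {x + d y |x y. x \<in> den M \<and> y \<in> num M}\<rparr>"

text \<open>\<open>M{s}\<close>: an element of degree \<open>g\<close> in \<open>M\<close> has degree \<open>g + s\<close> in \<open>M{s}\<close>.\<close>

definition shift :: "'g::minus \<Rightarrow> ('g, 'v) grmod \<Rightarrow> ('g, 'v) grmod" where
  "shift s M = M\<lparr>cmp := (\<lambda>g. cmp M (g - s))\<rparr>"

text \<open>\<open>row M j k\<close> is \<open>M\<close> in degrees \<open>(\<star>, j, k)\<close>, i.e. the direct sum over \<open>i\<close> of the components
  of degree \<open>(i, j, k)\<close>.\<close>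

definition row :: "(int \<times> int \<times> int, 'v::comm_monoid_add) grmod \<Rightarrow> int \<Rightarrow> int \<Rightarrow> (int, 'v) grmod" where
  "row M j k =
     \<lparr>num = {\<Sum>i\<in>I. f i |I f. finite I \<and> (\<forall>i\<in>I. f i \<in> num M \<inter> cmp M (i, j, k))},
      den = {\<Sum>i\<in>I. f i |I f. finite I \<and> (\<forall>i\<in>I. f i \<in> den M \<inter> cmp M (i, j, k))},
      cmp = (\<lambda>i. cmp M (i, j, k))\<rparr>"

section \<open>Graded Tor\<close>

text \<open>
  A graded free resolution \<open>\<dots> \<rightarrow> P\<^sub>1 \<rightarrow> P\<^sub>0 \<rightarrow> M \<rightarrow> 0\<close>. The module \<open>P\<^sub>p\<close> is free on \<open>basis P p\<close>,
  \<open>bdeg P p b\<close> is the degree of the basis element \<open>b\<close>, and \<open>bd P p\<close> maps \<open>P\<^sub>p\<^sub>+\<^sub>1\<close> to \<open>P\<^sub>p\<close>. Bases are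
  sets of natural numbers; this is enough because all modules considered here are countable.
  The augmentation is given by a linear lift \<open>P\<^sub>0 \<rightarrow> num M\<close>.
\<close>

record 'v resolution =
  basis :: "nat \<Rightarrow> nat set"
  bdeg :: "nat \<Rightarrow> nat \<Rightarrow> int"
  bd :: "nat \<Rightarrow> nat vec \<Rightarrow> nat vec"
  aug :: "nat vec \<Rightarrow> 'v"

definition res_cmp :: "('v, 'z) resolution_scheme \<Rightarrow> nat \<Rightarrow> int \<Rightarrow> nat vec set" where
  "res_cmp P p q =
     {x. \<forall>b \<in> Poly_Mapping.keys x. homogeneous (q - bdeg P p b) (Poly_Mapping.lookup x b)}"

definition graded_free_resolution ::
    "mpoly set \<Rightarrow> (int, 'b vec) grmod \<Rightarrow> 'b vec resolution \<Rightarrow> bool" where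
  "graded_free_resolution A M P \<longleftrightarrow>
     (let F = (\<lambda>p. vecs A (basis P p)) in
        (\<forall>p. linear_over A (F (Suc p)) (bd P p) \<and> bd P p ` F (Suc p) \<subseteq> F p \<and>
             (\<forall>q. bd P p ` (F (Suc p) \<inter> res_cmp P (Suc p) q) \<subseteq> res_cmp P p q)) \<and>
        linear_over A (F 0) (aug P) \<and> aug P ` F 0 \<subseteq> num M \<and>
        (\<forall>q. aug P ` (F 0 \<inter> res_cmp P 0 q) \<subseteq> cmp M q) \<and>
        (\<forall>y \<in> num M. \<exists>x \<in> F 0. y - aug P x \<in> den M) \<and>
        {x \<in> F 0. aug P x \<in> den M} = bd P 0 ` F 1 \<and>
        (\<forall>p. {x \<in> F (Suc p). bd P p x = 0} = bd P (Suc p) ` F (Suc (Suc p))))"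

text \<open>
  \<open>Tor\<^sub>p(A/I, M)\<close> is computed from a chosen graded free resolution of \<open>M\<close>; \<open>tor_of A I P p\<close> is
  \<open>H\<^sub>p((A/I) \<otimes>\<^sub>A P)\<close>, where \<open>(A/I) \<otimes>\<^sub>A P\<^sub>p\<close> is the direct sum of copies of \<open>A/I\<close> indexed by \<open>basis P p\<close>.
\<close>

definition tor_of :: "mpoly set \<Rightarrow> mpoly set \<Rightarrow> 'v resolution \<Rightarrow> nat \<Rightarrow> (int, nat vec) grmod" where
  "tor_of A I P p =
     \<lparr>num = {x \<in> vecs A (basis P p).
               case p of 0 \<Rightarrow> True | Suc p' \<Rightarrow> bd P p' x \<in> vecs I (basis P p')},
      den = {x + bd P p y |x y. x \<in> vecs I (basis P p) \<and> y \<in> vecs A (basis P (Suc p))},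
      cmp = res_cmp P p\<rparr>"

definition Tor :: "mpoly set \<Rightarrow> mpoly set \<Rightarrow> (int, 'b vec) grmod \<Rightarrow> nat \<Rightarrow> (int, nat vec) grmod" where
  "Tor A I M p = tor_of A I (SOME P. graded_free_resolution A M P) p"

section \<open>Closed braids\<close>

text \<open>
  A closed braid diagram is the closure of a braid word. The letter \<open>(i, True)\<close>, respectively
  \<open>(i, False)\<close>, is a positive, respectively negative, crossing of the strands in positions
  \<open>i\<close> (left) and \<open>i + 1\<close> (right). The crossings are the indices \<open>t < ncross B\<close> into the word,
  in the order in which they are met along the orientation.
\<close>

record braid =
  strands :: nat
  word :: "(nat \<times> bool) list"

definition closed_braid :: "braid \<Rightarrow> bool" where
  "closed_braid B \<longleftrightarrow>
     1 \<le> strands B \<and> (\<forall>(i, e) \<in> set (word B). 1 \<le> i \<and> i < strands B)"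

definition ncross :: "braid \<Rightarrow> nat" where
  "ncross B = length (word B)"

definition pos :: "braid \<Rightarrow> nat \<Rightarrow> nat" where
  "pos B t = fst (word B ! t)"

definition positive :: "braid \<Rightarrow> nat \<Rightarrow> bool" where
  "positive B t = snd (word B ! t)"

definition writhe :: "braid \<Rightarrow> int" where
  "writhe B = (\<Sum>t<ncross B. if positive B t then 1 else -1)"

definition meets :: "braid \<Rightarrow> nat \<Rightarrow> nat \<Rightarrow> bool" where
  "meets B t q \<longleftrightarrow> q = pos B t \<or> q = pos B t + 1"

text \<open>
  \<open>Arc t q\<close> is the edge that leaves crossing \<open>t\<close> in position \<open>q\<close> and ends at the next crossing met
  in that position, cyclically; \<open>Loop q\<close> is the closure of a strand without crossings.
\<close>

datatype edge = Arc nat nat | Loop nat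

definition edges :: "braid \<Rightarrow> edge set" where
  "edges B = {Arc t q |t q. t < ncross B \<and> meets B t q} \<union>
             {Loop q |q. 1 \<le> q \<and> q \<le> strands B \<and> (\<forall>t<ncross B. \<not> meets B t q)}"

text \<open>The edge arriving at crossing \<open>t\<close> in position \<open>q\<close> left the cyclically preceding crossing
  in that position (which is \<open>t\<close> itself if there is no other).\<close>

definition arriving :: "braid \<Rightarrow> nat \<Rightarrow> nat \<Rightarrow> edge" where
  "arriving B t q =
     (let n = ncross B;
          d = (LEAST d. 0 < d \<and> meets B ((t + n - d) mod n) q)
      in Arc ((t + n - d) mod n) q)"

definition in_left :: "braid \<Rightarrow> nat \<Rightarrow> edge" where "in_left B t = arriving B t (pos B t)"
definition in_right :: "braid \<Rightarrow> nat \<Rightarrow> edge" where "in_right B t = arriving B t (pos B t + 1)"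
definition out_left :: "braid \<Rightarrow> nat \<Rightarrow> edge" where "out_left B t = Arc t (pos B t)"
definition out_right :: "braid \<Rightarrow> nat \<Rightarrow> edge" where "out_right B t = Arc t (pos B t + 1)"

definition passes :: "braid \<Rightarrow> (edge \<times> edge) set" where
  "passes B = (\<Union>t<ncross B. {(in_left B t, out_right B t), (in_right B t, out_left B t)})"

definition components :: "braid \<Rightarrow> edge set set" where
  "components B = edges B // (passes B \<union> (passes B)\<inverse>)\<^sup>*"

definition ncomp :: "braid \<Rightarrow> nat" where
  "ncomp B = card (components B)"

definition is_knot :: "braid \<Rightarrow> bool" where
  "is_knot B \<longleftrightarrow> ncomp B = 1"

definition connected_diagram :: "braid \<Rightarrow> bool" where
  "connected_diagram B \<longleftrightarrow>
     (let legs = (\<lambda>t. {in_left B t, in_right B t, out_left B t, out_right B t})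
      in edges B \<times> edges B \<subseteq> (\<Union>t<ncross B. legs t \<times> legs t)\<^sup>*)"

definition nedges :: "braid \<Rightarrow> nat" where
  "nedges B = card (edges B)"

text \<open>A numbering of the edges such that, for a suitable enumeration \<open>K\<^sub>1, \<dots>, K\<^sub>m\<close> of the
  components, edge \<open>l\<close> lies on \<open>K\<^sub>l\<close> for \<open>1 \<le> l \<le> m\<close>.\<close>

definition edge_numbering :: "braid \<Rightarrow> (edge \<Rightarrow> nat) \<Rightarrow> bool" where
  "edge_numbering B \<nu> \<longleftrightarrow>
     bij_betw \<nu> (edges B) {1..nedges B} \<and>
     (\<exists>K. bij_betw K {1..ncomp B} (components B) \<and>
          (\<forall>e \<in> edges B. \<nu> e \<le> ncomp B \<longrightarrow> e \<in> K (\<nu> e)))"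

section \<open>The double complex\<close>

context
  fixes B :: braid and \<nu> :: "edge \<Rightarrow> nat"
begin

definition Xil :: "nat \<Rightarrow> mpoly" where "Xil t = Var (\<nu> (in_left B t))"
definition Xir :: "nat \<Rightarrow> mpoly" where "Xir t = Var (\<nu> (in_right B t))"
definition Xol :: "nat \<Rightarrow> mpoly" where "Xol t = Var (\<nu> (out_left B t))"
definition Xor :: "nat \<Rightarrow> mpoly" where "Xor t = Var (\<nu> (out_right B t))"

definition rho :: "nat \<Rightarrow> mpoly" where
  "rho t = Xol t + Xor t - Xil t - Xir t"

text \<open>
  The tensor product of the squares \<open>C\<^sub>0(c)\<close> has one free generator for every choice of a corner of
  each square. The generator \<open>(H, V)\<close> selects the right column at the crossings in \<open>H\<close>
  (the left one elsewhere) and the second row at the crossings in \<open>V\<close> (the first one elsewhere).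
\<close>

type_synonym corner = "nat set \<times> nat set"

definition corners :: "corner set" where
  "corners = Pow {..<ncross B} \<times> Pow {..<ncross B}"

text \<open>Arguments of \<open>corner_deg\<close>: is the crossing positive, right column, second row.\<close>

fun corner_deg :: "bool \<Rightarrow> bool \<Rightarrow> bool \<Rightarrow> int \<times> int \<times> int" where
  "corner_deg True  False False = (2, -2, -2)"
| "corner_deg True  True  False = (0, 0, -2)"
| "corner_deg True  False True  = (0, -2, 0)"
| "corner_deg True  True  True  = (0, 0, 0)"
| "corner_deg False False False = (0, -2, 0)"
| "corner_deg False True  False = (0, 0, 0)"
| "corner_deg False False True  = (0, -2, 2)"
| "corner_deg False True  True  = (-2, 0, 2)"

definition deg_at :: "corner \<Rightarrow> nat \<Rightarrow> int \<times> int \<times> int" where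
  "deg_at c t = corner_deg (positive B t) (t \<in> fst c) (t \<in> snd c)"

definition gen_deg :: "corner \<Rightarrow> int \<times> int \<times> int" where
  "gen_deg c = (\<Sum>t<ncross B. deg_at c t)"

text \<open>Horizontal differential of the square at \<open>t\<close>; the argument tells whether the row is the
  second one.\<close>

definition coef_h :: "nat \<Rightarrow> bool \<Rightarrow> mpoly" where
  "coef_h t r = (if positive B t \<and> \<not> r \<or> \<not> positive B t \<and> r
                 then (Xol t - Xil t) * (Xir t - Xol t) else Xol t - Xil t)"

text \<open>Vertical differential of the square at \<open>t\<close>; the argument tells whether the column is the
  right one.\<close>

definition coef_v :: "nat \<Rightarrow> bool \<Rightarrow> mpoly" where
  "coef_v t r = (if positive B t \<and> \<not> r \<or> \<not> positive B t \<and> r then Xir t - Xol t else 1)"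

text \<open>
  Koszul signs: a differential applied at crossing \<open>t\<close> picks up \<open>(-1)\<^sup>d\<close>, where \<open>2 d\<close> is the
  horizontal (respectively vertical) degree of the factors at the preceding crossings.
\<close>

definition sign_h :: "corner \<Rightarrow> nat \<Rightarrow> mpoly" where
  "sign_h c t = (-1) ^ nat \<bar>(\<Sum>u<t. fst (snd (deg_at c u))) div 2\<bar>"

definition sign_v :: "corner \<Rightarrow> nat \<Rightarrow> mpoly" where
  "sign_v c t = (-1) ^ nat \<bar>(\<Sum>u<t. snd (snd (deg_at c u))) div 2\<bar>"

definition d_h :: "corner vec \<Rightarrow> corner vec" where
  "d_h x = (\<Sum>c \<in> Poly_Mapping.keys x. \<Sum>t \<in> {..<ncross B} - fst c.
     Poly_Mapping.single (insert t (fst c), snd c)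
       (sign_h c t * coef_h t (t \<in> snd c) * Poly_Mapping.lookup x c))"

definition d_v :: "corner vec \<Rightarrow> corner vec" where
  "d_v x = (\<Sum>c \<in> Poly_Mapping.keys x. \<Sum>t \<in> {..<ncross B} - snd c.
     Poly_Mapping.single (fst c, insert t (snd c))
       (sign_v c t * coef_v t (t \<in> fst c) * Poly_Mapping.lookup x c))"

text \<open>
  The double complex with coefficients in \<open>A / (\<rho>(c\<^sub>1), \<dots>, \<rho>(c\<^sub>n))\<close>, where \<open>A\<close> is the polynomial ring
  in all edge variables (giving \<open>R(B)\<close>) or in their differences with \<open>X\<^sub>1\<close> (giving \<open>R\<^sub>r(B)\<close>).
\<close>

definition edge_poly :: "mpoly set" where
  "edge_poly = adjoin (Var ` {1..nedges B})"

definition edge_poly_red :: "mpoly set" where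
  "edge_poly_red = adjoin ((\<lambda>l. Var l - Var 1) ` {2..nedges B})"

definition cplx :: "mpoly set \<Rightarrow> (int \<times> int \<times> int, corner vec) grmod" where
  "cplx A =
     \<lparr>num = vecs A corners,
      den = vecs (ideal_gen A (rho ` {..<ncross B})) corners,
      cmp = (\<lambda>(i, j, k). {x. \<forall>c \<in> Poly_Mapping.keys x.
               snd (gen_deg c) = (j, k) \<and>
               homogeneous (i - fst (gen_deg c)) (Poly_Mapping.lookup x c)})\<rparr>"

definition C0 :: "(int \<times> int \<times> int, corner vec) grmod" where
  "C0 = cplx edge_poly"

definition Cr :: "(int \<times> int \<times> int, corner vec) grmod" where
  "Cr = cplx edge_poly_red"

section \<open>Middle HOMFLYPT homology and Betti numbers\<close>

definition H_mid :: "(int \<times> int \<times> int, corner vec) grmod" where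
  "H_mid = (let w = writhe B; s = int (strands B) in
     shift (- w + s, w + s - 1, w - s + 1) (homology d_v (homology d_h C0)))"

definition H_red :: "(int \<times> int \<times> int, corner vec) grmod" where
  "H_red = (let w = writhe B; s = int (strands B) in
     shift (- w + s - 1, w + s - 1, w - s + 1) (homology d_v (homology d_h Cr)))"

text \<open>Rasmussen's reduced HOMFLYPT homology, which is only considered for connected diagrams.\<close>

definition H_bar :: "(int \<times> int \<times> int, corner vec) grmod" where
  "H_bar = (if connected_diagram B
     then (let w = writhe B; s = int (strands B) in
       shift (- w + s - 1, w + s - 1, w - s + 1) (homology d_v (homology d_h Cr)))
     else undefined)"

definition comp_ring :: "mpoly set" where
  "comp_ring = adjoin (Var ` {1..ncomp B})"

definition comp_ring_red :: "mpoly set" where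
  "comp_ring_red = adjoin ((\<lambda>l. Var l - Var 1) ` {2..ncomp B})"

definition max_ideal :: "mpoly set" where
  "max_ideal = ideal_gen comp_ring (Var ` {1..ncomp B})"

definition max_ideal_red :: "mpoly set" where
  "max_ideal_red = ideal_gen comp_ring_red ((\<lambda>l. Var l - Var 1) ` {2..ncomp B})"

definition betti :: "nat \<Rightarrow> int \<Rightarrow> int \<Rightarrow> int \<Rightarrow> enat" where
  "betti p q j k = comp_dim (Tor comp_ring max_ideal (row H_mid j k) p) q"

definition betti_red :: "nat \<Rightarrow> int \<Rightarrow> int \<Rightarrow> int \<Rightarrow> enat" where
  "betti_red p q j k = comp_dim (Tor comp_ring_red max_ideal_red (row H_red j k) p) q"

end

end

theory Submission
  imports Defs "HOL-Library.Countable_Set"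
begin

text \<open>
  All differentials of the double complex have coefficients in the subring generated by the
  differences of the edge variables, and \<open>X\<^sub>1\<close> is transcendental over that subring. Hence every
  element of \<open>C\<^sub>0(B)\<close> is uniquely a polynomial in \<open>X\<^sub>1\<close> with coefficients in \<open>C\<^sub>r(B)\<close>, this expansion
  commutes with both differentials, and so \<open>H(B) = H\<^sub>r(B) \<otimes> \<rat>[X\<^sub>1]\<close> up to the shift by 1. A free
  resolution of \<open>H\<^sub>r(B)\<close> over \<open>\<rat>[X\<^sub>2 - X\<^sub>1, \<dots>, X\<^sub>m - X\<^sub>1]\<close> therefore extends to one of \<open>H(B)\<close> over
  \<open>\<rat>[X\<^sub>1, \<dots>, X\<^sub>m]\<close>, and both reduce to the same complex of rational vector spaces modulo the
  maximal ideals. For a knot the reduced ring is \<open>\<rat>\<close>, so \<open>H\<^sub>r(B)\<close> is free over it.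
\<close>

section \<open>Dimensions of quotients\<close>

text \<open>Homology is never formed as a set of cosets: every module is a numerator and a
  denominator inside one free module. Extension of scalars by \<open>X_1\<close> must therefore be
  an operation on sets of vectors that commutes with kernels, images and sums. Horner form
  \<open>u + X_1 * x\<close> supplies it: uniqueness of one Horner step reduces each such
  commutation to an induction. That uniqueness needs restricted heads \<open>u\<close>, so reduced
  modules are kept inside the vectors with \<open>invariant\<close> coefficients.

  A second obstacle is that dimensions and Tor come from arbitrarily chosen bases and resolutions.
  The extended resolution says something about Betti numbers only once resolutions are known to
  exist and any two are known to give the same dimension in each degree; all lifts must therefore be
  homogeneous.

  \<open>R_B\<close> is generated by the first \<open>m\<close> edge variables, so its action on
  \<open>H(B)\<close> is restriction of scalars from the edge polynomial ring.

  The shift in \<open>q\<close> comes solely from the normalizations \<open>- w + s\<close> and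
  \<open>- w + s - 1\<close>; multiplication by \<open>X_1\<close> adds none, since it is zero
  modulo the maximal ideal.\<close>

lemma quot_basis_exists:
  assumes U: "vecQ.subspace U" and W: "vecQ.subspace W"
  shows "\<exists>X. quot_basis U W X"
proof -
  obtain C where C: "C \<subseteq> U \<inter> W" "vecQ.independent C" "U \<inter> W \<subseteq> vecQ.span C"
    using vecQ.maximal_independent_subset by metis
  \<comment> \<open>Extending a basis \<open>C\<close> of \<open>U \<inter> W\<close> to a basis
    \<open>E\<close> of \<open>U\<close>, the added vectors \<open>E - C\<close> represent
    \<open>U\<close> modulo \<open>W\<close>.\<close>
  obtain E where E: "C \<subseteq> E" "E \<subseteq> U" "vecQ.independent E" "U \<subseteq> vecQ.span E"
    using vecQ.maximal_independent_subset_extend[of C U] C by blast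
  have ind: "vecQ.independent (E - C)"
    using E(3) vecQ.independent_mono by blast
  have "vecQ.span (E - C) \<inter> W \<subseteq> {0}"
  proof
    fix x assume x: "x \<in> vecQ.span (E - C) \<inter> W"
    then have "x \<in> U"
      using E(2) U vecQ.span_minimal[of "E - C" U] by blast
    then have xC: "x \<in> vecQ.span C" using x C(3) by blast
    define r where "r = vecQ.representation E x"
    \<comment> \<open>\<open>x\<close> lies in the spans of the disjoint subsets
      \<open>E - C\<close> and \<open>C\<close> of the independent set \<open>E\<close>, so its
      coordinates with respect to \<open>E\<close> are supported on both and vanish.\<close>
    have "vecQ.representation E x = vecQ.representation (E - C) x"
      using E(3) x by (intro vecQ.representation_extend) auto
    moreover have "vecQ.representation E x = vecQ.representation C x"
      using E(1,3) xC by (intro vecQ.representation_extend) auto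
    ultimately have "vecQ.representation E x b = 0" for b
      by (metis DiffE vecQ.representation_ne_zero)
    then show "x \<in> {0}"
      using vecQ.sum_nonzero_representation_eq[OF E(3), of x] x E(1) vecQ.span_mono[of "E - C" E]
      by auto
  qed
  moreover have "U \<subseteq> vecQ.span ((E - C) \<union> W)"
    using E(4) vecQ.span_mono[of E "(E - C) \<union> W"] C(1) by blast
  ultimately have "quot_basis U W (E - C)" using ind E(2) unfolding quot_basis_def by auto
  then show ?thesis ..
qed

text \<open>
  Using a relation instead of a map covers injections of \<open>U / W\<close> into \<open>U' / W'\<close> as well as
  surjections of \<open>U' / W'\<close> onto \<open>U / W\<close>.
\<close>

lemma quot_dim_le:
  fixes U W :: "'b vec set" and U' W' :: "'c vec set" and R :: "'b vec \<Rightarrow> 'c vec \<Rightarrow> bool"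
  assumes U: "vecQ.subspace U" and W: "vecQ.subspace W"
    and U': "vecQ.subspace U'" and W': "vecQ.subspace W'"
    and ex: "\<And>x. x \<in> U \<Longrightarrow> \<exists>y \<in> U'. R x y"
    and zero: "R 0 0"
    and add: "\<And>x y x' y'. R x y \<Longrightarrow> R x' y' \<Longrightarrow> R (x + x') (y + y')"
    and scale: "\<And>c x y. R x y \<Longrightarrow> R (scaleQ c x) (scaleQ c y)"
    and refl: "\<And>x y. x \<in> U \<Longrightarrow> R x y \<Longrightarrow> y \<in> W' \<Longrightarrow> x \<in> W"
  shows "quot_dim U W \<le> quot_dim U' W'"
proof -
  define X where "X = (SOME X. quot_basis U W X)"
  define X' where "X' = (SOME X. quot_basis U' W' X)"
  have X: "quot_basis U W X" and X': "quot_basis U' W' X'"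
    unfolding X_def X'_def using someI_ex[OF quot_basis_exists] U W U' W' by blast+
  have dim: "quot_dim U W = (if finite X then enat (card X) else \<infinity>)"
    "quot_dim U' W' = (if finite X' then enat (card X') else \<infinity>)"
    unfolding quot_dim_def X_def X'_def Let_def by auto
  show ?thesis
  proof (cases "finite X'")
    case False
    then show ?thesis using dim by simp
  next
    case fin: True
    \<comment> \<open>Each \<open>x\<close> gets a partner \<open>r\<close> in \<open>U'\<close> and
      a representative \<open>s\<close> of the coset of \<open>r\<close> in the finite-dimensional
      span of \<open>X'\<close>.\<close>
    have "\<exists>s. \<exists>r\<in>U'. R x r \<and> s \<in> vecQ.span X' \<and> r - s \<in> W'" if "x \<in> X" for x
    proof -
      obtain r where r: "r \<in> U'" "R x r"
        using ex X \<open>x \<in> X\<close> unfolding quot_basis_def by blast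
      then have "r \<in> vecQ.span (X' \<union> W')"
        using X' unfolding quot_basis_def by blast
      then obtain a b where "r = a + b" "a \<in> vecQ.span X'" "b \<in> vecQ.span W'"
        unfolding vecQ.span_Un by blast
      moreover from this have "b \<in> W'" using W' by (metis vecQ.span_eq_iff)
      ultimately show ?thesis using r by (intro exI[of _ a] bexI[of _ r]) auto
    qed
    then obtain s where "\<forall>x\<in>X. \<exists>r\<in>U'. R x r \<and> s x \<in> vecQ.span X' \<and> r - s x \<in> W'"
      using bchoice[of X "\<lambda>x s. \<exists>r\<in>U'. R x r \<and> s \<in> vecQ.span X' \<and> r - s \<in> W'"] by blast
    then obtain r where
      r: "\<And>x. x \<in> X \<Longrightarrow> r x \<in> U' \<and> R x (r x) \<and> s x \<in> vecQ.span X' \<and> r x - s x \<in> W'"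
      using bchoice[of X "\<lambda>x r. r \<in> U' \<and> R x r \<and> s x \<in> vecQ.span X' \<and> r - s x \<in> W'"] by blast
    \<comment> \<open>A linear relation among the \<open>s x\<close> puts the same combination of
      the \<open>r x\<close> into \<open>W'\<close>; by \<open>refl\<close> the combination of the
      \<open>x\<close> is in \<open>W\<close>, and \<open>X\<close> is independent modulo
      \<open>W\<close>.\<close>
    have key: "\<forall>x\<in>T. c x = 0"
      if T: "finite T" "T \<subseteq> X" and sum0: "(\<Sum>x\<in>T. scaleQ (c x) (s x)) = 0" for T c
    proof -
      have "(\<Sum>x\<in>T. scaleQ (c x) (r x)) = (\<Sum>x\<in>T. scaleQ (c x) (r x - s x))"
        using sum0 by (simp add: vecQ.scale_right_diff_distrib sum_subtractf)
      also have "\<dots> \<in> W'"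
        using r T W' by (intro vecQ.subspace_sum vecQ.subspace_scale) auto
      finally have inW': "(\<Sum>x\<in>T. scaleQ (c x) (r x)) \<in> W'" .
      have "R (\<Sum>x\<in>T. scaleQ (c x) x) (\<Sum>x\<in>T. scaleQ (c x) (r x))"
        using T by (induction T rule: finite_induct) (auto intro!: zero add scale simp: r)
      moreover have "(\<Sum>x\<in>T. scaleQ (c x) x) \<in> U"
        using T X U unfolding quot_basis_def by (intro vecQ.subspace_sum vecQ.subspace_scale) auto
      ultimately have "(\<Sum>x\<in>T. scaleQ (c x) x) \<in> W" using refl inW' by blast
      moreover have "(\<Sum>x\<in>T. scaleQ (c x) x) \<in> vecQ.span X"
        using T by (intro vecQ.span_sum vecQ.span_scale vecQ.span_base) auto
      ultimately have "(\<Sum>x\<in>T. scaleQ (c x) x) = 0"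
        using X unfolding quot_basis_def by blast
      then show ?thesis
        using vecQ.independentD[of X T c] X T unfolding quot_basis_def by blast
    qed
    have card_le: "card T \<le> card X'" if T: "finite T" "T \<subseteq> X" for T
    proof -
      have inj: "inj_on s T"
      proof (rule inj_onI, rule ccontr)
        fix x y assume xy: "x \<in> T" "y \<in> T" "s x = s y" "x \<noteq> y"
        have "(\<Sum>z\<in>{x, y}. scaleQ (if z = x then 1 else -1) (s z)) = 0"
          using xy by simp
        then show False using key[of "{x, y}" "\<lambda>z. if z = x then 1 else -1"] xy T by auto
      qed
      have "vecQ.independent (s ` T)"
        unfolding vecQ.independent_explicit_finite_subsets
      proof (intro allI impI ballI)
        fix V u v assume V: "V \<subseteq> s ` T" "finite V" "(\<Sum>v\<in>V. scaleQ (u v) v) = 0" "v \<in> V"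
        obtain T' where T': "T' \<subseteq> T" "V = s ` T'" using V(1) subset_image_iff by metis
        have "(\<Sum>x\<in>T'. scaleQ (u (s x)) (s x)) = 0"
          using V(3) T' inj by (simp add: sum.reindex inj_on_subset)
        then show "u v = 0"
          using key[of T' "\<lambda>x. u (s x)"] T' T V(4) finite_subset by blast
      qed
      then have "card (s ` T) \<le> card X'"
        using vecQ.independent_span_bound[OF fin, of "s ` T"] r T by blast
      then show ?thesis using card_image[OF inj] by simp
    qed
    then have "finite X \<and> card X \<le> card X'"
      by (intro finite_if_finite_subsets_card_bdd) auto
    then show ?thesis using dim fin by simp
  qed
qed

lemma quot_dim_self:
  assumes "vecQ.subspace W" "U \<subseteq> W" "vecQ.subspace U"
  shows "quot_dim U W = 0"
proof -
  define X where "X = (SOME X. quot_basis U W X)"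
  have X: "quot_basis U W X"
    unfolding X_def using someI_ex[OF quot_basis_exists] assms by blast
  have "X = {}"
  proof (rule ccontr)
    assume "X \<noteq> {}"
    then obtain x where "x \<in> X" by blast
    then have "x \<in> vecQ.span X" "x \<in> W"
      using X assms(2) vecQ.span_base[of x X] unfolding quot_basis_def by auto
    then have "x = 0" using X unfolding quot_basis_def by auto
    then show False
      using \<open>x \<in> X\<close> X vecQ.dependent_zero[of X] unfolding quot_basis_def by auto
  qed
  then show ?thesis unfolding quot_dim_def X_def[symmetric] by (simp add: Let_def flip: zero_enat_def)
qed

section \<open>Free modules\<close>

lemma smult_add_right: "smult a (x + y) = smult a x + smult a y"
  by (rule poly_mapping_eqI) (simp add: lookup_smult lookup_add distrib_left)

lemma smult_add_left: "smult (a + b) x = smult a x + smult b x"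
  by (rule poly_mapping_eqI) (simp add: lookup_smult lookup_add distrib_right)

lemma smult_diff_right: "smult a (x - y) = smult a x - smult a y"
  by (rule poly_mapping_eqI) (simp add: lookup_smult lookup_minus right_diff_distrib)

lemma smult_smult: "smult a (smult b x) = smult (a * b) x"
  by (rule poly_mapping_eqI) (simp add: lookup_smult mult.assoc)

lemma smult_zero_right [simp]: "smult a 0 = 0"
  by (rule poly_mapping_eqI) (simp add: lookup_smult)

lemma smult_zero_left [simp]: "smult 0 x = 0"
  by (rule poly_mapping_eqI) (simp add: lookup_smult)

lemma smult_one [simp]: "smult 1 x = x"
  by (rule poly_mapping_eqI) (simp add: lookup_smult)

lemma smult_minus_one: "smult (- 1) x = - x"
  by (rule poly_mapping_eqI) (simp add: lookup_smult)

lemma smult_single: "smult a (Poly_Mapping.single b c) = Poly_Mapping.single b (a * c)"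
  by (rule poly_mapping_eqI) (simp add: lookup_smult lookup_single when_def)

lemma smult_sum: "smult a (\<Sum>i\<in>I. f i) = (\<Sum>i\<in>I. smult a (f i))"
  by (induction I rule: infinite_finite_induct) (auto simp: smult_add_right)

lemma keys_smult: "Poly_Mapping.keys (smult a x) \<subseteq> Poly_Mapping.keys x"
  by (auto simp: in_keys_iff lookup_smult)

lemma Cst_zero [simp]: "Cst 0 = 0" and Cst_one [simp]: "Cst 1 = 1"
  by (simp_all add: Cst_def)

lemma Cst_minus_one [simp]: "Cst (- 1) = - 1"
  by (simp add: Cst_def single_uminus)

lemma subspaceI_smult:
  assumes "0 \<in> N" "\<And>x y. x \<in> N \<Longrightarrow> y \<in> N \<Longrightarrow> x + y \<in> N"
    "\<And>c x. x \<in> N \<Longrightarrow> smult (Cst c) x \<in> N"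
  shows "vecQ.subspace N"
  using assms by (intro vecQ.subspaceI) (auto simp: scaleQ_def)

text \<open>Total and linear with respect to all polynomial coefficients, so one map serves
  simultaneously over a ring and over every larger ring, without membership conditions.\<close>

definition linext :: "('b \<Rightarrow> 'c vec) \<Rightarrow> 'b vec \<Rightarrow> 'c vec" where
  "linext D x = (\<Sum>b\<in>Poly_Mapping.keys x. smult (Poly_Mapping.lookup x b) (D b))"

lemma linext_superset:
  assumes "finite S" "Poly_Mapping.keys x \<subseteq> S"
  shows "linext D x = (\<Sum>b\<in>S. smult (Poly_Mapping.lookup x b) (D b))"
  unfolding linext_def using assms
  by (intro sum.mono_neutral_left) (auto simp: in_keys_iff)

lemma linext_zero [simp]: "linext D 0 = 0"
  by (simp add: linext_def)

lemma linext_add: "linext D (x + y) = linext D x + linext D y"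
proof -
  let ?S = "Poly_Mapping.keys x \<union> Poly_Mapping.keys y"
  show ?thesis
    using linext_superset[of ?S x D] linext_superset[of ?S y D]
      linext_superset[of ?S "x + y" D] keys_add[of x y]
    by (simp add: lookup_add smult_add_left sum.distrib)
qed

lemma linext_smult: "linext D (smult a x) = smult a (linext D x)"
  using linext_superset[of "Poly_Mapping.keys x" "smult a x" D] keys_smult[of a x]
  by (simp add: linext_def lookup_smult smult_smult smult_sum)

lemma linext_diff: "linext D (x - y) = linext D x - linext D y"
  using linext_add[of D x "smult (- 1) y"] linext_smult[of D "- 1" y] by (simp add: smult_minus_one)

lemma linext_single: "linext D (Poly_Mapping.single b a) = smult a (D b)"
  by (cases "a = 0") (auto simp: linext_def)

lemma linext_basis [simp]: "linext D (Poly_Mapping.single b 1) = D b"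
  by (simp add: linext_single)

lemma linear_over_linext: "linear_over A U (linext D)"
  by (simp add: linear_over_def linext_add linext_smult)

definition submodule :: "mpoly set \<Rightarrow> 'b vec set \<Rightarrow> bool" where
  "submodule A N \<longleftrightarrow>
     0 \<in> N \<and> (\<forall>x\<in>N. \<forall>y\<in>N. x + y \<in> N) \<and> (\<forall>a\<in>A. \<forall>x\<in>N. smult a x \<in> N)"

lemma submodule_zero: "submodule A N \<Longrightarrow> 0 \<in> N"
  and submodule_add: "submodule A N \<Longrightarrow> x \<in> N \<Longrightarrow> y \<in> N \<Longrightarrow> x + y \<in> N"
  and submodule_smult: "submodule A N \<Longrightarrow> a \<in> A \<Longrightarrow> x \<in> N \<Longrightarrow> smult a x \<in> N"
  by (auto simp: submodule_def)

lemma submodule_sum: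
  "submodule A N \<Longrightarrow> (\<And>i. i \<in> I \<Longrightarrow> f i \<in> N) \<Longrightarrow> (\<Sum>i\<in>I. f i) \<in> N"
  by (induction I rule: infinite_finite_induct) (auto simp: submodule_zero submodule_add)

lemma submodule_linext:
  assumes "submodule A N" "x \<in> vecs A S" "\<And>b. b \<in> S \<Longrightarrow> D b \<in> N"
  shows "linext D x \<in> N"
  using assms unfolding linext_def vecs_def
  by (intro submodule_sum[of A] submodule_smult[of A]) auto

lemma linext_self: "linext (\<lambda>b. Poly_Mapping.single b 1) x = x"
  by (rule poly_mapping_eqI)
    (auto simp: linext_def lookup_sum lookup_smult lookup_single when_def in_keys_iff
      if_distrib[of "(*) _"] sum.delta cong: if_cong)

section \<open>Homogeneous parts\<close>

definition mdeg :: "(nat \<Rightarrow>\<^sub>0 nat) \<Rightarrow> int" where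
  "mdeg \<mu> = (\<Sum>l\<in>Poly_Mapping.keys \<mu>. 2 * int (Poly_Mapping.lookup \<mu> l))"

lemma homogeneous_iff: "homogeneous d f \<longleftrightarrow> (\<forall>\<mu>\<in>Poly_Mapping.keys f. mdeg \<mu> = d)"
  by (simp add: homogeneous_def mdeg_def)

lemma mdeg_superset:
  assumes "finite S" "Poly_Mapping.keys \<mu> \<subseteq> S"
  shows "mdeg \<mu> = (\<Sum>l\<in>S. 2 * int (Poly_Mapping.lookup \<mu> l))"
  unfolding mdeg_def using assms
  by (intro sum.mono_neutral_left) (auto simp: in_keys_iff)

lemma mdeg_add: "mdeg (\<mu> + \<nu>) = mdeg \<mu> + mdeg \<nu>"
proof -
  let ?S = "Poly_Mapping.keys \<mu> \<union> Poly_Mapping.keys \<nu>"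
  show ?thesis
    using mdeg_superset[of ?S \<mu>] mdeg_superset[of ?S \<nu>] mdeg_superset[of ?S "\<mu> + \<nu>"]
      keys_add[of \<mu> \<nu>]
    by (simp add: lookup_add sum.distrib distrib_left)
qed

lemma homogeneous_zero [simp]: "homogeneous d 0"
  by (simp add: homogeneous_iff)

lemma homogeneous_add: "homogeneous d f \<Longrightarrow> homogeneous d g \<Longrightarrow> homogeneous d (f + g)"
  using keys_add[of f g] by (auto simp: homogeneous_iff)

lemma homogeneous_uminus: "homogeneous d f \<Longrightarrow> homogeneous d (- f)"
  by (auto simp: homogeneous_iff in_keys_iff)

lemma homogeneous_diff: "homogeneous d f \<Longrightarrow> homogeneous d g \<Longrightarrow> homogeneous d (f - g)"
  using homogeneous_add[of d f "- g"] homogeneous_uminus by simp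

lemma homogeneous_mult: "homogeneous d f \<Longrightarrow> homogeneous e g \<Longrightarrow> homogeneous (d + e) (f * g)"
  using keys_mult[of f g] by (fastforce simp: homogeneous_iff mdeg_add)

lemma homogeneous_sum: "(\<And>i. i \<in> I \<Longrightarrow> homogeneous d (f i)) \<Longrightarrow> homogeneous d (\<Sum>i\<in>I. f i)"
  by (induction I rule: infinite_finite_induct) (auto simp: homogeneous_add)

lemma homogeneous_Cst: "homogeneous 0 (Cst c)"
  by (simp add: homogeneous_iff Cst_def mdeg_def)

lemma homogeneous_Var: "homogeneous 2 (Var l)"
  by (simp add: homogeneous_iff Var_def mdeg_def)

definition hpart :: "int \<Rightarrow> mpoly \<Rightarrow> mpoly" where
  "hpart d = Poly_Mapping.mapp (\<lambda>\<mu> c. c when mdeg \<mu> = d)"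

lemma lookup_hpart:
  "Poly_Mapping.lookup (hpart d f) \<mu> = (if mdeg \<mu> = d then Poly_Mapping.lookup f \<mu> else 0)"
  by (auto simp: hpart_def lookup_mapp when_def in_keys_iff)

lemma hpart_zero [simp]: "hpart d 0 = 0"
  by (rule poly_mapping_eqI) (simp add: lookup_hpart)

lemma hpart_add: "hpart d (f + g) = hpart d f + hpart d g"
  by (rule poly_mapping_eqI) (simp add: lookup_hpart lookup_add)

lemma hpart_sum: "hpart d (\<Sum>i\<in>I. f i) = (\<Sum>i\<in>I. hpart d (f i))"
  by (induction I rule: infinite_finite_induct) (auto simp: hpart_add)

lemma homogeneous_hpart: "homogeneous d (hpart d f)"
  by (auto simp: homogeneous_iff in_keys_iff lookup_hpart split: if_splits)

lemma hpart_homogeneous: "homogeneous e f \<Longrightarrow> hpart d f = (if d = e then f else 0)"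
  by (rule poly_mapping_eqI) (auto simp: homogeneous_iff in_keys_iff lookup_hpart)

lemma hpart_decomp:
  assumes "finite E" "mdeg ` Poly_Mapping.keys f \<subseteq> E"
  shows "f = (\<Sum>d\<in>E. hpart d f)"
proof (rule poly_mapping_eqI)
  fix \<mu>
  show "Poly_Mapping.lookup f \<mu> = Poly_Mapping.lookup (\<Sum>d\<in>E. hpart d f) \<mu>"
    using assms by (auto simp: lookup_sum lookup_hpart sum.delta image_subset_iff in_keys_iff)
qed

definition gcmp :: "('b \<Rightarrow> int) \<Rightarrow> int \<Rightarrow> 'b vec set" where
  "gcmp deg q = {x. \<forall>b\<in>Poly_Mapping.keys x. homogeneous (q - deg b) (Poly_Mapping.lookup x b)}"

lemma res_cmp_eq: "res_cmp P p q = gcmp (bdeg P p) q"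
  by (simp add: res_cmp_def gcmp_def)

lemma gcmp_iff: "x \<in> gcmp deg q \<longleftrightarrow> (\<forall>b. homogeneous (q - deg b) (Poly_Mapping.lookup x b))"
  unfolding gcmp_def mem_Collect_eq by (metis homogeneous_zero in_keys_iff)

lemma gcmp_shift: "gcmp (\<lambda>b. deg b + d) q = gcmp deg (q - d)"
  by (simp add: gcmp_def algebra_simps)

lemma gcmp_zero: "0 \<in> gcmp deg q"
  by (simp add: gcmp_iff)

lemma gcmp_add: "x \<in> gcmp deg q \<Longrightarrow> y \<in> gcmp deg q \<Longrightarrow> x + y \<in> gcmp deg q"
  by (simp add: gcmp_iff lookup_add homogeneous_add)

lemma gcmp_smult: "homogeneous d a \<Longrightarrow> x \<in> gcmp deg q \<Longrightarrow> smult a x \<in> gcmp deg (q + d)"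
  using homogeneous_mult[of d a "q - deg b" "Poly_Mapping.lookup x b" for b]
  by (force simp: gcmp_iff lookup_smult algebra_simps)

lemma gcmp_sum: "(\<And>i. i \<in> I \<Longrightarrow> f i \<in> gcmp deg q) \<Longrightarrow> (\<Sum>i\<in>I. f i) \<in> gcmp deg q"
  by (simp add: gcmp_iff lookup_sum homogeneous_sum)

lemma gcmp_single: "homogeneous (q - deg b) a \<Longrightarrow> Poly_Mapping.single b a \<in> gcmp deg q"
  by (simp add: gcmp_iff lookup_single when_def)

lemma gcmp_basis: "Poly_Mapping.single b 1 \<in> gcmp deg (deg b)"
  using homogeneous_Cst[of 1] by (intro gcmp_single) simp

lemma subspace_gcmp: "vecQ.subspace (gcmp deg q)"
  using gcmp_smult[OF homogeneous_Cst] by (intro subspaceI_smult) (auto simp: gcmp_zero gcmp_add)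

definition gpart :: "('b \<Rightarrow> int) \<Rightarrow> int \<Rightarrow> 'b vec \<Rightarrow> 'b vec" where
  "gpart deg q = Poly_Mapping.mapp (\<lambda>b. hpart (q - deg b))"

lemma lookup_gpart:
  "Poly_Mapping.lookup (gpart deg q x) b = hpart (q - deg b) (Poly_Mapping.lookup x b)"
  by (auto simp: gpart_def lookup_mapp when_def in_keys_iff)

lemma keys_gpart: "Poly_Mapping.keys (gpart deg q x) \<subseteq> Poly_Mapping.keys x"
  unfolding gpart_def by (rule keys_mapp_subset)

lemma gpart_zero [simp]: "gpart deg q 0 = 0"
  by (rule poly_mapping_eqI) (simp add: lookup_gpart)

lemma gpart_add: "gpart deg q (x + y) = gpart deg q x + gpart deg q y"
  by (rule poly_mapping_eqI) (simp add: lookup_gpart lookup_add hpart_add)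

lemma gpart_diff: "gpart deg q (x - y) = gpart deg q x - gpart deg q y"
  using gpart_add[of deg q "x - y" y] by (simp add: algebra_simps)

lemma gpart_sum: "gpart deg q (\<Sum>i\<in>I. f i) = (\<Sum>i\<in>I. gpart deg q (f i))"
  by (induction I rule: infinite_finite_induct) (auto simp: gpart_add)

lemma gpart_gcmp: "gpart deg q x \<in> gcmp deg q"
  by (simp add: gcmp_iff lookup_gpart homogeneous_hpart)

lemma gpart_of_gcmp:
  assumes "x \<in> gcmp deg q"
  shows "gpart deg q' x = (if q' = q then x else 0)"
proof (rule poly_mapping_eqI)
  fix b
  show "Poly_Mapping.lookup (gpart deg q' x) b = Poly_Mapping.lookup (if q' = q then x else 0) b"
    using assms hpart_homogeneous[of "q - deg b" "Poly_Mapping.lookup x b" "q' - deg b"]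
    by (auto simp: lookup_gpart gcmp_iff)
qed

lemma gpart_decomp: "\<exists>Q. finite Q \<and> x = (\<Sum>q\<in>Q. gpart deg q x)"
proof -
  let ?E = "\<lambda>b. (\<lambda>\<mu>. mdeg \<mu> + deg b) ` Poly_Mapping.keys (Poly_Mapping.lookup x b)"
  \<comment> \<open>Only finitely many degrees occur: those of the monomials present, each raised by
    the degree of its basis vector.\<close>
  define Q where "Q = (\<Union>b\<in>Poly_Mapping.keys x. ?E b)"
  have fin: "finite Q" by (simp add: Q_def)
  have "Poly_Mapping.lookup x b = (\<Sum>q\<in>Q. hpart (q - deg b) (Poly_Mapping.lookup x b))" for b
  proof (cases "b \<in> Poly_Mapping.keys x")
    case True
    then have "mdeg ` Poly_Mapping.keys (Poly_Mapping.lookup x b) \<subseteq> (\<lambda>q. q - deg b) ` Q"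
      by (force simp: Q_def image_iff)
    from hpart_decomp[OF _ this] fin
    have "Poly_Mapping.lookup x b
        = (\<Sum>d\<in>(\<lambda>q. q - deg b) ` Q. hpart d (Poly_Mapping.lookup x b))" by simp
    then show ?thesis by (subst (asm) sum.reindex) (auto simp: inj_on_def)
  next
    case False
    then show ?thesis by (simp add: in_keys_iff)
  qed
  then have "x = (\<Sum>q\<in>Q. gpart deg q x)"
    by (intro poly_mapping_eqI) (simp add: lookup_sum lookup_gpart)
  then show ?thesis using fin by blast
qed

text \<open>\<open>L\<close> sends the degree \<open>q\<close> summand of \<open>x\<close> into
  degree \<open>q + d\<close>, so projecting \<open>L x\<close> selects exactly that summand. The
  carrier \<open>F\<close> is there because differentials of a resolution are controlled only on
  their free modules.\<close>

lemma gpart_commute: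
  assumes add: "\<And>x y. x \<in> F \<Longrightarrow> y \<in> F \<Longrightarrow> L (x + y) = L x + L y"
    and F: "0 \<in> F" "\<And>x y. x \<in> F \<Longrightarrow> y \<in> F \<Longrightarrow> x + y \<in> F" "\<And>x q. x \<in> F \<Longrightarrow> gpart deg q x \<in> F"
    and deg: "\<And>x q. x \<in> F \<Longrightarrow> x \<in> gcmp deg q \<Longrightarrow> L x \<in> gcmp deg' (q + d)"
    and x: "x \<in> F"
  shows "L (gpart deg q x) = gpart deg' (q + d) (L x)"
proof -
  obtain Q where Q: "finite Q" "x = (\<Sum>q\<in>Q. gpart deg q x)" using gpart_decomp by blast
  have L0: "L 0 = 0" using add[of 0 0] F(1) by simp
  have "(\<Sum>q\<in>Q. gpart deg q x) \<in> F \<and> L (\<Sum>q\<in>Q. gpart deg q x) = (\<Sum>q\<in>Q. L (gpart deg q x))"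
    using Q(1) by (induction Q rule: finite_induct) (auto simp: L0 F add x)
  then have "L x = (\<Sum>q\<in>Q. L (gpart deg q x))" using Q(2) by simp
  then have "gpart deg' (q + d) (L x) = (\<Sum>r\<in>Q. gpart deg' (q + d) (L (gpart deg r x)))"
    by (simp add: gpart_sum)
  also have "\<dots> = (\<Sum>r\<in>Q. if q = r then L (gpart deg r x) else 0)"
    using gpart_of_gcmp[OF deg[OF F(3)[OF x] gpart_gcmp], of "q + d" for q]
    by (intro sum.cong) auto
  also have "\<dots> = (if q \<in> Q then L (gpart deg q x) else 0)" using Q(1) by simp
  also have "\<dots> = L (gpart deg q x)"
  \<comment> \<open>For \<open>q\<close> outside \<open>Q\<close> the degree \<open>q\<close> part
    of \<open>x\<close> is itself zero, so the empty contribution is correct.\<close>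
  proof (cases "q \<in> Q")
    case False
    have "gpart deg q x = (\<Sum>r\<in>Q. gpart deg q (gpart deg r x))"
      using arg_cong[OF Q(2), of "gpart deg q"] by (simp add: gpart_sum)
    also have "\<dots> = 0" using False
      by (intro sum.neutral) (auto simp: gpart_of_gcmp[OF gpart_gcmp])
    finally show ?thesis using False L0 by simp
  qed simp
  finally show ?thesis by simp
qed

section \<open>Graded submodules\<close>

lemma linear_over_zero: "linear_over A U L \<Longrightarrow> 0 \<in> U \<Longrightarrow> L 0 = 0"
  unfolding linear_over_def by (metis add.right_neutral add_left_cancel)

lemma linear_over_add: "linear_over A U L \<Longrightarrow> x \<in> U \<Longrightarrow> y \<in> U \<Longrightarrow> L (x + y) = L x + L y"
  and linear_over_smult: "linear_over A U L \<Longrightarrow> a \<in> A \<Longrightarrow> x \<in> U \<Longrightarrow> L (smult a x) = smult a (L x)"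
  by (auto simp: linear_over_def)

lemma linear_over_sum:
  assumes "linear_over A U L" "submodule A U" "\<And>i. i \<in> I \<Longrightarrow> f i \<in> U"
  shows "L (\<Sum>i\<in>I. f i) = (\<Sum>i\<in>I. L (f i))"
  using assms(3)
  by (induction I rule: infinite_finite_induct)
    (auto simp: linear_over_zero[OF assms(1)] linear_over_add[OF assms(1)] submodule_zero[OF assms(2)]
      submodule_sum[OF assms(2)])

lemma linext_linext: "linext D (linext E x) = linext (\<lambda>b. linext D (E b)) x"
proof -
  have "linext D (\<Sum>b\<in>B. smult (a b) (E b)) = (\<Sum>b\<in>B. smult (a b) (linext D (E b)))" for B a
    by (induction B rule: infinite_finite_induct) (auto simp: linext_add linext_smult)
  then show ?thesis by (simp add: linext_def[of E] linext_def[of "\<lambda>b. linext D (E b)"])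
qed

lemma linext_diff_fun: "linext (\<lambda>b. D b - E b) x = linext D x - linext E x"
  by (simp add: linext_def smult_diff_right sum_subtractf)

lemma linext_gcmp:
  assumes "x \<in> vecs A S" "x \<in> gcmp deg q" "\<And>b. b \<in> S \<Longrightarrow> D b \<in> gcmp deg' (deg b + d)"
  shows "linext D x \<in> gcmp deg' (q + d)"
  unfolding linext_def
proof (rule gcmp_sum)
  fix b assume b: "b \<in> Poly_Mapping.keys x"
  then have "D b \<in> gcmp deg' (deg b + d)" "homogeneous (q - deg b) (Poly_Mapping.lookup x b)"
    using assms by (auto simp: vecs_def gcmp_iff)
  from gcmp_smult[OF this(2,1)]
  show "smult (Poly_Mapping.lookup x b) (D b) \<in> gcmp deg' (q + d)" by (simp add: algebra_simps)
qed

text \<open>Closure under homogeneous projections is the usual condition of being generated by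
  homogeneous elements, in the form in which it is applied.\<close>

definition graded_submodule :: "mpoly set \<Rightarrow> ('b \<Rightarrow> int) \<Rightarrow> 'b vec set \<Rightarrow> bool" where
  "graded_submodule A deg N \<longleftrightarrow> submodule A N \<and> (\<forall>x\<in>N. \<forall>q. gpart deg q x \<in> N)"

text \<open>\<open>cmp M\<close> has to match the degrees \<open>deg\<close> only inside
  \<open>num M\<close> and \<open>den M\<close>: for a row of a trigraded module it also records the
  other two degrees.\<close>

definition graded_module :: "mpoly set \<Rightarrow> ('b \<Rightarrow> int) \<Rightarrow> (int, 'b vec) grmod \<Rightarrow> bool" where
  "graded_module A deg M \<longleftrightarrow> graded_submodule A deg (num M) \<and> graded_submodule A deg (den M) \<and>
     (\<forall>q. num M \<inter> cmp M q = num M \<inter> gcmp deg q) \<and> (\<forall>q. den M \<inter> cmp M q = den M \<inter> gcmp deg q)"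

definition ideal_in :: "mpoly set \<Rightarrow> mpoly set \<Rightarrow> bool" where
  "ideal_in A I \<longleftrightarrow> I \<subseteq> A \<and> 0 \<in> I \<and> (\<forall>f\<in>I. \<forall>g\<in>I. f + g \<in> I) \<and> (\<forall>a\<in>A. \<forall>f\<in>I. a * f \<in> I)"

text \<open>Closure under homogeneous parts is what allows an arbitrary preimage over
  \<open>A\<close> to be replaced by a homogeneous one over \<open>A\<close>. Negation comes from
  the constant \<open>- 1\<close>.\<close>

locale graded_subring =
  fixes A :: "mpoly set"
  assumes Cst_in: "Cst c \<in> A"
    and add_in: "f \<in> A \<Longrightarrow> g \<in> A \<Longrightarrow> f + g \<in> A"
    and mult_in: "f \<in> A \<Longrightarrow> g \<in> A \<Longrightarrow> f * g \<in> A"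
    and hpart_in: "f \<in> A \<Longrightarrow> hpart d f \<in> A"
begin

lemma zero_in: "0 \<in> A" and one_in: "1 \<in> A" and minus_one_in: "- 1 \<in> A"
  using Cst_in[of 0] Cst_in[of 1] Cst_in[of "- 1"] by simp_all

lemma submodule_minus: "submodule A N \<Longrightarrow> x \<in> N \<Longrightarrow> y \<in> N \<Longrightarrow> x - y \<in> N"
  using submodule_add[of A N x "- y"] submodule_smult[of A N "- 1" y] minus_one_in
  by (simp add: smult_minus_one)

lemma submodule_subspace: "submodule A N \<Longrightarrow> vecQ.subspace N"
  using Cst_in by (intro subspaceI_smult) (auto simp: submodule_def)

lemma linear_over_diff:
  assumes "linear_over A U L" "submodule A U" "x \<in> U" "y \<in> U"
  shows "L (x - y) = L x - L y"
  using linear_over_add[OF assms(1) submodule_minus[OF assms(2-4)] assms(4)] by simp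

lemma ideal_in_self: "ideal_in A A"
  by (simp add: ideal_in_def zero_in add_in mult_in)

lemma submodule_vecs: "ideal_in A I \<Longrightarrow> submodule A (vecs I S)"
  unfolding submodule_def vecs_def ideal_in_def
  using keys_add[of x y for x y :: "'a vec"] keys_smult[of a x for a and x :: "'a vec"]
  by (auto simp: lookup_add lookup_smult dest!: subsetD)

lemmas submodule_vecs_self = submodule_vecs[OF ideal_in_self]

lemma gpart_vecs: "x \<in> vecs A S \<Longrightarrow> gpart deg q x \<in> vecs A S"
  using keys_gpart[of deg q x] by (auto simp: vecs_def lookup_gpart hpart_in)

lemma basis_in_vecs: "b \<in> S \<Longrightarrow> Poly_Mapping.single b 1 \<in> vecs A S"
  by (auto simp: vecs_def lookup_single when_def zero_in one_in)

text \<open>Induction principle for free modules: a property holds throughout once the vectors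
  having it form a submodule containing the basis.\<close>

lemma vecs_submodule:
  assumes "submodule A N" "x \<in> vecs A S" "\<And>b. b \<in> S \<Longrightarrow> Poly_Mapping.single b 1 \<in> N"
  shows "x \<in> N"
  using submodule_linext[of A N x S "\<lambda>b. Poly_Mapping.single b 1"] assms by (simp add: linext_self)

lemma linear_over_linext_eq:
  assumes L: "linear_over A (vecs A S) L" and x: "x \<in> vecs A S"
  shows "linext (\<lambda>b. L (Poly_Mapping.single b 1)) x = L x"
proof -
  let ?N = "{x \<in> vecs A S. linext (\<lambda>b. L (Poly_Mapping.single b 1)) x = L x}"
  have "submodule A ?N"
    using submodule_vecs_self[of S] linear_over_zero[OF L]
    by (auto simp: submodule_def linext_add linext_smult linear_over_add[OF L]
        linear_over_smult[OF L])
  then have "x \<in> ?N" using x by (rule vecs_submodule) (simp add: basis_in_vecs)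
  then show ?thesis by simp
qed

text \<open>Coefficients in the ideal times vectors over \<open>A\<close> stay in the ideal; thus
  the map descends modulo \<open>I\<close>.\<close>

lemma linext_vecs:
  assumes "ideal_in A I" "x \<in> vecs I S" "\<And>b. b \<in> S \<Longrightarrow> D b \<in> vecs A S'"
  shows "linext D x \<in> vecs I S'"
proof -
  have "smult i y \<in> vecs I S'" if "i \<in> I" "y \<in> vecs A S'" for i y
    using that keys_smult[of i y] assms(1)
    by (auto simp: vecs_def ideal_in_def lookup_smult mult.commute[of i])
  moreover have "D b \<in> vecs A S'" "Poly_Mapping.lookup x b \<in> I" if "b \<in> Poly_Mapping.keys x" for b
    using assms(2,3) that unfolding vecs_def by blast+
  ultimately show ?thesis
    unfolding linext_def by (intro submodule_sum[OF submodule_vecs[OF assms(1)]]) blast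
qed

lemma graded_submodule_vecs_ideal:
  assumes "ideal_in A I" "\<And>f d. f \<in> I \<Longrightarrow> hpart d f \<in> I"
  shows "graded_submodule A deg (vecs I S)"
proof -
  have "gpart deg q x \<in> vecs I S" if "x \<in> vecs I S" for q x
    using that assms(2) keys_gpart[of deg q x] by (auto simp: vecs_def lookup_gpart)
  then show ?thesis
    using submodule_vecs[OF assms(1)] by (simp add: graded_submodule_def)
qed

lemmas graded_submodule_vecs = graded_submodule_vecs_ideal[OF ideal_in_self hpart_in]

lemma submodule_zero_vec: "submodule A {0}"
  by (simp add: submodule_def)

lemma graded_submodule_zero: "graded_submodule A deg {0}"
  by (simp add: graded_submodule_def submodule_zero_vec)

lemma gpart_linear:
  assumes L: "linear_over A F L" and F: "graded_submodule A deg F"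
    and deg: "\<And>x q. x \<in> F \<Longrightarrow> x \<in> gcmp deg q \<Longrightarrow> L x \<in> gcmp deg' (q + d)" and x: "x \<in> F"
  shows "L (gpart deg q x) = gpart deg' (q + d) (L x)"
  using F x deg linear_over_add[OF L]
  by (intro gpart_commute[where F = F]) (auto simp: graded_submodule_def submodule_def)

lemma graded_submodule_kernel:
  assumes L: "linear_over A F L" and F: "graded_submodule A deg F"
    and deg: "\<And>x q. x \<in> F \<Longrightarrow> x \<in> gcmp deg q \<Longrightarrow> L x \<in> gcmp deg' (q + d)"
    and N: "graded_submodule A deg' N"
  shows "graded_submodule A deg {x \<in> F. L x \<in> N}"
proof -
  have "gpart deg q x \<in> F \<and> L (gpart deg q x) \<in> N" if "x \<in> F" "L x \<in> N" for x q
    using that gpart_linear[OF L F deg that(1), of q] F N by (auto simp: graded_submodule_def)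
  moreover have "submodule A {x \<in> F. L x \<in> N}"
    using F N linear_over_zero[OF L] linear_over_add[OF L] linear_over_smult[OF L]
    by (auto simp: graded_submodule_def submodule_def)
  ultimately show ?thesis by (simp add: graded_submodule_def)
qed

lemma submodule_plus_image:
  assumes N: "submodule A N" and U: "submodule A U" and L: "linear_over A U L"
  shows "submodule A {x + L y |x y. x \<in> N \<and> y \<in> U}"
  unfolding submodule_def
proof (intro conjI ballI)
  show "0 \<in> {x + L y |x y. x \<in> N \<and> y \<in> U}"
    using submodule_zero[OF N] submodule_zero[OF U] linear_over_zero[OF L] by force
next
  fix u v assume "u \<in> {x + L y |x y. x \<in> N \<and> y \<in> U}" "v \<in> {x + L y |x y. x \<in> N \<and> y \<in> U}"
  then obtain x y x' y' where *: "u = x + L y" "v = x' + L y'" "x \<in> N" "y \<in> U" "x' \<in> N" "y' \<in> U"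
    by blast
  then have "u + v = (x + x') + L (y + y')" by (simp add: linear_over_add[OF L])
  then show "u + v \<in> {x + L y |x y. x \<in> N \<and> y \<in> U}"
    using submodule_add[OF N *(3,5)] submodule_add[OF U *(4,6)] by blast
next
  fix a u assume a: "a \<in> A" and "u \<in> {x + L y |x y. x \<in> N \<and> y \<in> U}"
  then obtain x y where *: "u = x + L y" "x \<in> N" "y \<in> U" by blast
  then have "smult a u = smult a x + L (smult a y)"
    using a by (simp add: linear_over_smult[OF L] smult_add_right)
  then show "smult a u \<in> {x + L y |x y. x \<in> N \<and> y \<in> U}"
    using submodule_smult[OF N a *(2)] submodule_smult[OF U a *(3)] by blast
qed

lemma graded_submodule_plus_image:
  assumes N: "graded_submodule A deg' N" and U: "graded_submodule A deg U"
    and L: "linear_over A U L"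
    and deg: "\<And>x q. x \<in> U \<Longrightarrow> x \<in> gcmp deg q \<Longrightarrow> L x \<in> gcmp deg' (q + d)"
  shows "graded_submodule A deg' {x + L y |x y. x \<in> N \<and> y \<in> U}"
  unfolding graded_submodule_def
proof (intro conjI ballI allI)
  show "submodule A {x + L y |x y. x \<in> N \<and> y \<in> U}"
    using N U L by (intro submodule_plus_image) (auto simp: graded_submodule_def)
next
  fix u q assume "u \<in> {x + L y |x y. x \<in> N \<and> y \<in> U}"
  then obtain x y where *: "u = x + L y" "x \<in> N" "y \<in> U" by blast
  then have "gpart deg' q u = gpart deg' q x + L (gpart deg (q - d) y)"
    using gpart_linear[where q = "q - d", OF L U deg] by (simp add: gpart_add)
  moreover have "gpart deg' q x \<in> N" "gpart deg (q - d) y \<in> U"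
    using * N U by (auto simp: graded_submodule_def)
  ultimately show "gpart deg' q u \<in> {x + L y |x y. x \<in> N \<and> y \<in> U}" by blast
qed

text \<open>Projectivity of free modules: lifts are chosen on the basis and extended linearly.
  Lifting is modulo \<open>N\<close>, which is \<open>{0}\<close> inside a resolution and
  \<open>den M\<close> at the augmentation; \<open>G\<close> carries a side condition on the chosen
  lifts, namely their degree.\<close>

lemma free_lift:
  assumes N: "submodule A N" and F': "submodule A F'" and L: "linear_over A F' L"
    and \<psi>: "linear_over A (vecs A S) \<psi>"
    and ex: "\<And>b. b \<in> S \<Longrightarrow> \<exists>y\<in>F'. G b y \<and> \<psi> (Poly_Mapping.single b 1) - L y \<in> N"
  shows "\<exists>D. (\<forall>b\<in>S. D b \<in> F' \<and> G b (D b)) \<and>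
    (\<forall>x\<in>vecs A S. linext D x \<in> F' \<and> \<psi> x - L (linext D x) \<in> N)"
proof -
  obtain D where D: "\<And>b. b \<in> S \<Longrightarrow> D b \<in> F' \<and> G b (D b) \<and> \<psi> (Poly_Mapping.single b 1) - L (D b) \<in> N"
    using bchoice[of S "\<lambda>b y. y \<in> F' \<and> G b y \<and> \<psi> (Poly_Mapping.single b 1) - L y \<in> N"] ex by blast
  let ?N = "{x \<in> vecs A S. linext D x \<in> F' \<and> \<psi> x - L (linext D x) \<in> N}"
  have "submodule A ?N"
    unfolding submodule_def
  proof (intro conjI ballI)
    show "0 \<in> ?N"
      using linear_over_zero[OF \<psi> submodule_zero[OF submodule_vecs_self]]
        linear_over_zero[OF L submodule_zero[OF F']]
      by (simp add: submodule_zero[OF submodule_vecs_self] submodule_zero[OF F'] submodule_zero[OF N])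
  next
    fix x y assume xy: "x \<in> ?N" "y \<in> ?N"
    then have "\<psi> (x + y) - L (linext D (x + y))
        = (\<psi> x - L (linext D x)) + (\<psi> y - L (linext D y))"
      by (simp add: linext_add linear_over_add[OF \<psi>] linear_over_add[OF L])
    then show "x + y \<in> ?N"
      using xy by (simp add: linext_add submodule_add[OF F'] submodule_add[OF N]
          submodule_add[OF submodule_vecs_self])
  next
    fix a x assume ax: "a \<in> A" "x \<in> ?N"
    then have "\<psi> (smult a x) - L (linext D (smult a x)) = smult a (\<psi> x - L (linext D x))"
      by (simp add: linext_smult linear_over_smult[OF \<psi>] linear_over_smult[OF L] smult_diff_right)
    then show "smult a x \<in> ?N"
      using ax by (simp add: linext_smult submodule_smult[OF F'] submodule_smult[OF N]
          submodule_smult[OF submodule_vecs_self])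
  qed
  then have "x \<in> ?N" if "x \<in> vecs A S" for x
    using that by (rule vecs_submodule) (simp add: D basis_in_vecs)
  then show ?thesis using D by blast
qed

section \<open>Independence of Tor of the resolution\<close>

context
  fixes M :: "(int, 'b vec) grmod" and deg :: "'b \<Rightarrow> int"
  assumes M: "graded_module A deg M"
begin

lemma submodule_num: "submodule A (num M)" and submodule_den: "submodule A (den M)"
  using M by (auto simp: graded_module_def graded_submodule_def)

context
  fixes P :: "'b vec resolution"
  assumes P: "graded_free_resolution A M P"
begin

private abbreviation (input) "free p \<equiv> vecs A (basis P p)"

lemmas resolution_conjuncts = P[unfolded graded_free_resolution_def Let_def res_cmp_eq One_nat_def]
lemmas resolution_bd = spec[OF conjunct1[OF resolution_conjuncts]]
lemmas resolution_aug = conjunct2[OF resolution_conjuncts]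

lemma bd_linear: "linear_over A (free (Suc p)) (bd P p)"
  and bd_in: "x \<in> free (Suc p) \<Longrightarrow> bd P p x \<in> free p"
  and bd_gcmp: "x \<in> free (Suc p) \<Longrightarrow> x \<in> gcmp (bdeg P (Suc p)) q \<Longrightarrow> bd P p x \<in> gcmp (bdeg P p) q"
  using resolution_bd[of p] by blast+

lemma aug_linear: "linear_over A (free 0) (aug P)"
  and aug_in: "x \<in> free 0 \<Longrightarrow> aug P x \<in> num M"
  and aug_surj: "y \<in> num M \<Longrightarrow> \<exists>x\<in>free 0. y - aug P x \<in> den M"
  using conjunct1[OF resolution_aug] conjunct1[OF conjunct2[OF resolution_aug]]
    conjunct1[OF conjunct2[OF conjunct2[OF conjunct2[OF resolution_aug]]]]
  by blast+

lemma aug_cmp: "x \<in> free 0 \<Longrightarrow> x \<in> gcmp (bdeg P 0) q \<Longrightarrow> aug P x \<in> cmp M q"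
  using conjunct1[OF conjunct2[OF conjunct2[OF resolution_aug]]] by blast

lemma exact_aug: "{x \<in> free 0. aug P x \<in> den M} = bd P 0 ` free (Suc 0)"
  and exact_bd: "{x \<in> free (Suc p). bd P p x = 0} = bd P (Suc p) ` free (Suc (Suc p))"
  using resolution_aug by simp_all

lemma aug_gcmp: "x \<in> free 0 \<Longrightarrow> x \<in> gcmp (bdeg P 0) q \<Longrightarrow> aug P x \<in> gcmp deg q"
  using M aug_in aug_cmp unfolding graded_module_def by blast

lemma bd_gpart:
  "x \<in> free (Suc p) \<Longrightarrow> bd P p (gpart (bdeg P (Suc p)) q x) = gpart (bdeg P p) q (bd P p x)"
  using gpart_linear[where d = 0 and deg' = "bdeg P p", OF bd_linear graded_submodule_vecs] bd_gcmp
  by simp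

lemma aug_gpart: "x \<in> free 0 \<Longrightarrow> aug P (gpart (bdeg P 0) q x) = gpart deg q (aug P x)"
  using gpart_linear[where d = 0 and deg' = deg, OF aug_linear graded_submodule_vecs] aug_gcmp
  by simp

text \<open>Any preimage becomes homogeneous by projecting it to degree \<open>q\<close>; the error
  stays in \<open>den M\<close> because \<open>den M\<close> is graded.\<close>

lemma aug_surj_graded:
  assumes "y \<in> num M" "y \<in> gcmp deg q"
  shows "\<exists>x\<in>free 0. x \<in> gcmp (bdeg P 0) q \<and> y - aug P x \<in> den M"
proof -
  obtain x where x: "x \<in> free 0" "y - aug P x \<in> den M" using aug_surj assms by blast
  have "y - aug P (gpart (bdeg P 0) q x) = gpart deg q (y - aug P x)"
    using gpart_of_gcmp[OF assms(2)] by (simp add: gpart_diff aug_gpart[OF x(1)])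
  then show ?thesis
    using x M gpart_vecs[OF x(1)] gpart_gcmp
    by (auto simp: graded_module_def graded_submodule_def intro!: bexI[of _ "gpart (bdeg P 0) q x"])
qed

lemma bd_surj_graded:
  assumes "y \<in> bd P p ` free (Suc p)" "y \<in> gcmp (bdeg P p) q"
  shows "\<exists>x\<in>free (Suc p). x \<in> gcmp (bdeg P (Suc p)) q \<and> y - bd P p x \<in> {0}"
proof -
  obtain x where x: "x \<in> free (Suc p)" "y = bd P p x" using assms by blast
  have "bd P p (gpart (bdeg P (Suc p)) q x) = y"
    using gpart_of_gcmp[OF assms(2)] by (simp add: bd_gpart[OF x(1)] x(2))
  then show ?thesis
    using gpart_vecs[OF x(1)] gpart_gcmp
    by (auto intro!: bexI[of _ "gpart (bdeg P (Suc p)) q x"])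
qed

lemma bd_image_in: "bd P p ` free (Suc p) \<subseteq> free p"
  using bd_in by blast

lemma bd_bd: "x \<in> free (Suc (Suc p)) \<Longrightarrow> bd P p (bd P (Suc p) x) = 0"
  using exact_bd[of p] by blast

text \<open>A chain endomorphism inducing zero on \<open>M\<close> is null-homotopic. Each level
  only needs its own homotopy \<open>h\<close> and the one below it, \<open>h'\<close>, so a pair is
  asserted for each \<open>p\<close>; at level 0 there is nothing below.\<close>

lemma homotopy:
  assumes \<phi>: "\<And>p b. b \<in> basis P p \<Longrightarrow> \<phi> p b \<in> free p"
    and aug0: "\<And>x. x \<in> free 0 \<Longrightarrow> aug P (linext (\<phi> 0) x) \<in> den M"
    and chain: "\<And>p x. x \<in> free (Suc p) \<Longrightarrow>
      bd P p (linext (\<phi> (Suc p)) x) = linext (\<phi> p) (bd P p x)"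
  shows "\<exists>h h'. (\<forall>x\<in>free p. linext h x \<in> free (Suc p)) \<and>
    (\<forall>x\<in>free p. linext (\<phi> p) x = bd P p (linext h x) +
      (case p of 0 \<Rightarrow> 0 | Suc p' \<Rightarrow> linext h' (bd P p' x))) \<and>
    (case p of 0 \<Rightarrow> True | Suc p' \<Rightarrow> \<forall>b\<in>basis P p'. h' b \<in> free p)"
proof (induction p)
  case 0
  have "\<exists>y\<in>free (Suc 0). True \<and> linext (\<phi> 0) (Poly_Mapping.single b 1) - bd P 0 y \<in> {0}"
    if "b \<in> basis P 0" for b
  proof -
    have "linext (\<phi> 0) (Poly_Mapping.single b 1) \<in> {x \<in> free 0. aug P x \<in> den M}"
      using aug0[OF basis_in_vecs[OF that]] \<phi>[OF that] by simp
    then show ?thesis unfolding exact_aug by auto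
  qed
  from free_lift[where S = "basis P 0" and \<psi> = "linext (\<phi> 0)",
      OF submodule_zero_vec submodule_vecs_self bd_linear linear_over_linext, OF this]
  obtain h where "\<forall>x\<in>free 0. linext h x \<in> free (Suc 0) \<and> linext (\<phi> 0) x - bd P 0 (linext h x) \<in> {0}"
    by auto
  then show ?case by (intro exI[of _ h]) auto
next
  case (Suc p)
  then obtain h h' where h: "\<And>x. x \<in> free p \<Longrightarrow> linext h x \<in> free (Suc p)"
    "\<And>x. x \<in> free p \<Longrightarrow> linext (\<phi> p) x = bd P p (linext h x) +
      (case p of 0 \<Rightarrow> 0 | Suc p' \<Rightarrow> linext h' (bd P p' x))" by blast
  \<comment> \<open>What remains after subtracting the previous homotopy consists of cycles, hence
    by exactness of boundaries; lifting it gives the next homotopy \<open>k\<close>.\<close>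
  let ?\<psi> = "\<lambda>x. linext (\<phi> (Suc p)) x - linext h (bd P p x)"
  \<comment> \<open>On boundaries the \<open>h'\<close> term of the homotopy formula disappears,
    since two successive differentials compose to zero.\<close>
  have h_bd: "linext (\<phi> p) (bd P p x) = bd P p (linext h (bd P p x))" if "x \<in> free (Suc p)" for x
  proof (cases p)
    case 0
    then show ?thesis using h(2)[OF bd_in[OF that]] by simp
  next
    case (Suc p')
    then have "bd P p' (bd P p x) = 0" using bd_bd[of x p'] that by simp
    then show ?thesis using h(2)[OF bd_in[OF that]] Suc by simp
  qed
  have \<psi>: "linear_over A (free (Suc p)) ?\<psi>"
    unfolding linear_over_def
    by (auto simp: linext_add linext_smult smult_diff_right linear_over_add[OF bd_linear]
        linear_over_smult[OF bd_linear])
  have \<phi>_in: "linext (\<phi> p) x \<in> free p" if "x \<in> free p" for x p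
    by (rule linext_vecs[OF ideal_in_self that \<phi>])
  have "\<exists>y\<in>free (Suc (Suc p)). True \<and> ?\<psi> (Poly_Mapping.single b 1) - bd P (Suc p) y \<in> {0}"
    if b: "b \<in> basis P (Suc p)" for b
  proof -
    let ?e = "Poly_Mapping.single b 1 :: nat vec"
    have e: "?e \<in> free (Suc p)" using basis_in_vecs[OF b] .
    have in1: "linext (\<phi> (Suc p)) ?e \<in> free (Suc p)" and in2: "linext h (bd P p ?e) \<in> free (Suc p)"
      using \<phi>_in[OF e] h(1)[OF bd_in[OF e]] by auto
    have "bd P p (?\<psi> ?e) = 0"
      using linear_over_diff[OF bd_linear submodule_vecs_self in1 in2] chain[OF e] h_bd[OF e]
      by simp
    then have "?\<psi> ?e \<in> {x \<in> free (Suc p). bd P p x = 0}"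
      using submodule_minus[OF submodule_vecs_self in1 in2] by simp
    then show ?thesis unfolding exact_bd by auto
  qed
  from free_lift[OF submodule_zero_vec submodule_vecs_self bd_linear \<psi>, OF this]
  obtain k where k: "\<forall>x\<in>free (Suc p). linext k x \<in> free (Suc (Suc p)) \<and>
    ?\<psi> x - bd P (Suc p) (linext k x) \<in> {0}"
    by auto
  have "h b \<in> free (Suc p)" if "b \<in> basis P p" for b
    using h(1)[OF basis_in_vecs[OF that]] by simp
  with k show ?case
    by (intro exI[of _ k] exI[of _ h]) (auto simp: algebra_simps)
qed

lemma submodule_tor:
  assumes I: "ideal_in A I"
  shows "submodule A (num (tor_of A I P p))" "submodule A (den (tor_of A I P p))"
proof -
  show "submodule A (num (tor_of A I P p))"
    using submodule_vecs_self[of "basis P p"] submodule_vecs[OF I, of "basis P (p - 1)"]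
      linear_over_zero[OF bd_linear] linear_over_add[OF bd_linear] linear_over_smult[OF bd_linear]
    by (cases p) (auto simp: tor_of_def submodule_def)
  show "submodule A (den (tor_of A I P p))"
    using submodule_plus_image[OF submodule_vecs[OF I] submodule_vecs_self bd_linear]
    by (simp add: tor_of_def)
qed

lemma subspace_tor:
  assumes "ideal_in A I"
  shows "vecQ.subspace (num (tor_of A I P p) \<inter> gcmp (bdeg P p) q)"
    "vecQ.subspace (den (tor_of A I P p) \<inter> gcmp (bdeg P p) q)"
  by (intro vecQ.subspace_inter subspace_gcmp submodule_subspace submodule_tor assms)+

text \<open>If \<open>x\<close> is a cycle modulo \<open>I\<close>, the term
  \<open>h' (bd x)\<close> of the homotopy has coefficients in \<open>I\<close> and the term
  \<open>bd (h x)\<close> is a boundary.\<close>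

lemma null_homotopic_tor:
  assumes I: "ideal_in A I" and \<phi>: "\<And>p b. b \<in> basis P p \<Longrightarrow> \<phi> p b \<in> free p"
    and aug0: "\<And>x. x \<in> free 0 \<Longrightarrow> aug P (linext (\<phi> 0) x) \<in> den M"
    and chain: "\<And>p x. x \<in> free (Suc p) \<Longrightarrow>
      bd P p (linext (\<phi> (Suc p)) x) = linext (\<phi> p) (bd P p x)"
    and x: "x \<in> num (tor_of A I P p)"
  shows "linext (\<phi> p) x \<in> den (tor_of A I P p)"
proof -
  obtain h h' where h: "\<forall>x\<in>free p. linext h x \<in> free (Suc p)"
    "\<forall>x\<in>free p. linext (\<phi> p) x = bd P p (linext h x) +
      (case p of 0 \<Rightarrow> 0 | Suc p' \<Rightarrow> linext h' (bd P p' x))"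
    "case p of 0 \<Rightarrow> True | Suc p' \<Rightarrow> \<forall>b\<in>basis P p'. h' b \<in> free p"
    using homotopy[OF \<phi> aug0 chain] by blast
  have xF: "x \<in> free p" using x by (auto simp: tor_of_def)
  let ?i = "case p of 0 \<Rightarrow> 0 | Suc p' \<Rightarrow> linext h' (bd P p' x)"
  have "?i \<in> vecs I (basis P p)"
    using x h(3)
    by (auto simp: tor_of_def submodule_zero[OF submodule_vecs[OF I]] intro: linext_vecs[OF I]
        split: nat.splits)
  moreover have "linext (\<phi> p) x = ?i + bd P p (linext h x)"
    using h(2) xF by simp
  moreover have "linext h x \<in> free (Suc p)" using h(1) xF by blast
  ultimately show ?thesis
    unfolding tor_of_def grmod.simps mem_Collect_eq
    by (intro exI[of _ ?i] exI[of _ "linext h x"] conjI)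
qed

end

text \<open>The comparison theorem for resolutions of the same module, with basis vectors sent to
  vectors of their own degree.\<close>

lemma chain_map:
  assumes P: "graded_free_resolution A M P" and Q: "graded_free_resolution A M Q"
  shows "\<exists>f. (\<forall>p. \<forall>b\<in>basis P p. f p b \<in> vecs A (basis Q p) \<inter> gcmp (bdeg Q p) (bdeg P p b)) \<and>
    (\<forall>x\<in>vecs A (basis P 0). aug P x - aug Q (linext (f 0) x) \<in> den M) \<and>
    (\<forall>p. \<forall>x\<in>vecs A (basis P (Suc p)). linext (f p) (bd P p x) = bd Q p (linext (f (Suc p)) x))"
proof -
  define im where "im R p = bd R p ` vecs A (basis R (Suc p))" for R :: "'b vec resolution" and p
  \<comment> \<open>The invariant of the recursion: mapping boundaries of \<open>P\<close> to
    boundaries of \<open>Q\<close> is exactly what makes the next lift possible. Compatibility with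
    the augmentations is a condition at stage 0 only.\<close>
  define good where "good p g \<longleftrightarrow>
      (\<forall>b\<in>basis P p. g b \<in> vecs A (basis Q p) \<inter> gcmp (bdeg Q p) (bdeg P p b)) \<and>
      linext g ` im P p \<subseteq> im Q p \<and>
      (p = 0 \<longrightarrow> (\<forall>x\<in>vecs A (basis P 0). aug P x - aug Q (linext g x) \<in> den M))" for p g
  have "\<exists>f. \<forall>p. good p (f p) \<and>
      (\<forall>x\<in>vecs A (basis P (Suc p)). linext (f p) (bd P p x) = bd Q p (linext (f (Suc p)) x))"
  proof (rule dependent_nat_choice)
    have "\<exists>y\<in>vecs A (basis Q 0). y \<in> gcmp (bdeg Q 0) (bdeg P 0 b) \<and>
        aug P (Poly_Mapping.single b 1) - aug Q y \<in> den M" if "b \<in> basis P 0" for b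
    proof -
      have "Poly_Mapping.single b 1 \<in> vecs A (basis P 0)" using basis_in_vecs[OF that] .
      from aug_surj_graded[OF Q aug_in[OF P this] aug_gcmp[OF P this gcmp_basis]]
      show ?thesis by blast
    qed
    from free_lift[OF submodule_den submodule_vecs_self aug_linear[OF Q] aug_linear[OF P],
        OF this]
    obtain g where g: "\<forall>b\<in>basis P 0. g b \<in> vecs A (basis Q 0) \<and> g b \<in> gcmp (bdeg Q 0) (bdeg P 0 b)"
      "\<forall>x\<in>vecs A (basis P 0). linext g x \<in> vecs A (basis Q 0) \<and> aug P x - aug Q (linext g x) \<in> den M"
      by blast
    \<comment> \<open>Boundaries in level 0 are the vectors whose augmentation lies in
      \<open>den M\<close>, and \<open>g\<close> preserves augmentations modulo
      \<open>den M\<close>.\<close>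
    have "linext g x \<in> im Q 0" if "x \<in> im P 0" for x
    proof -
      have x: "x \<in> vecs A (basis P 0)" "aug P x \<in> den M"
        using that exact_aug[OF P] unfolding im_def by blast+
      have "aug P x - (aug P x - aug Q (linext g x)) \<in> den M"
        by (rule submodule_minus[OF submodule_den]) (use g(2) x in blast)+
      then show ?thesis
        using g(2) x(1) exact_aug[OF Q] unfolding im_def by auto
    qed
    with g show "\<exists>g. good 0 g" unfolding good_def by blast
  next
    fix g p assume g: "good p g"
    let ?\<psi> = "\<lambda>x. linext g (bd P p x)"
    have \<psi>: "linear_over A (vecs A (basis P (Suc p))) ?\<psi>"
      unfolding linear_over_def
      by (auto simp: linext_add linext_smult linear_over_add[OF bd_linear[OF P]]
          linear_over_smult[OF bd_linear[OF P]])
    have "\<exists>y\<in>vecs A (basis Q (Suc p)). y \<in> gcmp (bdeg Q (Suc p)) (bdeg P (Suc p) b) \<and>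
        ?\<psi> (Poly_Mapping.single b 1) - bd Q p y \<in> {0}" if b: "b \<in> basis P (Suc p)" for b
    proof (rule bd_surj_graded[OF Q])
      let ?e = "Poly_Mapping.single b 1 :: nat vec"
      have e: "?e \<in> vecs A (basis P (Suc p))" using basis_in_vecs[OF b] .
      show "?\<psi> ?e \<in> bd Q p ` vecs A (basis Q (Suc p))"
        using g e unfolding good_def im_def by blast
      show "?\<psi> ?e \<in> gcmp (bdeg Q p) (bdeg P (Suc p) b)"
        using linext_gcmp[OF bd_in[OF P e] bd_gcmp[OF P e gcmp_basis], of g "bdeg Q p" 0] g
        unfolding good_def by auto
    qed
    from free_lift[OF submodule_zero_vec submodule_vecs_self bd_linear[OF Q] \<psi>, OF this]
    obtain k where k: "\<forall>b\<in>basis P (Suc p). k b \<in> vecs A (basis Q (Suc p)) \<and>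
        k b \<in> gcmp (bdeg Q (Suc p)) (bdeg P (Suc p) b)"
      "\<forall>x\<in>vecs A (basis P (Suc p)). linext k x \<in> vecs A (basis Q (Suc p)) \<and>
        ?\<psi> x - bd Q p (linext k x) \<in> {0}"
      by blast
    have "linext k x \<in> im Q (Suc p)" if "x \<in> im P (Suc p)" for x
    proof -
      have x: "x \<in> vecs A (basis P (Suc p))" "bd P p x = 0"
        using that exact_bd[OF P, of p] unfolding im_def by blast+
      then have "linext k x \<in> {x \<in> vecs A (basis Q (Suc p)). bd Q p x = 0}"
        using k(2) by auto
      then show ?thesis unfolding im_def exact_bd[OF Q] .
    qed
    with k show "\<exists>k. good (Suc p) k \<and>
        (\<forall>x\<in>vecs A (basis P (Suc p)). linext g (bd P p x) = bd Q p (linext k x))"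
      unfolding good_def by (intro exI[of _ k]) auto
  qed
  then obtain f where "\<forall>p. good p (f p) \<and>
      (\<forall>x\<in>vecs A (basis P (Suc p)). linext (f p) (bd P p x) = bd Q p (linext (f (Suc p)) x))" ..
  then show ?thesis unfolding good_def by (intro exI[of _ f]) auto
qed

text \<open>With comparison maps \<open>f\<close> and \<open>g\<close>, the chain map
  \<open>g \<circ> f - id\<close> is null-homotopic, so \<open>f\<close> is injective on Tor. One
  composite suffices, because equality follows by exchanging \<open>P\<close> and
  \<open>Q\<close>.\<close>

lemma tor_dim_le:
  assumes P: "graded_free_resolution A M P" and Q: "graded_free_resolution A M Q"
    and I: "ideal_in A I"
  shows "comp_dim (tor_of A I P p) q \<le> comp_dim (tor_of A I Q p) q"
proof -
  obtain f where f: "\<And>p b. b \<in> basis P p \<Longrightarrow> f p b \<in> vecs A (basis Q p) \<inter> gcmp (bdeg Q p) (bdeg P p b)"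
    "\<And>x. x \<in> vecs A (basis P 0) \<Longrightarrow> aug P x - aug Q (linext (f 0) x) \<in> den M"
    "\<And>p x. x \<in> vecs A (basis P (Suc p)) \<Longrightarrow> linext (f p) (bd P p x) = bd Q p (linext (f (Suc p)) x)"
    using chain_map[OF P Q] by (elim exE conjE, intro that) blast+
  obtain g where g: "\<And>p b. b \<in> basis Q p \<Longrightarrow> g p b \<in> vecs A (basis P p) \<inter> gcmp (bdeg P p) (bdeg Q p b)"
    "\<And>x. x \<in> vecs A (basis Q 0) \<Longrightarrow> aug Q x - aug P (linext (g 0) x) \<in> den M"
    "\<And>p x. x \<in> vecs A (basis Q (Suc p)) \<Longrightarrow> linext (g p) (bd Q p x) = bd P p (linext (g (Suc p)) x)"
    using chain_map[OF Q P] by (elim exE conjE, intro that) blast+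
  have f_vecs: "linext (f p) x \<in> vecs J (basis Q p)" if "ideal_in A J" "x \<in> vecs J (basis P p)" for J p x
    using f(1) by (intro linext_vecs[OF that]) auto
  have g_vecs: "linext (g p) x \<in> vecs J (basis P p)" if "ideal_in A J" "x \<in> vecs J (basis Q p)" for J p x
    using g(1) by (intro linext_vecs[OF that]) auto
  note f_free = f_vecs[OF ideal_in_self] and g_free = g_vecs[OF ideal_in_self]
  define \<phi> where "\<phi> p b = linext (g p) (f p b) - Poly_Mapping.single b 1" for p b
  have \<phi>: "linext (\<phi> p) x = linext (g p) (linext (f p) x) - x" for p x
    unfolding \<phi>_def linext_diff_fun linext_linext linext_self ..
  have gf_null: "linext (\<phi> p) x \<in> den (tor_of A I P p)" if "x \<in> num (tor_of A I P p)" for x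
  proof (rule null_homotopic_tor[OF P I _ _ _ that])
    fix p b assume "b \<in> basis P p"
    then show "\<phi> p b \<in> vecs A (basis P p)"
      using f(1) g_free basis_in_vecs unfolding \<phi>_def
      by (intro submodule_minus[OF submodule_vecs_self]) auto
  next
    fix x assume x: "x \<in> vecs A (basis P 0)"
    let ?y = "linext (f 0) x"
    have y: "?y \<in> vecs A (basis Q 0)" using f_free[OF x] .
    have "aug P (linext (\<phi> 0) x) = aug P (linext (g 0) ?y) - aug P x"
      unfolding \<phi> using linear_over_diff[OF aug_linear[OF P] submodule_vecs_self g_free[OF y] x] .
    also have "\<dots> = 0 - (aug Q ?y - aug P (linext (g 0) ?y)) - (aug P x - aug Q ?y)" by simp
    also have "\<dots> \<in> den M"
      using submodule_minus[OF submodule_den submodule_minus[OF submodule_den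
          submodule_zero[OF submodule_den] g(2)[OF y]] f(2)[OF x]] .
    finally show "aug P (linext (\<phi> 0) x) \<in> den M" .
  next
    fix p x assume x: "x \<in> vecs A (basis P (Suc p))"
    show "bd P p (linext (\<phi> (Suc p)) x) = linext (\<phi> p) (bd P p x)"
      using linear_over_diff[OF bd_linear[OF P] submodule_vecs_self g_free[OF f_free[OF x]] x]
        f(3)[OF x] g(3)[OF f_free[OF x]]
      by (simp add: \<phi>)
  qed
  have cmp: "cmp (tor_of A I R p) = gcmp (bdeg R p)" for R :: "'b vec resolution"
    by (simp add: tor_of_def res_cmp_eq fun_eq_iff)
  show ?thesis
    unfolding comp_dim_def cmp
  proof (rule quot_dim_le[where R = "\<lambda>x y. y = linext (f p) x"])
    fix x assume x: "x \<in> num (tor_of A I P p) \<inter> gcmp (bdeg P p) q"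
    then have xF: "x \<in> vecs A (basis P p)" by (auto simp: tor_of_def)
    have "bd Q p' (linext (f p) x) \<in> vecs I (basis Q p')" if "p = Suc p'" for p'
      using f_vecs[OF I, of "bd P p' x" p'] x f(3)[of x p'] xF that by (auto simp: tor_of_def)
    moreover have "linext (f p) x \<in> gcmp (bdeg Q p) q"
      using linext_gcmp[OF xF, of "bdeg P p" q "f p" "bdeg Q p" 0] f(1) x by auto
    ultimately show "\<exists>y\<in>num (tor_of A I Q p) \<inter> gcmp (bdeg Q p) q. y = linext (f p) x"
      using f_free[OF xF] by (auto simp: tor_of_def split: nat.splits)
  next
    fix x y assume x: "x \<in> num (tor_of A I P p) \<inter> gcmp (bdeg P p) q"
      and y: "y = linext (f p) x" "y \<in> den (tor_of A I Q p) \<inter> gcmp (bdeg Q p) q"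
    then obtain i z where z: "y = i + bd Q p z" "i \<in> vecs I (basis Q p)"
      "z \<in> vecs A (basis Q (Suc p))" by (auto simp: tor_of_def)
    then have "linext (g p) y \<in> den (tor_of A I P p)"
      using g_vecs[OF I z(2)] g_free[OF z(3)] g(3)[OF z(3)] by (auto simp: tor_of_def linext_add)
    \<comment> \<open>The difference equals \<open>x\<close>: \<open>g\<close> returns the boundary
      \<open>y\<close> to a boundary, and the null-homotopic defect is one as well.\<close>
    then have "linext (g p) y - linext (\<phi> p) x \<in> den (tor_of A I P p)"
      using gf_null x submodule_minus[OF submodule_tor(2)[OF P I]] by blast
    then show "x \<in> den (tor_of A I P p) \<inter> gcmp (bdeg P p) q"
      using x y(1) by (simp add: \<phi>)
  qed (auto simp: linext_add scaleQ_def linext_smult subspace_tor[OF P I] subspace_tor[OF Q I])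
qed

lemma tor_dim_unique:
  assumes "graded_free_resolution A M P" "graded_free_resolution A M Q" "ideal_in A I"
  shows "comp_dim (tor_of A I P p) q = comp_dim (tor_of A I Q p) q"
  using tor_dim_le assms by (intro antisym) blast+

lemma Tor_dim:
  assumes "graded_free_resolution A M P" "ideal_in A I"
  shows "comp_dim (Tor A I M p) q = comp_dim (tor_of A I P p) q"
  unfolding Tor_def using tor_dim_unique assms someI[of "graded_free_resolution A M"] by metis

end

end

section \<open>Existence of resolutions\<close>

text \<open>A finitely supported function is determined by its finite graph. Countability is what
  lets generators be numbered, as bases of resolutions are sets of natural numbers.\<close>

lemma countable_poly_mapping:
  assumes "countable S" "countable (UNIV :: 'v::zero set)"
  shows "countable {x :: 'a \<Rightarrow>\<^sub>0 'v. Poly_Mapping.keys x \<subseteq> S}"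
proof -
  let ?graph = "\<lambda>x :: 'a \<Rightarrow>\<^sub>0 'v. (\<lambda>k. (k, Poly_Mapping.lookup x k)) ` Poly_Mapping.keys x"
  have "inj ?graph"
  proof (rule injI, rule poly_mapping_eqI)
    fix x y :: "'a \<Rightarrow>\<^sub>0 'v" and k assume eq: "?graph x = ?graph y"
    have "(k, v) \<in> ?graph z \<longleftrightarrow> v \<noteq> 0 \<and> Poly_Mapping.lookup z k = v" for z v
      by (auto simp: in_keys_iff)
    then show "Poly_Mapping.lookup x k = Poly_Mapping.lookup y k"
      using eq by (metis (no_types))
  qed
  moreover have "countable {G. finite G \<and> G \<subseteq> S \<times> (UNIV :: 'v set)}"
    using assms by (intro countable_Collect_finite_subset countable_SIGMA) auto
  then have "countable (?graph ` {x. Poly_Mapping.keys x \<subseteq> S})"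
    by (rule countable_subset[rotated]) auto
  ultimately show ?thesis
    by (intro countable_image_inj_on[of ?graph] inj_on_subset[OF \<open>inj ?graph\<close>]) auto
qed

lemma countable_mpoly: "countable (UNIV :: mpoly set)"
  using countable_poly_mapping[of "UNIV :: (nat \<Rightarrow>\<^sub>0 nat) set", where 'v = rat]
    countable_poly_mapping[of "UNIV :: nat set", where 'v = nat] by simp

lemma countable_vecs: "countable S \<Longrightarrow> countable (vecs A S)"
  by (rule countable_subset[OF _ countable_poly_mapping[OF _ countable_mpoly]]) (auto simp: vecs_def)

context graded_subring
begin

text \<open>All homogeneous elements of \<open>N\<close> serve as generators, numbered by an
  enumeration. The enumerated objects are pairs with a degree, since the zero vector is homogeneous
  of every degree and does not determine its own.\<close>

lemma free_cover:
  assumes N: "graded_submodule A deg N" and count: "countable N"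
  shows "\<exists>S e D. (\<forall>b\<in>S. D b \<in> N \<inter> gcmp deg (e b)) \<and> linext D ` vecs A (S :: nat set) = N"
proof -
  define G where "G = {(q, x). x \<in> N \<inter> gcmp deg q}"
  have G: "countable G"
    using count by (intro countable_subset[of G "UNIV \<times> N"]) (auto simp: G_def)
  define S where "S = to_nat_on G ` G"
  define e where "e n = fst (from_nat_into G n)" for n
  define D where "D n = snd (from_nat_into G n)" for n
  have D: "D b \<in> N \<inter> gcmp deg (e b)" if b: "b \<in> S" for b
  proof -
    obtain g where "g \<in> G" "b = to_nat_on G g" using b unfolding S_def by blast
    then have "from_nat_into G b \<in> G" using G by simp
    then show ?thesis by (auto simp: G_def D_def e_def)
  qed
  have N': "submodule A N" using N by (simp add: graded_submodule_def)
  have "y \<in> linext D ` vecs A S" if y: "y \<in> N" for y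
  proof -
    obtain Q where Q: "finite Q" "y = (\<Sum>q\<in>Q. gpart deg q y)" using gpart_decomp by blast
    define b where "b q = to_nat_on G (q, gpart deg q y)" for q
    have "(q, gpart deg q y) \<in> G" for q
      using y N gpart_gcmp by (auto simp: G_def graded_submodule_def)
    then have b: "b q \<in> S" "D (b q) = gpart deg q y" for q
      using G by (auto simp: b_def S_def D_def)
    have "linext D (\<Sum>q\<in>Q. Poly_Mapping.single (b q) 1) = (\<Sum>q\<in>Q. gpart deg q y)"
      by (subst linear_over_sum[OF linear_over_linext submodule_vecs_self[of UNIV]])
        (auto simp: b basis_in_vecs)
    moreover have "(\<Sum>q\<in>Q. Poly_Mapping.single (b q) 1) \<in> vecs A S"
      by (intro submodule_sum[OF submodule_vecs_self] basis_in_vecs b)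
    ultimately show ?thesis using Q(2) by (metis imageI)
  qed
  moreover have "linext D x \<in> N" if "x \<in> vecs A S" for x
    using submodule_linext[OF N' that] D by blast
  ultimately show ?thesis using D by blast
qed

lemma resolution_exists:
  assumes M: "graded_module A deg M" and count: "countable (num M)"
  shows "\<exists>P. graded_free_resolution A M P"
proof -
  have num: "graded_submodule A deg (num M)" and den: "graded_submodule A deg (den M)"
    using M by (auto simp: graded_module_def)
  obtain S0 e0 D0 where D0: "\<forall>b\<in>S0. D0 b \<in> num M \<inter> gcmp deg (e0 b)"
    "linext D0 ` vecs A (S0 :: nat set) = num M"
    using free_cover[OF num count] by blast
  define K0 where "K0 = {x \<in> vecs A S0. linext D0 x \<in> den M}"
  have K0: "graded_submodule A e0 K0"
    unfolding K0_def using D0 linext_gcmp[of _ A S0 e0 _ D0 deg 0]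
    by (intro graded_submodule_kernel[where deg' = deg and d = 0, OF linear_over_linext
          graded_submodule_vecs _ den]) auto
  \<comment> \<open>A state consists of a basis \<open>S\<close>, its degrees \<open>e\<close>, the
    kernel \<open>K\<close> still to be covered, and the map \<open>D\<close> into the previous free
    module.\<close>
  define good where "good n st \<longleftrightarrow> (case st of (S, e, K, D) \<Rightarrow> graded_submodule A e K \<and>
      K \<subseteq> vecs A S \<and> (n = 0 \<longrightarrow> st = (S0, e0, K0, \<lambda>_. 0)))"
    for n :: nat and st :: "nat set \<times> (nat \<Rightarrow> int) \<times> nat vec set \<times> (nat \<Rightarrow> nat vec)"
  define succ where "succ st st' \<longleftrightarrow> (case (st, st') of ((S, e, K, D), (S', e', K', D')) \<Rightarrow>
      (\<forall>b\<in>S'. D' b \<in> K \<inter> gcmp e (e' b)) \<and> linext D' ` vecs A S' = K \<and>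
      K' = {x \<in> vecs A S'. linext D' x = 0})"
    for st st' :: "nat set \<times> (nat \<Rightarrow> int) \<times> nat vec set \<times> (nat \<Rightarrow> nat vec)"
  have "\<exists>st. \<forall>n. good n (st n) \<and> succ (st n) (st (Suc n))"
  proof (rule dependent_nat_choice)
    show "\<exists>st. good 0 st" using K0 by (auto simp: good_def K0_def)
  next
    fix st n assume st: "good n st"
    obtain S e K D where "st = (S, e, K, D)" by (cases st)
    with st have *: "st = (S, e, K, D)" "graded_submodule A e K" by (auto simp: good_def)
    obtain S' e' D' where D': "\<forall>b\<in>S'. D' b \<in> K \<inter> gcmp e (e' b)"
      "linext D' ` vecs A (S' :: nat set) = K"
      using free_cover[OF *(2) countable_subset[OF _ countable_vecs[of UNIV UNIV]]]
      by (auto simp: vecs_def)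
    have "graded_submodule A e' {x \<in> vecs A S'. linext D' x \<in> {0}}"
      using D' linext_gcmp[of _ A S' e' _ D' e 0]
      by (intro graded_submodule_kernel[where deg' = e and d = 0, OF linear_over_linext
            graded_submodule_vecs _ graded_submodule_zero]) auto
    then show "\<exists>st'. good (Suc n) st' \<and> succ st st'"
      using D' unfolding *(1) good_def succ_def
      by (intro exI[of _ "(S', e', {x \<in> vecs A S'. linext D' x = 0}, D')"]) auto
  qed
  then obtain st where st: "\<And>n. good n (st n)" "\<And>n. succ (st n) (st (Suc n))" by blast
  define S where "S n = fst (st n)" for n
  define e where "e n = fst (snd (st n))" for n
  define K where "K n = fst (snd (snd (st n)))" for n
  \<comment> \<open>A state holds the map leaving its own module, so the differential with index
    \<open>n\<close> sits in state \<open>Suc n\<close>. The map in state 0 is a dummy; the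
    augmentation \<open>D0\<close> takes its place.\<close>
  define D where "D n = snd (snd (snd (st (Suc n))))" for n
  have st_eq: "st n = (S n, e n, K n, snd (snd (snd (st n))))" for n
    by (simp add: S_def e_def K_def)
  have init: "S 0 = S0" "e 0 = e0" "K 0 = K0"
    using st(1)[of 0] by (auto simp: good_def S_def e_def K_def split: prod.splits)
  have K_sub: "K n \<subseteq> vecs A (S n)" for n
    using st(1)[of n] by (auto simp: good_def S_def K_def split: prod.splits)
  have D: "\<And>b. b \<in> S (Suc n) \<Longrightarrow> D n b \<in> K n \<inter> gcmp (e n) (e (Suc n) b)"
    "linext (D n) ` vecs A (S (Suc n)) = K n"
    "K (Suc n) = {x \<in> vecs A (S (Suc n)). linext (D n) x = 0}" for n
    using st(2)[of n] by (auto simp: succ_def S_def K_def D_def e_def split: prod.splits)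
  define P where "P = \<lparr>basis = S, bdeg = e, bd = (\<lambda>n. linext (D n)), aug = linext D0\<rparr>"
  have "graded_free_resolution A M P"
    unfolding graded_free_resolution_def Let_def res_cmp_eq P_def resolution.simps One_nat_def
  proof (intro conjI allI)
    fix p q
    show "linext (D p) ` vecs A (S (Suc p)) \<subseteq> vecs A (S p)"
      using D(2) K_sub by simp
    show "linext (D p) ` (vecs A (S (Suc p)) \<inter> gcmp (e (Suc p)) q) \<subseteq> gcmp (e p) q"
      using linext_gcmp[of _ A "S (Suc p)" "e (Suc p)" q "D p" "e p" 0] D(1) by auto
    have "K p = linext (D p) ` vecs A (S (Suc p))" for p using D(2) by simp
    then show "{x \<in> vecs A (S (Suc p)). linext (D p) x = 0} = linext (D (Suc p)) ` vecs A (S (Suc (Suc p)))"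
      using D(3)[of p] by metis
    show "{x \<in> vecs A (S 0). linext D0 x \<in> den M} = linext (D 0) ` vecs A (S (Suc 0))"
      using D(2)[of 0] by (simp add: init K0_def)
    show "linext D0 ` vecs A (S 0) \<subseteq> num M" using D0(2) init by simp
    have "linext D0 x \<in> num M \<inter> gcmp deg q" if "x \<in> vecs A (S 0) \<inter> gcmp (e 0) q" for x
      using that D0 linext_gcmp[of x A S0 e0 q D0 deg 0] init by auto
    then show "linext D0 ` (vecs A (S 0) \<inter> gcmp (e 0) q) \<subseteq> cmp M q"
      using M unfolding graded_module_def by blast
  next
    show "\<forall>y\<in>num M. \<exists>x\<in>vecs A (S 0). y - linext D0 x \<in> den M"
    proof
      fix y assume "y \<in> num M"
      then obtain x where "x \<in> vecs A (S 0)" "y = linext D0 x" using D0(2) init by auto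
      then show "\<exists>x\<in>vecs A (S 0). y - linext D0 x \<in> den M"
        using den by (intro bexI[of _ x]) (auto simp: graded_submodule_def submodule_def)
    qed
  qed (rule linear_over_linext)+
  then show ?thesis ..
qed

end

section \<open>Expansion in powers of a free element\<close>

text \<open>\<open>powspan m U\<close> consists of the sums \<open>\<Sum>\<^sub>i m\<^sup>i u\<^sub>i\<close> with \<open>u\<^sub>i \<in> U\<close>, in Horner form.\<close>

inductive_set powspan :: "('a::plus \<Rightarrow> 'a) \<Rightarrow> 'a set \<Rightarrow> 'a set" for m U where
  base: "u \<in> U \<Longrightarrow> u \<in> powspan m U"
| step: "u \<in> U \<Longrightarrow> x \<in> powspan m U \<Longrightarrow> u + m x \<in> powspan m U"

lemma powspan_map:
  assumes "\<And>x y. f (x + m y) = f x + m' (f y)" "f ` U \<subseteq> U'" "x \<in> powspan m U"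
  shows "f x \<in> powspan m' U'"
  using assms(3)
  by (induction rule: powspan.induct) (use assms(1,2) in \<open>auto intro: powspan.base powspan.step\<close>)

lemma powspan_image:
  assumes "\<And>x y. f (x + m y) = f x + m' (f y)"
  shows "powspan m' (f ` U) = f ` powspan m U"
proof
  show "f ` powspan m U \<subseteq> powspan m' (f ` U)" using powspan_map[of f m m' U "f ` U"] assms by blast
  show "powspan m' (f ` U) \<subseteq> f ` powspan m U"
  proof
    fix y assume "y \<in> powspan m' (f ` U)"
    then show "y \<in> f ` powspan m U"
    proof (induction rule: powspan.induct)
      case (base u)
      then show ?case by (auto intro: powspan.base)
    next
      case (step u x)
      then obtain v z where "u = f v" "v \<in> U" "x = f z" "z \<in> powspan m U" by auto
      then have "u + m' x = f (v + m z)" "v + m z \<in> powspan m U"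
        by (auto simp: assms intro: powspan.step)
      then show ?case by blast
    qed
  qed
qed

lemma powspan_mono: "U \<subseteq> U' \<Longrightarrow> powspan m U \<subseteq> powspan m U'"
  by (auto intro: powspan_map[of "\<lambda>x. x" m m U])

text \<open>\<open>V\<close> is the largest admissible set of coefficients; the sets
  \<open>U\<close> to be expanded vary inside it. The tails \<open>x\<close> and \<open>y\<close> in
  \<open>free\<close> are arbitrary, so one comparison of heads and tails is enough in every
  induction.\<close>

locale free_operator =
  fixes m :: "'a::ab_group_add \<Rightarrow> 'a" and V :: "'a set"
  assumes m_add: "m (x + y) = m x + m y"
    and free: "u \<in> V \<Longrightarrow> v \<in> V \<Longrightarrow> u + m x = v + m y \<Longrightarrow> u = v \<and> x = y"
begin

lemma m_zero: "m 0 = 0"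
  using m_add[of 0 0] by simp

lemma powspan_decomp: "0 \<in> U \<Longrightarrow> x \<in> powspan m U \<Longrightarrow> \<exists>u\<in>U. \<exists>y\<in>powspan m U. x = u + m y"
  by (erule powspan.cases) (force simp: m_zero intro: powspan.base)+

lemma powspan_m: "0 \<in> U \<Longrightarrow> x \<in> powspan m U \<Longrightarrow> m x \<in> powspan m U"
  using powspan.step[of 0 U x m] by simp

lemma powspan_add:
  assumes U: "0 \<in> U" "\<And>u v. u \<in> U \<Longrightarrow> v \<in> U \<Longrightarrow> u + v \<in> U"
    and x: "x \<in> powspan m U" and y: "y \<in> powspan m U"
  shows "x + y \<in> powspan m U"
  using x y
proof (induction arbitrary: y rule: powspan.induct)
  case (base u)
  obtain v z where "y = v + m z" "v \<in> U" "z \<in> powspan m U"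
    using powspan_decomp[OF U(1) base(2)] by blast
  then show ?case using powspan.step[of "u + v" U z m] U(2) base(1) by (simp add: add.assoc)
next
  case (step u x)
  obtain v z where *: "y = v + m z" "v \<in> U" "z \<in> powspan m U"
    using powspan_decomp[OF U(1) step.prems] by blast
  then have "u + m x + y = (u + v) + m (x + z)" by (simp add: m_add algebra_simps)
  moreover have "(u + v) + m (x + z) \<in> powspan m U"
    using U(2)[OF step.hyps(1) *(2)] step.IH[OF *(3)] by (rule powspan.step)
  ultimately show ?case by (simp only:)
qed

lemma powspan_sum:
  assumes U: "0 \<in> U" "\<And>u v. u \<in> U \<Longrightarrow> v \<in> U \<Longrightarrow> u + v \<in> U"
    and f: "\<And>i. i \<in> I \<Longrightarrow> f i \<in> powspan m U"
  shows "(\<Sum>i\<in>I. f i) \<in> powspan m U"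
  using f
  by (induction I rule: infinite_finite_induct) (auto intro: powspan.base powspan_add U)

lemma powspan_zero: "powspan m {0} = {0}"
proof -
  have "x = 0" if "x \<in> powspan m {0}" for x
    using that by (induction rule: powspan.induct) (auto simp: m_zero)
  then show ?thesis by (auto intro: powspan.base)
qed

lemma powspan_Int:
  assumes "U \<subseteq> V" "0 \<in> U" "x \<in> V" "x \<in> powspan m U"
  shows "x \<in> U"
proof -
  obtain u y where "u \<in> U" "x = u + m y" using powspan_decomp assms by blast
  then show ?thesis using free[of x u 0 y] assms by (auto simp: m_zero)
qed

text \<open>The substitute for flatness. Applying \<open>f\<close> to a Horner step gives a Horner
  step, and uniqueness in the target forces head and tail to satisfy the condition
  separately.\<close>

lemma powspan_kernel:
  assumes f: "\<And>x y. f (x + m' y) = f x + m (f y)" and U: "f ` U \<subseteq> V" and W: "W \<subseteq> V" "0 \<in> W"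
  shows "{x \<in> powspan m' U. f x \<in> powspan m W} = powspan m' {x \<in> U. f x \<in> W}"
proof
  show "powspan m' {x \<in> U. f x \<in> W} \<subseteq> {x \<in> powspan m' U. f x \<in> powspan m W}"
    using powspan_map[of f m' m "{x \<in> U. f x \<in> W}" W] powspan_mono[of "{x \<in> U. f x \<in> W}" U m'] f
    by auto
  have "f x \<in> powspan m W \<longrightarrow> x \<in> powspan m' {x \<in> U. f x \<in> W}" if "x \<in> powspan m' U" for x
    using that
  proof (induction rule: powspan.induct)
    case (base u)
    have "f u \<in> W" if "f u \<in> powspan m W" using powspan_Int[OF W _ that] U base by blast
    then show ?case using base by (auto intro: powspan.base)
  next
    case (step u x)
    show ?case
    proof
      assume "f (u + m' x) \<in> powspan m W"
      then obtain w y where "w \<in> W" "y \<in> powspan m W" "f u + m (f x) = w + m y"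
        using powspan_decomp[OF W(2)] f by force
      moreover from this have "f u = w \<and> f x = y" using U W step by (intro free) auto
      ultimately show "u + m' x \<in> powspan m' {x \<in> U. f x \<in> W}"
        using step by (intro powspan.step) auto
    qed
  qed
  then show "{x \<in> powspan m' U. f x \<in> powspan m W} \<subseteq> powspan m' {x \<in> U. f x \<in> W}" by blast
qed

text \<open>The companion of \<open>powspan_kernel\<close> for denominators: heads are combined with
  heads and tails with tails.\<close>

lemma powspan_plus_image:
  assumes f: "\<And>x y. f (x + y) = f x + f y" "\<And>x. f (m x) = m (f x)"
    and W: "0 \<in> W" "\<And>x y. x \<in> W \<Longrightarrow> y \<in> W \<Longrightarrow> x + y \<in> W"
    and U: "0 \<in> U" "\<And>x y. x \<in> U \<Longrightarrow> y \<in> U \<Longrightarrow> x + y \<in> U"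
  shows "{x + f y |x y. x \<in> powspan m W \<and> y \<in> powspan m U} = powspan m {x + f y |x y. x \<in> W \<and> y \<in> U}"
    (is "?L = powspan m ?R")
proof
  have f0: "f 0 = 0" using f(1)[of 0 0] by simp
  have R0: "0 \<in> ?R" using W(1) U(1) f0 by force
  have Radd: "x + y \<in> ?R" if xy: "x \<in> ?R" "y \<in> ?R" for x y
  proof -
    obtain a b c d where *: "x = a + f b" "y = c + f d" "a \<in> W" "b \<in> U" "c \<in> W" "d \<in> U"
      using xy by blast
    then have "x + y = (a + c) + f (b + d)" by (simp add: f algebra_simps)
    then show ?thesis using W(2)[OF *(3,5)] U(2)[OF *(4,6)] by blast
  qed
  have "x + f y \<in> powspan m ?R" if "x \<in> powspan m W" "y \<in> powspan m U" for x y
  proof (rule powspan_add[OF R0 Radd])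
    have "W \<subseteq> ?R" using U(1) f0 by force
    then show "x \<in> powspan m ?R" using that(1) powspan_mono by blast
    have "f ` U \<subseteq> ?R" using W(1) by force
    then show "f y \<in> powspan m ?R" using that(2) by (intro powspan_map[of f m m U ?R]) (auto simp: f)
  qed
  then show "?L \<subseteq> powspan m ?R" by blast
  have "z \<in> ?L" if "z \<in> powspan m ?R" for z
    using that
  proof (induction rule: powspan.induct)
    case (base z)
    then show ?case by (auto intro: powspan.base)
  next
    case (step v z)
    then obtain a b x y where *: "v = a + f b" "a \<in> W" "b \<in> U" "z = x + f y" "x \<in> powspan m W"
      "y \<in> powspan m U" by blast
    then have "v + m z = (a + m x) + f (b + m y)" by (simp add: f m_add algebra_simps)
    then show ?case using powspan.step[OF *(2,5)] powspan.step[OF *(3,6)] by blast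
  qed
  then show "powspan m ?R \<subseteq> ?L" by blast
qed

end

section \<open>Substitution and graded polynomial rings\<close>

definition mon :: "(nat \<Rightarrow> mpoly) \<Rightarrow> (nat \<Rightarrow>\<^sub>0 nat) \<Rightarrow> mpoly" where
  "mon \<sigma> \<mu> = (\<Prod>l\<in>Poly_Mapping.keys \<mu>. \<sigma> l ^ Poly_Mapping.lookup \<mu> l)"

definition subst_poly :: "(nat \<Rightarrow> mpoly) \<Rightarrow> mpoly \<Rightarrow> mpoly" where
  "subst_poly \<sigma> f = (\<Sum>\<mu>\<in>Poly_Mapping.keys f. Cst (Poly_Mapping.lookup f \<mu>) * mon \<sigma> \<mu>)"

lemma Cst_add: "Cst (a + b) = Cst a + Cst b" and Cst_mult: "Cst (a * b) = Cst a * Cst b"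
  by (simp_all add: Cst_def single_add mult_single)

lemma mon_add: "mon \<sigma> (\<mu> + \<nu>) = mon \<sigma> \<mu> * mon \<sigma> \<nu>"
proof -
  let ?S = "Poly_Mapping.keys \<mu> \<union> Poly_Mapping.keys \<nu>"
  have "mon \<sigma> \<kappa> = (\<Prod>l\<in>?S. \<sigma> l ^ Poly_Mapping.lookup \<kappa> l)" if "Poly_Mapping.keys \<kappa> \<subseteq> ?S" for \<kappa>
    unfolding mon_def using that by (intro prod.mono_neutral_left) (auto simp: in_keys_iff)
  then show ?thesis
    using keys_add[of \<mu> \<nu>] by (simp add: lookup_add power_add prod.distrib)
qed

lemma subst_poly_superset:
  assumes "finite S" "Poly_Mapping.keys f \<subseteq> S"
  shows "subst_poly \<sigma> f = (\<Sum>\<mu>\<in>S. Cst (Poly_Mapping.lookup f \<mu>) * mon \<sigma> \<mu>)"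
  unfolding subst_poly_def using assms by (intro sum.mono_neutral_left) (auto simp: in_keys_iff)

lemma subst_poly_zero [simp]: "subst_poly \<sigma> 0 = 0"
  by (simp add: subst_poly_def)

lemma subst_poly_add: "subst_poly \<sigma> (f + g) = subst_poly \<sigma> f + subst_poly \<sigma> g"
proof -
  let ?S = "Poly_Mapping.keys f \<union> Poly_Mapping.keys g"
  show ?thesis
    using subst_poly_superset[of ?S f \<sigma>] subst_poly_superset[of ?S g \<sigma>]
      subst_poly_superset[of ?S "f + g" \<sigma>] keys_add[of f g]
    by (simp add: lookup_add Cst_add distrib_right sum.distrib)
qed

lemma subst_poly_sum: "subst_poly \<sigma> (\<Sum>i\<in>I. f i) = (\<Sum>i\<in>I. subst_poly \<sigma> (f i))"
  by (induction I rule: infinite_finite_induct) (auto simp: subst_poly_add)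

lemma subst_poly_single: "subst_poly \<sigma> (Poly_Mapping.single \<mu> c) = Cst c * mon \<sigma> \<mu>"
  by (cases "c = 0") (auto simp: subst_poly_def)

lemma poly_mapping_sum_single:
  "(\<Sum>k\<in>Poly_Mapping.keys x. Poly_Mapping.single k (Poly_Mapping.lookup x k)) = x"
  by (rule poly_mapping_eqI)
    (auto simp: lookup_sum lookup_single when_def in_keys_iff sum.delta)

lemma subst_poly_mult: "subst_poly \<sigma> (f * g) = subst_poly \<sigma> f * subst_poly \<sigma> g"
proof -
  let ?s = "\<lambda>f \<mu>. Poly_Mapping.single \<mu> (Poly_Mapping.lookup f \<mu>) :: mpoly"
  have "f * g = (\<Sum>\<mu>\<in>Poly_Mapping.keys f. ?s f \<mu>) * (\<Sum>\<nu>\<in>Poly_Mapping.keys g. ?s g \<nu>)"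
    by (simp only: poly_mapping_sum_single)
  then show ?thesis
    by (simp add: sum_product subst_poly_sum mult_single subst_poly_single Cst_mult mon_add
        subst_poly_def[of _ f] subst_poly_def[of _ g] mult.assoc mult.left_commute)
qed

lemma subst_poly_Cst: "subst_poly \<sigma> (Cst c) = Cst c"
  using subst_poly_single[of \<sigma> 0 c] by (simp add: mon_def flip: Cst_def)

lemma subst_poly_Var: "subst_poly \<sigma> (Var l) = \<sigma> l"
  by (simp add: Var_def subst_poly_single mon_def)

lemma subst_poly_diff: "subst_poly \<sigma> (f - g) = subst_poly \<sigma> f - subst_poly \<sigma> g"
  using subst_poly_add[of \<sigma> "f - g" g] by simp

lemma Var_nonzero: "Var l \<noteq> 0"
  by (metis Var_def keys_zero keys_single empty_not_insert one_neq_zero)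

section \<open>Constant terms and the irrelevant ideal\<close>

definition cst :: "mpoly \<Rightarrow> rat" where
  "cst f = Poly_Mapping.lookup f 0"

lemma cst_add: "cst (f + g) = cst f + cst g" and cst_Cst [simp]: "cst (Cst c) = c"
  and cst_zero [simp]: "cst 0 = 0" and cst_diff: "cst (f - g) = cst f - cst g"
  by (simp_all add: cst_def Cst_def lookup_add lookup_minus)

lemma cst_Var [simp]: "cst (Var l) = 0"
proof -
  have "Poly_Mapping.single l 1 \<noteq> (0 :: nat \<Rightarrow>\<^sub>0 nat)"
    by (metis keys_zero keys_single empty_not_insert one_neq_zero)
  then show ?thesis by (simp add: cst_def Var_def lookup_single when_def)
qed

text \<open>Taking the constant term is substitution of zero for every variable, which kills each
  nonempty monomial, and substitution is multiplicative.\<close>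

lemma cst_mult: "cst (f * g) = cst f * cst g"
proof -
  have "mon (\<lambda>_. 0) \<mu> = (if \<mu> = 0 then 1 else 0)" for \<mu>
  proof (cases "\<mu> = 0")
    case False
    then obtain l where "l \<in> Poly_Mapping.keys \<mu>" using keys_eq_empty[of \<mu>] by blast
    then show ?thesis by (auto simp: mon_def in_keys_iff intro!: bexI[of _ l])
  qed (simp add: mon_def)
  then have "subst_poly (\<lambda>_. 0) f = Cst (cst f)" for f
    by (simp add: subst_poly_def cst_def sum.delta in_keys_iff if_distrib[of "(*) _"] cong: if_cong)
  then have "Cst (cst (f * g)) = Cst (cst f * cst g)"
    using subst_poly_mult[of "\<lambda>_. 0" f g] by (simp add: Cst_mult)
  then show ?thesis by (metis cst_Cst)
qed

lemma cst_hpart: "cst f = 0 \<Longrightarrow> cst (hpart d f) = 0"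
  by (simp add: cst_def lookup_hpart)

lemma adjoin_graded:
  assumes G: "\<And>g. g \<in> G \<Longrightarrow> \<exists>d. homogeneous d g"
  shows "graded_subring (adjoin G)"
proof
  fix f d assume "f \<in> adjoin G"
  then show "hpart d f \<in> adjoin G"
  proof (induction arbitrary: d rule: adjoin.induct)
    case (const c)
    then show ?case
      using adjoin.const[of c G] adjoin.const[of 0 G]
      by (simp add: hpart_homogeneous[OF homogeneous_Cst])
  next
    case (gen g)
    then obtain e where "homogeneous e g" using G by blast
    then show ?case
      using adjoin.gen[OF gen] adjoin.const[of 0 G] by (simp add: hpart_homogeneous)
  next
    case (add f g)
    then show ?case by (simp add: hpart_add adjoin.add)
  next
    \<comment> \<open>Both factors are split into homogeneous parts, which lie in the algebra by
      induction; the degree \<open>d\<close> part of the product collects the products whose degrees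
      add up to \<open>d\<close>.\<close>
    case (mult f g)
    define E where "E f = mdeg ` Poly_Mapping.keys f" for f :: mpoly
    have sum: "f = (\<Sum>e\<in>E f. hpart e f)" for f
      by (rule hpart_decomp) (auto simp: E_def)
    have "f * g = (\<Sum>e\<in>E f. \<Sum>e'\<in>E g. hpart e f * hpart e' g)"
      by (subst sum[of f], subst sum[of g]) (rule sum_product)
    then have "hpart d (f * g) = (\<Sum>e\<in>E f. \<Sum>e'\<in>E g. hpart d (hpart e f * hpart e' g))"
      by (simp add: hpart_sum)
    also have "\<dots> = (\<Sum>e\<in>E f. \<Sum>e'\<in>E g. if d = e + e' then hpart e f * hpart e' g else 0)"
      by (intro sum.cong refl hpart_homogeneous homogeneous_mult homogeneous_hpart)
    also have "\<dots> \<in> adjoin G"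
    proof -
      have sum_in: "(\<Sum>i\<in>I. h i) \<in> adjoin G" if "\<And>i. i \<in> I \<Longrightarrow> h i \<in> adjoin G" for I :: "int set" and h
        using that adjoin.const[of 0 G]
        by (induction I rule: infinite_finite_induct) (auto intro: adjoin.add)
      show ?thesis
        using mult.IH adjoin.const[of 0 G] by (intro sum_in) (auto intro: adjoin.mult)
    qed
    finally show ?case .
  qed
qed (auto intro: adjoin.intros)

lemma adjoin_subset:
  assumes "G \<subseteq> adjoin G'"
  shows "adjoin G \<subseteq> adjoin G'"
proof
  fix f assume "f \<in> adjoin G"
  then show "f \<in> adjoin G'"
    by (induction rule: adjoin.induct) (use assms in \<open>auto intro: adjoin.intros\<close>)
qed

lemma ideal_gen_add:
  assumes "f \<in> ideal_gen A G" "g \<in> ideal_gen A G"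
  shows "f + g \<in> ideal_gen A G"
  using assms(2)
  by (induction rule: ideal_gen.induct)
    (use assms(1) in \<open>auto intro: ideal_gen.step simp flip: add.assoc\<close>)

lemma ideal_gen_gen: "a \<in> A \<Longrightarrow> g \<in> G \<Longrightarrow> a * g \<in> ideal_gen A G"
  using ideal_gen.step[OF ideal_gen.zero] by simp

context graded_subring
begin

lemma ideal_in_ideal_gen:
  assumes "G \<subseteq> A"
  shows "ideal_in A (ideal_gen A G)"
proof -
  have "f \<in> A" if "f \<in> ideal_gen A G" for f
    using that by (induction rule: ideal_gen.induct)
      (use assms in \<open>auto intro: zero_in add_in mult_in\<close>)
  moreover have "a * f \<in> ideal_gen A G" if "f \<in> ideal_gen A G" "a \<in> A" for f a
    using that by (induction rule: ideal_gen.induct)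
      (auto simp: distrib_left ideal_gen.zero simp flip: mult.assoc intro!: ideal_gen.step mult_in)
  ultimately show ?thesis by (auto simp: ideal_in_def ideal_gen.zero ideal_gen_add)
qed

lemma ideal_in_cst: "ideal_in A {f \<in> A. cst f = 0}"
  by (auto simp: ideal_in_def zero_in add_in mult_in cst_add cst_mult)

text \<open>As all generators have the same degree \<open>e\<close>, the homogeneous parts of
  \<open>a * g\<close> are the parts of \<open>a\<close> times \<open>g\<close>.\<close>

lemma hpart_ideal_gen:
  assumes G: "\<And>g. g \<in> G \<Longrightarrow> homogeneous e g" and f: "f \<in> ideal_gen A G"
  shows "hpart d f \<in> ideal_gen A G"
  using f
proof (induction rule: ideal_gen.induct)
  case zero
  then show ?case by (simp add: ideal_gen.zero)
next
  case (step f a g)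
  let ?E = "mdeg ` Poly_Mapping.keys a"
  have "a * g = (\<Sum>d\<in>?E. hpart d a * g)"
    using hpart_decomp[of ?E a] by (simp flip: sum_distrib_right)
  then have "hpart d (a * g) = (\<Sum>d'\<in>?E. hpart d (hpart d' a * g))" by (simp add: hpart_sum)
  also have "\<dots> = (\<Sum>d'\<in>?E. if d = d' + e then hpart d' a * g else 0)"
    using G step by (intro sum.cong refl hpart_homogeneous homogeneous_mult homogeneous_hpart) auto
  also have "\<dots> \<in> ideal_gen A G"
  proof -
    have sum_in: "(\<Sum>i\<in>I. h i) \<in> ideal_gen A G" if "\<And>i. i \<in> I \<Longrightarrow> h i \<in> ideal_gen A G" for I :: "int set" and h
      using that
      by (induction I rule: infinite_finite_induct) (auto intro: ideal_gen_add ideal_gen.zero)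
    show ?thesis
      using step by (intro sum_in) (auto intro!: ideal_gen_gen hpart_in ideal_gen.zero)
  qed
  finally show ?case using step by (simp add: hpart_add ideal_gen_add)
qed

end

text \<open>Subtracting its constant term moves every element into the ideal; for products this
  rests on \<open>f g - f(0) g(0) = g (f - f(0)) + f(0) (g - g(0))\<close>. Both maximal ideals
  thereby become kernels of the same function.\<close>

lemma ideal_gen_cst:
  assumes G: "\<And>g. g \<in> G \<Longrightarrow> homogeneous 2 g" "\<And>g. g \<in> G \<Longrightarrow> cst g = 0"
  shows "ideal_gen (adjoin G) G = {f \<in> adjoin G. cst f = 0}"
proof
  interpret graded_subring "adjoin G" using G by (intro adjoin_graded) blast
  note ideal = ideal_in_ideal_gen[of G]
  have G_sub: "G \<subseteq> adjoin G" by (auto intro: adjoin.gen)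
  have "cst f = 0" if "f \<in> ideal_gen (adjoin G) G" for f
    using that by (induction rule: ideal_gen.induct) (auto simp: cst_add cst_mult G)
  then show "ideal_gen (adjoin G) G \<subseteq> {f \<in> adjoin G. cst f = 0}"
    using ideal[OF G_sub] by (auto simp: ideal_in_def)
  have "f - Cst (cst f) \<in> ideal_gen (adjoin G) G" if "f \<in> adjoin G" for f
    using that
  proof (induction rule: adjoin.induct)
    case (const c)
    then show ?case by (simp add: ideal_gen.zero)
  next
    case (gen g)
    then show ?case using ideal_gen_gen[OF one_in gen] by (simp add: G)
  next
    case (add f g)
    then have "(f - Cst (cst f)) + (g - Cst (cst g)) \<in> ideal_gen (adjoin G) G"
      by (intro ideal_gen_add)
    then show ?case by (simp add: cst_add Cst_add algebra_simps)
  next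
    case (mult f g)
    then have "g * (f - Cst (cst f)) + Cst (cst f) * (g - Cst (cst g)) \<in> ideal_gen (adjoin G) G"
      using ideal[OF G_sub] Cst_in by (intro ideal_gen_add) (auto simp: ideal_in_def)
    then show ?case by (simp add: cst_mult Cst_mult algebra_simps)
  qed
  then show "{f \<in> adjoin G. cst f = 0} \<subseteq> ideal_gen (adjoin G) G" by force
qed

section \<open>Adjoining the first variable\<close>

declare One_nat_def [simp del]

definition poly_ring :: "nat \<Rightarrow> mpoly set" where
  "poly_ring n = adjoin (Var ` {1..n})"

definition red_ring :: "nat \<Rightarrow> mpoly set" where
  "red_ring n = adjoin ((\<lambda>l. Var l - Var 1) ` {2..n})"

text \<open>
  The substitution \<open>X\<^sub>l \<mapsto> X\<^sub>l - X\<^sub>1\<close> kills \<open>X\<^sub>1\<close> and fixes the differences of variables. Hence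
  \<open>X\<^sub>1\<close> is transcendental over the ring of its fixed points.
\<close>

definition invariant :: "mpoly set" where
  "invariant = {f. subst_poly (\<lambda>l. Var l - Var 1) f = f}"

abbreviation mult_X1 :: "mpoly \<Rightarrow> mpoly" where "mult_X1 \<equiv> (*) (Var 1)"
abbreviation act_X1 :: "'b vec \<Rightarrow> 'b vec" where "act_X1 \<equiv> smult (Var 1)"

lemma red_ring_invariant: "red_ring n \<subseteq> invariant"
proof
  fix f assume "f \<in> red_ring n"
  then show "f \<in> invariant"
    unfolding red_ring_def
    by (induction rule: adjoin.induct)
      (auto simp: invariant_def subst_poly_Cst subst_poly_Var subst_poly_diff subst_poly_add
        subst_poly_mult)
qed

interpretation polys: free_operator mult_X1 invariant
proof
  fix f g h k :: mpoly
  assume fg: "f \<in> invariant" "g \<in> invariant" and eq: "f + Var 1 * h = g + Var 1 * k"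
  let ?\<epsilon> = "subst_poly (\<lambda>l. Var l - Var 1)"
  have "?\<epsilon> (f + Var 1 * h) = f" "?\<epsilon> (g + Var 1 * k) = g"
    using fg by (auto simp: invariant_def subst_poly_add subst_poly_mult subst_poly_Var)
  then have "f = g" using eq by simp
  then show "f = g \<and> h = k" using eq Var_nonzero by simp
qed (simp add: distrib_left)

interpretation vecs: free_operator act_X1 "vecs invariant UNIV"
proof
  fix u v x y :: "'a vec"
  assume uv: "u \<in> vecs invariant UNIV" "v \<in> vecs invariant UNIV"
    and eq: "u + act_X1 x = v + act_X1 y"
  have "Poly_Mapping.lookup u b = Poly_Mapping.lookup v b \<and>
      Poly_Mapping.lookup x b = Poly_Mapping.lookup y b" for b
    using uv arg_cong[OF eq, of "\<lambda>z. Poly_Mapping.lookup z b"]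
    by (intro polys.free) (auto simp: vecs_def lookup_add lookup_smult)
  then show "u = v \<and> x = y" by (auto intro!: poly_mapping_eqI)
qed (rule smult_add_right)

lemma vecs_mono: "A \<subseteq> A' \<Longrightarrow> S \<subseteq> S' \<Longrightarrow> vecs A S \<subseteq> vecs A' S'"
  by (auto simp: vecs_def)

lemma graded_subring_poly_ring: "graded_subring (poly_ring n)"
  unfolding poly_ring_def by (rule adjoin_graded) (auto intro: homogeneous_Var)

lemma graded_subring_red_ring: "graded_subring (red_ring n)"
  unfolding red_ring_def by (rule adjoin_graded) (auto intro: homogeneous_Var homogeneous_diff)

lemma red_ring_sub_poly_ring: "1 \<le> n \<Longrightarrow> red_ring n \<subseteq> poly_ring n"
  unfolding red_ring_def
proof (unfold poly_ring_def, rule adjoin_subset)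
  assume n: "1 \<le> n"
  have "Var l + Cst (- 1) * Var 1 \<in> adjoin (Var ` {1..n})" if "l \<in> {1..n}" for l
    using that n by (intro adjoin.add adjoin.mult adjoin.const adjoin.gen) auto
  then show "(\<lambda>l. Var l - Var 1) ` {2..n} \<subseteq> adjoin (Var ` {1..n})" by auto
qed

lemma Var_1_in: "1 \<le> n \<Longrightarrow> Var 1 \<in> poly_ring n"
  unfolding poly_ring_def by (rule adjoin.gen) auto

text \<open>Each variable is the Horner expression \<open>(X_l - X_1) + X_1 * 1\<close>, and Horner
  expressions over a ring are closed under products.\<close>

lemma poly_ring_eq:
  assumes n: "1 \<le> n"
  shows "poly_ring n = powspan mult_X1 (red_ring n)"
proof
  interpret A: graded_subring "poly_ring n" by (rule graded_subring_poly_ring)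
  interpret R: graded_subring "red_ring n" by (rule graded_subring_red_ring)
  have "f \<in> poly_ring n" if "f \<in> powspan mult_X1 (red_ring n)" for f
    using that red_ring_sub_poly_ring[OF n] Var_1_in[OF n]
    by (induction rule: powspan.induct) (auto intro!: A.add_in A.mult_in)
  then show "powspan mult_X1 (red_ring n) \<subseteq> poly_ring n" by blast
  have closed: "f + g \<in> powspan mult_X1 (red_ring n)"
    if "f \<in> powspan mult_X1 (red_ring n)" "g \<in> powspan mult_X1 (red_ring n)" for f g
    using that by (intro polys.powspan_add R.zero_in R.add_in)
  have "f \<in> powspan mult_X1 (red_ring n)" if "f \<in> poly_ring n" for f
    using that unfolding poly_ring_def
  proof (induction rule: adjoin.induct)
    case (const c)
    then show ?case by (intro powspan.base R.Cst_in)
  next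
    case (gen g)
    then obtain l where l: "g = Var l" "1 \<le> l" "l \<le> n" by auto
    have "Var l - Var 1 \<in> red_ring n"
    proof (cases "l = 1")
      case False
      then show ?thesis unfolding red_ring_def using l by (intro adjoin.gen) auto
    qed (simp add: R.zero_in)
    from powspan.step[OF this powspan.base[OF R.one_in], of mult_X1]
    show ?case using l by simp
  next
    case (add f g)
    then show ?case by (intro closed)
  next
    case (mult f g)
    have "f * g \<in> powspan mult_X1 (red_ring n)" if "g \<in> powspan mult_X1 (red_ring n)"
      "f \<in> powspan mult_X1 (red_ring n)" for f g
      using that(2)
    proof (induction rule: powspan.induct)
      case (base u)
      then show ?case
        using powspan_map[of "(*) u" mult_X1 mult_X1 "red_ring n" "red_ring n" g] that(1) R.mult_in
        by (auto simp: distrib_left mult.left_commute)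
    next
      case (step u f)
      have "u * g \<in> powspan mult_X1 (red_ring n)"
        using powspan_map[of "(*) u" mult_X1 mult_X1 "red_ring n" "red_ring n" g] that(1) R.mult_in step
        by (auto simp: distrib_left mult.left_commute)
      from closed[OF this polys.powspan_m[OF R.zero_in step.IH]]
      show ?case by (simp add: distrib_right mult.assoc)
    qed
    then show ?case using mult by blast
  qed
  then show "poly_ring n \<subseteq> powspan mult_X1 (red_ring n)" by blast
qed

text \<open>The generators are free of \<open>X_1\<close>, so multiplying them by a Horner
  expression acts on each coefficient. For the relations \<open>rho\<close> this is
  \<open>R(B) = R_r(B)[X_1]\<close>.\<close>

lemma ideal_gen_poly_ring:
  assumes n: "1 \<le> n" and G: "G \<subseteq> red_ring n"
  shows "ideal_gen (poly_ring n) G = powspan mult_X1 (ideal_gen (red_ring n) G)"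
proof
  interpret A: graded_subring "poly_ring n" by (rule graded_subring_poly_ring)
  have ideal: "ideal_in (poly_ring n) (ideal_gen (poly_ring n) G)"
    using G red_ring_sub_poly_ring[OF n] by (intro A.ideal_in_ideal_gen) blast
  have sub: "f \<in> ideal_gen (poly_ring n) G" if "f \<in> ideal_gen (red_ring n) G" for f
    using that red_ring_sub_poly_ring[OF n]
    by (induction rule: ideal_gen.induct) (auto intro: ideal_gen.intros)
  have "f \<in> ideal_gen (poly_ring n) G" if "f \<in> powspan mult_X1 (ideal_gen (red_ring n) G)" for f
    using that sub ideal Var_1_in[OF n]
    by (induction rule: powspan.induct) (auto simp: ideal_in_def)
  then show "powspan mult_X1 (ideal_gen (red_ring n) G) \<subseteq> ideal_gen (poly_ring n) G" by blast
  have "f \<in> powspan mult_X1 (ideal_gen (red_ring n) G)" if "f \<in> ideal_gen (poly_ring n) G" for f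
    using that
  proof (induction rule: ideal_gen.induct)
    case zero
    then show ?case by (intro powspan.base ideal_gen.zero)
  next
    case (step f a g)
    have "a * g \<in> powspan mult_X1 (ideal_gen (red_ring n) G)"
      using step ideal_gen_gen[of _ "red_ring n" g G]
      by (intro powspan_map[of "\<lambda>a. a * g" mult_X1 mult_X1 "red_ring n"])
        (auto simp: poly_ring_eq[OF n] distrib_right mult.assoc)
    then show ?case
      using step by (intro polys.powspan_add ideal_gen.zero ideal_gen_add)
  qed
  then show "ideal_gen (poly_ring n) G \<subseteq> powspan mult_X1 (ideal_gen (red_ring n) G)" by blast
qed

text \<open>Coordinatewise expansions may have different lengths; writing a vector as the finite sum
  of its coordinates combines them into one expansion.\<close>

lemma vecs_powspan:
  assumes U: "0 \<in> U" "\<And>f g. f \<in> U \<Longrightarrow> g \<in> U \<Longrightarrow> f + g \<in> U"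
  shows "vecs (powspan mult_X1 U) S = powspan act_X1 (vecs U S)"
proof
  have "x \<in> vecs (powspan mult_X1 U) S" if "x \<in> powspan act_X1 (vecs U S)" for x
    using that
  proof (induction rule: powspan.induct)
    case (base u)
    then show ?case by (auto simp: vecs_def intro: powspan.base)
  next
    case (step u x)
    moreover have "Poly_Mapping.keys (u + act_X1 x) \<subseteq> S"
      using keys_add[of u "act_X1 x"] keys_smult[of "Var 1" x] step unfolding vecs_def by blast
    ultimately show ?case
      by (auto simp: vecs_def lookup_add lookup_smult intro!: powspan.step)
  qed
  then show "powspan act_X1 (vecs U S) \<subseteq> vecs (powspan mult_X1 U) S" by blast
  have V: "0 \<in> vecs U S" "\<And>x y. x \<in> vecs U S \<Longrightarrow> y \<in> vecs U S \<Longrightarrow> x + y \<in> vecs U S"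
    using U keys_add[of x y for x y :: "'a vec"]
    by (auto simp: vecs_def lookup_add dest!: subsetD)
  have "x \<in> powspan act_X1 (vecs U S)" if x: "x \<in> vecs (powspan mult_X1 U) S" for x
  proof -
    have "Poly_Mapping.single b (Poly_Mapping.lookup x b) \<in> powspan act_X1 (vecs U S)"
      if b: "b \<in> Poly_Mapping.keys x" for b
    proof (rule powspan_map[where m = mult_X1 and U = U])
      show "Poly_Mapping.single b (f + Var 1 * g)
          = Poly_Mapping.single b f + act_X1 (Poly_Mapping.single b g)" for f g
        by (simp add: single_add smult_single)
      show "Poly_Mapping.single b ` U \<subseteq> vecs U S"
        using b x U(1) by (auto simp: vecs_def lookup_single when_def split: if_splits)
      show "Poly_Mapping.lookup x b \<in> powspan mult_X1 U" using x by (simp add: vecs_def)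
    qed
    then have "(\<Sum>b\<in>Poly_Mapping.keys x. Poly_Mapping.single b (Poly_Mapping.lookup x b))
        \<in> powspan act_X1 (vecs U S)"
      by (intro vecs.powspan_sum V)
    then show ?thesis by (simp only: poly_mapping_sum_single)
  qed
  then show "vecs (powspan mult_X1 U) S \<subseteq> powspan act_X1 (vecs U S)" by blast
qed

section \<open>Base change of resolutions\<close>

lemma graded_submodule_powspan:
  assumes n: "1 \<le> n" and N: "graded_submodule (red_ring n) deg N"
  shows "graded_submodule (poly_ring n) deg (powspan act_X1 N)"
proof -
  interpret R: graded_subring "red_ring n" by (rule graded_subring_red_ring)
  have sub: "submodule (red_ring n) N" using N by (simp add: graded_submodule_def)
  note N0 = submodule_zero[OF sub] and N_add = submodule_add[OF sub]
  have add: "x + y \<in> powspan act_X1 N" if "x \<in> powspan act_X1 N" "y \<in> powspan act_X1 N" for x y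
    using that by (intro vecs.powspan_add N0 N_add)
  have red: "smult a x \<in> powspan act_X1 N" if "x \<in> powspan act_X1 N" "a \<in> red_ring n" for a x
    using that submodule_smult[OF sub]
    by (intro powspan_map[of "smult a" act_X1 act_X1 N])
      (auto simp: smult_add_right smult_smult mult.commute)
  have smult: "smult a x \<in> powspan act_X1 N" if "x \<in> powspan act_X1 N" "a \<in> poly_ring n" for a x
    using that(2) unfolding poly_ring_eq[OF n]
  proof (induction rule: powspan.induct)
    case (base a)
    then show ?case using red that by blast
  next
    case (step a f)
    then have "smult a x + act_X1 (smult f x) \<in> powspan act_X1 N"
      using red that by (intro add vecs.powspan_m N0)
    then show ?case by (simp add: smult_add_left smult_smult)
  qed
  have "gpart deg q x \<in> powspan act_X1 N" if "x \<in> powspan act_X1 N" for q x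
    using that
  proof (induction arbitrary: q rule: powspan.induct)
    case (base u)
    then show ?case using N by (auto simp: graded_submodule_def intro: powspan.base)
  next
    case (step u x)
    \<comment> \<open>\<open>X_1\<close> has degree 2, so the degree \<open>q\<close> part of
      \<open>X_1 x\<close> comes from degree \<open>q - 2\<close>.\<close>
    have "act_X1 (gpart deg (q - 2) x) = gpart deg (q - 2 + 2) (act_X1 x)"
      by (rule gpart_commute[where F = UNIV])
        (auto simp: smult_add_right intro: gcmp_smult homogeneous_Var)
    then have "gpart deg q (u + act_X1 x) = gpart deg q u + act_X1 (gpart deg (q - 2) x)"
      by (simp add: gpart_add)
    then show ?case using step N by (auto simp: graded_submodule_def intro!: powspan.step)
  qed
  then show ?thesis
    using N0 add smult by (auto simp: graded_submodule_def submodule_def intro: powspan.base)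
qed

text \<open>The degree shift by 1 accounts for the different normalizations of \<open>H\<close> and \<open>H\<^sub>r\<close>.\<close>

definition base_change :: "'b vec resolution \<Rightarrow> 'b vec resolution" where
  "base_change P = \<lparr>basis = basis P, bdeg = (\<lambda>p b. bdeg P p b + 1),
     bd = (\<lambda>p. linext (\<lambda>b. bd P p (Poly_Mapping.single b 1))),
     aug = linext (\<lambda>b. aug P (Poly_Mapping.single b 1))\<rparr>"

text \<open>In this form the ideal of the reduced ring is visibly the intersection of that ring with
  the ideal of the full ring.\<close>

definition const_ideal :: "mpoly set \<Rightarrow> mpoly set" where
  "const_ideal A = {f \<in> A. cst f = 0}"

section \<open>Extending a resolution by \<open>X_1\<close>\<close>

context
  fixes n :: nat and M M' :: "(int, 'b vec) grmod" and deg :: "'b \<Rightarrow> int"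
    and P :: "'b vec resolution"
  assumes n: "1 \<le> n"
    and num: "num M = powspan act_X1 (num M')" and den: "den M = powspan act_X1 (den M')"
    and inv: "num M' \<subseteq> vecs invariant UNIV" "den M' \<subseteq> vecs invariant UNIV"
    and M': "graded_module (red_ring n) deg M'"
    and M: "graded_module (poly_ring n) (\<lambda>b. deg b + 1) M"
    and P: "graded_free_resolution (red_ring n) M' P"
begin

interpretation A: graded_subring "poly_ring n" by (rule graded_subring_poly_ring)
interpretation R: graded_subring "red_ring n" by (rule graded_subring_red_ring)

lemmas bd_linear' = R.bd_linear[OF M' P] and bd_in' = R.bd_in[OF M' P]
  and aug_linear' = R.aug_linear[OF M' P] and aug_in' = R.aug_in[OF M' P]
  and submodule_den' = R.submodule_den[OF M']

private abbreviation (input) "F p \<equiv> vecs (red_ring n) (basis P p)"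
private abbreviation (input) "d p \<equiv> bd (base_change P) p"
private abbreviation (input) "\<epsilon> \<equiv> aug (base_change P)"

lemma vecs_poly_ring: "vecs (poly_ring n) S = powspan act_X1 (vecs (red_ring n) S)"
  unfolding poly_ring_eq[OF n] by (intro vecs_powspan R.zero_in R.add_in)

text \<open>\<open>bd P p\<close> is specified only on vectors over the reduced ring; extending its
  values on the basis gives a map linear over the full ring without changing it there.\<close>

lemma d_eq: "x \<in> F (Suc p) \<Longrightarrow> d p x = bd P p x"
  using R.linear_over_linext_eq[OF bd_linear'] by (simp add: base_change_def)

lemma aug_eq: "x \<in> F 0 \<Longrightarrow> \<epsilon> x = aug P x"
  using R.linear_over_linext_eq[OF aug_linear'] by (simp add: base_change_def)

lemma d_add: "d p (x + y) = d p x + d p y" and d_diff: "d p (x - y) = d p x - d p y"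
  and d_smult: "d p (smult a x) = smult a (d p x)"
  and aug_add: "\<epsilon> (x + y) = \<epsilon> x + \<epsilon> y" and aug_smult: "\<epsilon> (smult a x) = smult a (\<epsilon> x)"
  by (simp_all add: base_change_def linext_add linext_diff linext_smult)

lemma d_vecs:
  assumes "ideal_in (poly_ring n) I" "x \<in> vecs I (basis P (Suc p))"
  shows "d p x \<in> vecs I (basis P p)"
proof -
  have "bd P p (Poly_Mapping.single b 1) \<in> vecs (poly_ring n) (basis P p)" if "b \<in> basis P (Suc p)" for b
    using bd_in'[OF R.basis_in_vecs[OF that]] vecs_mono[OF red_ring_sub_poly_ring[OF n]] by blast
  then show ?thesis
    unfolding base_change_def resolution.simps by (rule A.linext_vecs[OF assms])
qed

lemma F_invariant: "F p \<subseteq> vecs invariant UNIV"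
  by (intro vecs_mono red_ring_invariant) auto

text \<open>Kernels and images of the extended differentials are both the Horner expansions of the
  reduced ones, so exactness is inherited.\<close>

lemma base_change_resolution:
  "graded_free_resolution (poly_ring n) M (base_change P)"
proof -
  have basis: "basis (base_change P) = basis P"
    and bdeg: "bdeg (base_change P) p = (\<lambda>b. bdeg P p b + 1)" for p
    by (simp_all add: base_change_def)
  have d_img: "d p ` F (Suc p) = bd P p ` F (Suc p)" for p
    using d_eq by (intro image_cong) auto
  have d_sub: "d p ` F (Suc p) \<subseteq> vecs invariant UNIV" for p
    unfolding d_img using R.bd_image_in[OF M' P] F_invariant by blast
  have img: "d p ` vecs (poly_ring n) (basis P (Suc p)) = powspan act_X1 (bd P p ` F (Suc p))" for p
    unfolding vecs_poly_ring d_img[symmetric]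
    by (rule powspan_image[symmetric]) (simp add: d_add d_smult)
  have exact_bd: "{x \<in> vecs (poly_ring n) (basis P (Suc p)). d p x = 0}
      = d (Suc p) ` vecs (poly_ring n) (basis P (Suc (Suc p)))" for p
  proof -
    \<comment> \<open>Zero is written as the expansion of \<open>{0}\<close>, which makes vanishing
      an instance of \<open>powspan_kernel\<close>.\<close>
    have "{x \<in> powspan act_X1 (F (Suc p)). d p x \<in> powspan act_X1 {0}}
        = powspan act_X1 {x \<in> F (Suc p). d p x \<in> {0}}"
      by (intro vecs.powspan_kernel d_sub) (auto simp: d_add d_smult vecs_def invariant_def)
    moreover have "{x \<in> F (Suc p). d p x \<in> {0}} = {x \<in> F (Suc p). bd P p x = 0}"
      using d_eq by auto
    ultimately show ?thesis
      unfolding img R.exact_bd[OF M' P, symmetric] unfolding vecs_poly_ring vecs.powspan_zero by simp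
  qed
  have exact_aug: "{x \<in> vecs (poly_ring n) (basis P 0). \<epsilon> x \<in> den M}
      = d 0 ` vecs (poly_ring n) (basis P (Suc 0))"
  proof -
    have sub: "\<epsilon> ` F 0 \<subseteq> vecs invariant UNIV"
      using aug_in' inv(1) aug_eq by auto
    have "{x \<in> powspan act_X1 (F 0). \<epsilon> x \<in> powspan act_X1 (den M')}
        = powspan act_X1 {x \<in> F 0. \<epsilon> x \<in> den M'}"
      by (intro vecs.powspan_kernel sub inv(2) submodule_zero[OF submodule_den'])
        (simp add: aug_add aug_smult)
    moreover have "{x \<in> F 0. \<epsilon> x \<in> den M'} = {x \<in> F 0. aug P x \<in> den M'}"
      using aug_eq by auto
    ultimately show ?thesis
      unfolding img R.exact_aug[OF M' P, symmetric] unfolding vecs_poly_ring den by simp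
  qed
  have aug_num: "\<epsilon> x \<in> num M" if "x \<in> vecs (poly_ring n) (basis P 0)" for x
    using that unfolding vecs_poly_ring num
    by (rule powspan_map[rotated 2]) (auto simp: aug_add aug_smult aug_eq aug_in')
  have surj: "\<exists>x\<in>vecs (poly_ring n) (basis P 0). y - \<epsilon> x \<in> den M" if "y \<in> num M" for y
    using that unfolding num vecs_poly_ring den
  proof (induction rule: powspan.induct)
    case (base y)
    then obtain x where "x \<in> F 0" "y - aug P x \<in> den M'" using R.aug_surj[OF M' P] by blast
    then show ?case by (intro bexI[of _ x]) (auto simp: aug_eq intro: powspan.base)
  next
    case (step y z)
    obtain x where x: "x \<in> F 0" "y - aug P x \<in> den M'"
      using R.aug_surj[OF M' P] step.hyps(1) by blast
    obtain w where w: "w \<in> powspan act_X1 (F 0)" "z - \<epsilon> w \<in> powspan act_X1 (den M')"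
      using step.IH by blast
    have "(y + act_X1 z) - \<epsilon> (x + act_X1 w) = (y - aug P x) + act_X1 (z - \<epsilon> w)"
      using aug_eq[OF x(1)] by (simp add: aug_add aug_smult smult_diff_right)
    also have "\<dots> \<in> powspan act_X1 (den M')" using x(2) w(2) by (rule powspan.step)
    finally show ?case using powspan.step[OF x(1) w(1)] by blast
  qed
  have d_gcmp: "d p x \<in> gcmp (\<lambda>b. bdeg P p b + 1) q"
    if "x \<in> vecs (poly_ring n) (basis P (Suc p))" "x \<in> gcmp (\<lambda>b. bdeg P (Suc p) b + 1) q" for p x q
    using that R.bd_gcmp[OF M' P R.basis_in_vecs gcmp_basis]
      linext_gcmp[where deg' = "bdeg P p" and d = 0 and deg = "bdeg P (Suc p)" and q = "q - 1" and x = x]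
    unfolding gcmp_shift base_change_def resolution.simps by fastforce
  have aug_gcmp: "\<epsilon> x \<in> gcmp (\<lambda>b. deg b + 1) q"
    if "x \<in> vecs (poly_ring n) (basis P 0)" "x \<in> gcmp (\<lambda>b. bdeg P 0 b + 1) q" for x q
    using that R.aug_gcmp[OF M' P R.basis_in_vecs gcmp_basis]
      linext_gcmp[where deg' = deg and d = 0 and deg = "bdeg P 0" and q = "q - 1" and x = x]
    unfolding gcmp_shift base_change_def resolution.simps by fastforce
  show ?thesis
    unfolding graded_free_resolution_def Let_def res_cmp_eq basis bdeg One_nat_def
  proof (intro conjI allI)
    show "linear_over (poly_ring n) (vecs (poly_ring n) (basis P (Suc p))) (d p)" for p
      by (simp add: base_change_def linear_over_linext)
    show "linear_over (poly_ring n) (vecs (poly_ring n) (basis P 0)) \<epsilon>"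
      by (simp add: base_change_def linear_over_linext)
    show "d p ` vecs (poly_ring n) (basis P (Suc p)) \<subseteq> vecs (poly_ring n) (basis P p)" for p
      using d_vecs[OF A.ideal_in_self] by blast
    show "\<epsilon> ` (vecs (poly_ring n) (basis P 0) \<inter> gcmp (\<lambda>b. bdeg P 0 b + 1) q) \<subseteq> cmp M q" for q
      using aug_num aug_gcmp M unfolding graded_module_def by blast
  qed (use d_gcmp aug_num surj exact_aug exact_bd in blast)+
qed

text \<open>Every vector over the full ring is a reduced vector plus a multiple of
  \<open>X_1\<close>, and \<open>X_1\<close> lies in the maximal ideal. Modulo the ideals the
  inclusion of the reduced complex is thus an isomorphism; the two inequalities are its injectivity
  and surjectivity on homology.\<close>

lemma Tor_base_change:
  "comp_dim (Tor (poly_ring n) (const_ideal (poly_ring n)) M p) q =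
   comp_dim (Tor (red_ring n) (const_ideal (red_ring n)) M' p) (q - 1)"
proof -
  let ?A = "poly_ring n" and ?R = "red_ring n"
  let ?I = "const_ideal (poly_ring n)" and ?J = "const_ideal (red_ring n)"
  have I: "ideal_in ?A ?I" and J: "ideal_in ?R ?J"
    unfolding const_ideal_def by (rule A.ideal_in_cst R.ideal_in_cst)+
  let ?Q = "base_change P"
  have Q: "graded_free_resolution ?A M ?Q" by (rule base_change_resolution)
  define T where "T = tor_of ?A ?I ?Q p"
  define T' where "T' = tor_of ?R ?J P p"
  have basis: "basis ?Q = basis P" and bdeg: "bdeg ?Q p = (\<lambda>b. bdeg P p b + 1)"
    by (simp_all add: base_change_def)
  \<comment> \<open>The basis degrees were raised by 1, so degree \<open>q\<close> over the full
    ring is degree \<open>q - 1\<close> for the original ones.\<close>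
  have cmp: "cmp T q = gcmp (bdeg P p) (q - 1)" "cmp T' (q - 1) = gcmp (bdeg P p) (q - 1)"
    by (simp_all add: T_def T'_def tor_of_def res_cmp_eq bdeg gcmp_shift)
  let ?U = "num T \<inter> gcmp (bdeg P p) (q - 1)" and ?W = "den T \<inter> gcmp (bdeg P p) (q - 1)"
  let ?U' = "num T' \<inter> gcmp (bdeg P p) (q - 1)" and ?W' = "den T' \<inter> gcmp (bdeg P p) (q - 1)"
  note subT = A.submodule_tor[OF M Q I, of p, folded T_def]
    and subT' = R.submodule_tor[OF M' P J, of p, folded T'_def]
  have spaces: "vecQ.subspace ?U" "vecQ.subspace ?W" "vecQ.subspace ?U'" "vecQ.subspace ?W'"
    by (intro vecQ.subspace_inter subspace_gcmp A.submodule_subspace R.submodule_subspace subT subT')+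
  have R_A: "vecs ?R S \<subseteq> vecs ?A S" and J_I: "vecs ?J S \<subseteq> vecs ?I S"
    and I_A: "vecs ?I S \<subseteq> vecs ?A S" and I_R: "vecs ?I S \<inter> vecs ?R S = vecs ?J S" for S :: "nat set"
    using red_ring_sub_poly_ring[OF n] by (auto simp: vecs_def const_ideal_def)
  have num_T: "x \<in> num T \<longleftrightarrow> x \<in> vecs ?A (basis P p) \<and>
      (\<forall>p'. p = Suc p' \<longrightarrow> d p' x \<in> vecs ?I (basis P p'))" for x
    by (auto simp: T_def tor_of_def basis split: nat.splits)
  have num_T': "x \<in> num T' \<longleftrightarrow> x \<in> F p \<and>
      (\<forall>p'. p = Suc p' \<longrightarrow> d p' x \<in> vecs ?J (basis P p'))" for x
    by (cases p) (auto simp: T'_def tor_of_def d_eq)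
  have den_T: "x \<in> den T \<longleftrightarrow> (\<exists>i y. x = i + d p y \<and> i \<in> vecs ?I (basis P p) \<and>
      y \<in> vecs ?A (basis P (Suc p)))" for x
    by (auto simp: T_def tor_of_def basis)
  have den_T': "x \<in> den T' \<longleftrightarrow> (\<exists>i y. x = i + d p y \<and> i \<in> vecs ?J (basis P p) \<and>
      y \<in> F (Suc p))" for x
    using d_eq[of _ p] by (auto simp: T'_def tor_of_def) metis+
  have X1: "act_X1 x \<in> vecs ?I S" if "x \<in> vecs ?A S" for x and S :: "nat set"
    using that A.mult_in[OF Var_1_in[OF n]] keys_smult[of "Var 1" x]
    by (auto simp: vecs_def const_ideal_def lookup_smult cst_mult)
  have decomp: "\<exists>u\<in>vecs ?R S. \<exists>y\<in>vecs ?A S. x = u + act_X1 y" if "x \<in> vecs ?A S" for x and S :: "nat set"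
    using that vecs.powspan_decomp[OF submodule_zero[OF R.submodule_vecs_self]]
    unfolding vecs_poly_ring by blast
  have "quot_dim ?U' ?W' \<le> quot_dim ?U ?W"
  proof (rule quot_dim_le[where R = "\<lambda>x y. y = x", OF spaces(3,4,1,2)])
    fix x assume "x \<in> ?U'"
    then show "\<exists>y\<in>?U. y = x"
      by (auto simp: num_T num_T' intro: subsetD[OF R_A] subsetD[OF J_I])
  next
    fix x y assume x: "x \<in> ?U'" "y = x" "y \<in> ?W"
    then obtain i y where iy: "x = i + d p y" "i \<in> vecs ?I (basis P p)"
      "y \<in> vecs ?A (basis P (Suc p))" by (auto simp: den_T)
    obtain i0 i1 where i: "i0 \<in> vecs ?R (basis P p)" "i1 \<in> vecs ?A (basis P p)" "i = i0 + act_X1 i1"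
      using decomp iy(2) I_A by blast
    obtain y0 y1 where y: "y0 \<in> F (Suc p)" "y1 \<in> vecs ?A (basis P (Suc p))" "y = y0 + act_X1 y1"
      using decomp iy(3) by blast
    have dy0: "d p y0 \<in> F p" using bd_in'[OF y(1)] d_eq[OF y(1)] by simp
    \<comment> \<open>Both sides are now in Horner form, and uniqueness discards everything
      divisible by \<open>X_1\<close>.\<close>
    have "x + act_X1 0 = (i0 + d p y0) + act_X1 (i1 + d p y1)"
      unfolding iy(1) i(3) y(3) by (simp add: d_add d_smult smult_add_right)
    moreover have "x \<in> F p" "i0 + d p y0 \<in> F p"
      using x(1) dy0 i(1) submodule_add[OF R.submodule_vecs_self] by (auto simp: num_T')
    ultimately have "x = i0 + d p y0" using vecs.free F_invariant by blast
    moreover have "i0 \<in> vecs ?I (basis P p)"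
      using A.submodule_minus[OF A.submodule_vecs[OF I] iy(2) X1[OF i(2)]] i(3) by simp
    ultimately show "x \<in> ?W'" using x(1) i(1) y(1) I_R by (auto simp: den_T')
  qed (auto simp: scaleQ_def)
  moreover have "quot_dim ?U ?W \<le> quot_dim ?U' ?W'"
  proof (rule quot_dim_le[where R = "\<lambda>x y. x - y \<in> vecs ?I (basis P p)", OF spaces(1,2,3,4)])
    fix x assume x: "x \<in> ?U"
    then have "x \<in> vecs ?A (basis P p)" by (simp add: num_T)
    then obtain u y where uy: "u \<in> F p" "y \<in> vecs ?A (basis P p)" "x = u + act_X1 y"
      using decomp by blast
    \<comment> \<open>The head \<open>u\<close> need not be homogeneous, although \<open>x\<close>
      is. Projecting it keeps the difference in the ideal, because homogeneous parts of a polynomial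
      without constant term have none either.\<close>
    let ?u = "gpart (bdeg P p) (q - 1) u"
    have u: "?u \<in> F p" using R.gpart_vecs[OF uy(1)] .
    have "x - ?u = gpart (bdeg P p) (q - 1) (x - u)"
      using gpart_of_gcmp[of x "bdeg P p" "q - 1" "q - 1"] x by (simp add: gpart_diff)
    moreover have xu: "x - u \<in> vecs ?I (basis P p)" using X1[OF uy(2)] uy(3) by simp
    then have "gpart (bdeg P p) (q - 1) (x - u) \<in> vecs ?A (basis P p)"
      using I_A A.gpart_vecs by blast
    ultimately have diff: "x - ?u \<in> vecs ?I (basis P p)"
      using xu by (auto simp: vecs_def const_ideal_def lookup_gpart cst_hpart)
    have "d p' ?u \<in> vecs ?J (basis P p')" if p: "p = Suc p'" for p'
    proof -
      have "d p' x - d p' (x - ?u) \<in> vecs ?I (basis P p')"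
        using x d_vecs[OF I, of "x - ?u" p'] diff p
        by (intro A.submodule_minus[OF A.submodule_vecs[OF I]]) (auto simp: num_T)
      moreover have "d p' ?u \<in> F p'" using bd_in'[of ?u p'] d_eq[of ?u p'] u p by simp
      ultimately show ?thesis using I_R by (auto simp: d_diff)
    qed
    then show "\<exists>y\<in>?U'. x - y \<in> vecs ?I (basis P p)"
      using u diff gpart_gcmp by (intro bexI[of _ ?u]) (auto simp: num_T')
  next
    fix x y assume x: "x \<in> ?U" and xy: "x - y \<in> vecs ?I (basis P p)" and "y \<in> ?W'"
    then obtain i z where iz: "y = i + d p z" "i \<in> vecs ?J (basis P p)" "z \<in> F (Suc p)"
      by (auto simp: den_T')
    then have "x = (x - y + i) + d p z" by simp
    moreover have "x - y + i \<in> vecs ?I (basis P p)"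
      using xy iz(2) J_I by (intro submodule_add[OF A.submodule_vecs[OF I]]) blast+
    moreover have "z \<in> vecs ?A (basis P (Suc p))" using iz(3) R_A by blast
    ultimately show "x \<in> ?W" using x den_T[of x] by blast
  next
    note sub = A.submodule_vecs[OF I, of "basis P p"]
    show "0 - 0 \<in> vecs ?I (basis P p)" using submodule_zero[OF sub] by simp
    fix x y assume xy: "x - y \<in> vecs ?I (basis P p)"
    show "scaleQ c x - scaleQ c y \<in> vecs ?I (basis P p)" for c
      using submodule_smult[OF sub A.Cst_in xy] by (simp add: scaleQ_def smult_diff_right)
    fix x' y' assume "x' - y' \<in> vecs ?I (basis P p)"
    from submodule_add[OF sub xy this] show "x + x' - (y + y') \<in> vecs ?I (basis P p)"
      by (simp add: algebra_simps)
  qed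
  ultimately have "comp_dim T q = comp_dim T' (q - 1)"
    unfolding comp_dim_def cmp by (intro antisym)
  then show ?thesis
    using A.Tor_dim[OF M Q I] R.Tor_dim[OF M' P J] by (simp add: T_def T'_def)
qed

end

context graded_subring
begin

text \<open>Modulo the zero ideal the complex is the resolution itself, whose homology is
  \<open>M\<close> in level 0 and vanishes above. This handles knots, where the reduced maximal
  ideal is zero.\<close>

lemma tor_of_zero_ideal:
  assumes M: "graded_module A deg M" and P: "graded_free_resolution A M P"
  shows "comp_dim (tor_of A {0} P 0) q = comp_dim M q" "comp_dim (tor_of A {0} P (Suc p)) q = 0"
proof -
  have I: "ideal_in A {0}" by (simp add: ideal_in_def zero_in)
  have vecs0: "vecs {0} S = {0}" for S :: "nat set"
    by (auto simp: vecs_def intro: poly_mapping_eqI)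
  note spaces = subspace_tor[OF M P I]
  have cmp: "cmp (tor_of A {0} P p) = gcmp (bdeg P p)" for p
    by (simp add: tor_of_def res_cmp_eq fun_eq_iff)
  have den: "den (tor_of A {0} P p) = bd P p ` vecs A (basis P (Suc p))" for p
    by (auto simp: tor_of_def vecs0)
  have num_Suc: "num (tor_of A {0} P (Suc p)) = den (tor_of A {0} P (Suc p))"
    unfolding den exact_bd[OF M P, symmetric] by (auto simp: tor_of_def vecs0)
  show "comp_dim (tor_of A {0} P (Suc p)) q = 0"
    unfolding comp_dim_def cmp num_Suc by (intro quot_dim_self spaces) auto
  let ?F = "vecs A (basis P 0)"
  let ?U = "num (tor_of A {0} P 0) \<inter> gcmp (bdeg P 0) q"
    and ?W = "den (tor_of A {0} P 0) \<inter> gcmp (bdeg P 0) q"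
  have num_0: "num (tor_of A {0} P 0) = ?F" by (simp add: tor_of_def)
  have den_0: "den (tor_of A {0} P 0) = {x \<in> ?F. aug P x \<in> den M}"
    unfolding den exact_aug[OF M P] ..
  have M_cmp: "comp_dim M q = quot_dim (num M \<inter> gcmp deg q) (den M \<inter> gcmp deg q)"
    using M by (simp add: comp_dim_def graded_module_def)
  have spaces': "vecQ.subspace (num M \<inter> gcmp deg q)" "vecQ.subspace (den M \<inter> gcmp deg q)"
    by (intro vecQ.subspace_inter subspace_gcmp submodule_subspace submodule_num[OF M]
        submodule_den[OF M])+
  note F = submodule_vecs_self[of "basis P 0"] and aug = aug_linear[OF M P]
  have "quot_dim ?U ?W \<le> quot_dim (num M \<inter> gcmp deg q) (den M \<inter> gcmp deg q)"
  proof (rule quot_dim_le[where R = "\<lambda>x y. x \<in> ?F \<and> y = aug P x", OF spaces spaces'])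
    fix x assume "x \<in> ?U"
    then show "\<exists>y\<in>num M \<inter> gcmp deg q. x \<in> ?F \<and> y = aug P x"
      using aug_in[OF M P] aug_gcmp[OF M P] by (auto simp: num_0)
  qed (use submodule_zero[OF F] submodule_add[OF F] submodule_smult[OF F Cst_in]
      linear_over_zero[OF aug] linear_over_add[OF aug] linear_over_smult[OF aug Cst_in] in
      \<open>auto simp: den_0 scaleQ_def\<close>)
  moreover have "quot_dim (num M \<inter> gcmp deg q) (den M \<inter> gcmp deg q) \<le> quot_dim ?U ?W"
  proof (rule quot_dim_le[where R = "\<lambda>y x. x \<in> ?F \<and> y - aug P x \<in> den M", OF spaces' spaces])
    fix y assume "y \<in> num M \<inter> gcmp deg q"
    then show "\<exists>x\<in>?U. x \<in> ?F \<and> y - aug P x \<in> den M"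
      using aug_surj_graded[OF M P, of y q] by (auto simp: num_0)
  next
    fix y x assume "y \<in> num M \<inter> gcmp deg q" "x \<in> ?F \<and> y - aug P x \<in> den M" "x \<in> ?W"
    then show "y \<in> den M \<inter> gcmp deg q"
      using submodule_add[OF submodule_den[OF M], of "y - aug P x" "aug P x"] by (auto simp: den_0)
  next
    show "0 \<in> ?F \<and> 0 - aug P 0 \<in> den M"
      using submodule_zero[OF F] linear_over_zero[OF aug] submodule_zero[OF submodule_den[OF M]] by simp
  next
    fix y x y' x' assume *: "x \<in> ?F \<and> y - aug P x \<in> den M" "x' \<in> ?F \<and> y' - aug P x' \<in> den M"
    then have "y + y' - aug P (x + x') = (y - aug P x) + (y' - aug P x')"
      by (simp add: linear_over_add[OF aug])
    moreover have "(y - aug P x) + (y' - aug P x') \<in> den M"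
      using * submodule_add[OF submodule_den[OF M]] by blast
    ultimately show "x + x' \<in> ?F \<and> y + y' - aug P (x + x') \<in> den M"
      using * submodule_add[OF F] by metis
  next
    fix c y x assume *: "x \<in> ?F \<and> y - aug P x \<in> den M"
    then have "scaleQ c y - aug P (scaleQ c x) = smult (Cst c) (y - aug P x)"
      by (simp add: scaleQ_def linear_over_smult[OF aug Cst_in] smult_diff_right)
    moreover have "smult (Cst c) (y - aug P x) \<in> den M"
      using * submodule_smult[OF submodule_den[OF M] Cst_in] by blast
    ultimately show "scaleQ c x \<in> ?F \<and> scaleQ c y - aug P (scaleQ c x) \<in> den M"
      using * submodule_smult[OF F Cst_in] by (metis scaleQ_def)
  qed
  moreover have "comp_dim (tor_of A {0} P 0) q = quot_dim ?U ?W"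
    by (simp only: comp_dim_def cmp)
  ultimately show "comp_dim (tor_of A {0} P 0) q = comp_dim M q"
    unfolding M_cmp by simp
qed

end

text \<open>There are no indices from 2 to 1, so the ring consists of the constants.\<close>

lemma const_ideal_red_ring_1: "const_ideal (red_ring 1) = {0}"
proof -
  have "\<exists>c. f = Cst c" if "f \<in> adjoin {}" for f
    using that by (induction rule: adjoin.induct) (auto simp flip: Cst_add Cst_mult)
  moreover have "0 \<in> adjoin {}" using adjoin.const[of 0] by simp
  ultimately show ?thesis by (fastforce simp: const_ideal_def red_ring_def)
qed

section \<open>Combinatorics of the diagram\<close>

lemma finite_edges: "finite (edges B)"
proof -
  have "edges B \<subseteq> (\<lambda>(t, q). Arc t q) ` ({..<ncross B} \<times> (\<Union>t<ncross B. {pos B t, pos B t + 1})) \<union>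
      Loop ` {1..strands B}"
    by (auto simp: edges_def meets_def)
  then show ?thesis by (rule finite_subset) auto
qed

text \<open>The strand in position 1 either leaves some crossing or closes up to a loop.\<close>

lemma edges_nonempty: "closed_braid B \<Longrightarrow> edges B \<noteq> {}"
  by (cases "\<exists>t<ncross B. meets B t 1") (auto simp: edges_def closed_braid_def)

lemma arriving_in_edges:
  assumes "t < ncross B" "meets B t q"
  shows "arriving B t q \<in> edges B"
proof -
  let ?n = "ncross B"
  let ?P = "\<lambda>d. 0 < d \<and> meets B ((t + ?n - d) mod ?n) q"
  \<comment> \<open>Going back \<open>n\<close> steps returns to \<open>t\<close> itself, so the set
    whose least element is taken is nonempty.\<close>
  have "?P ?n" using assms by simp
  then have "?P (LEAST d. ?P d)" by (rule LeastI)
  moreover have "(t + ?n - (LEAST d. ?P d)) mod ?n < ?n" using assms by simp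
  ultimately show ?thesis by (auto simp: arriving_def Let_def edges_def)
qed

lemma legs_in_edges:
  assumes "t < ncross B"
  shows "in_left B t \<in> edges B" "in_right B t \<in> edges B" "out_left B t \<in> edges B"
    "out_right B t \<in> edges B"
proof -
  show "in_left B t \<in> edges B" "in_right B t \<in> edges B"
    unfolding in_left_def in_right_def by (intro arriving_in_edges assms; simp add: meets_def)+
  show "out_left B t \<in> edges B" "out_right B t \<in> edges B"
    using assms by (auto simp: out_left_def out_right_def edges_def meets_def)
qed

text \<open>Components are classes of edges. The lower bound provides the variable
  \<open>X_1\<close>, the upper bound embeds the component ring in the edge ring.\<close>

lemma ncomp_bounds:
  assumes "closed_braid B"
  shows "1 \<le> ncomp B" "ncomp B \<le> nedges B"
proof -
  have eq: "components B = (\<lambda>e. ((passes B \<union> (passes B)\<inverse>)\<^sup>*) `` {e}) ` edges B"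
    by (auto simp: components_def quotient_def)
  show "ncomp B \<le> nedges B"
    unfolding ncomp_def nedges_def eq by (rule card_image_le[OF finite_edges])
  have "card (components B) \<noteq> 0"
    using edges_nonempty[OF assms] finite_edges by (simp add: eq)
  then show "1 \<le> ncomp B" by (simp add: ncomp_def)
qed

text \<open>Edges that follow one another on a component share a crossing, so a single component
  links all edges. This puts \<open>H_bar\<close> in its defined case.\<close>

lemma knot_connected:
  assumes "is_knot B"
  shows "connected_diagram B"
proof -
  let ?r = "passes B \<union> (passes B)\<inverse>"
  let ?legs = "\<lambda>t. {in_left B t, in_right B t, out_left B t, out_right B t}"
  obtain K where K: "components B = {K}"
    using assms by (auto simp: is_knot_def ncomp_def One_nat_def card_1_singleton_iff)
  have "(e, e') \<in> ?r\<^sup>*" if "e \<in> edges B" "e' \<in> edges B" for e e'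
  proof -
    have "?r\<^sup>* `` {e} = K" "?r\<^sup>* `` {e'} = K"
      using that K quotientI[of _ "edges B" "?r\<^sup>*"] unfolding components_def by blast+
    then show ?thesis by blast
  qed
  moreover have "?r\<^sup>* \<subseteq> (\<Union>t<ncross B. ?legs t \<times> ?legs t)\<^sup>*"
    by (intro rtrancl_mono) (auto simp: passes_def)
  ultimately show ?thesis unfolding connected_diagram_def Let_def by blast
qed

section \<open>Homology of the double complex\<close>

lemma Var_diff_in_red_ring:
  assumes "a \<in> {1..n}" "b \<in> {1..n}"
  shows "Var a - Var b \<in> red_ring n"
proof -
  interpret R: graded_subring "red_ring n" by (rule graded_subring_red_ring)
  have *: "Var l - Var 1 \<in> red_ring n" if "l \<in> {1..n}" for l
  proof (cases "l = 1")
    case False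
    then show ?thesis unfolding red_ring_def using that by (intro adjoin.gen) auto
  qed (simp add: R.zero_in)
  have "(Var a - Var 1) + (- 1) * (Var b - Var 1) \<in> red_ring n"
    by (intro R.add_in R.mult_in R.minus_one_in * assms)
  then show ?thesis by (simp add: algebra_simps)
qed

lemma num_homology: "num (homology d M) = {x \<in> num M. d x \<in> den M}"
  and den_homology: "den (homology d M) = {x + d y |x y. x \<in> den M \<and> y \<in> num M}"
  and cmp_homology [simp]: "cmp (homology d M) = cmp M"
  by (simp_all add: homology_def)

lemma homology_subset:
  assumes V: "submodule A V" and M: "num M \<subseteq> V" "den M \<subseteq> V" and d: "\<And>x. x \<in> V \<Longrightarrow> d x \<in> V"
  shows "num (homology d M) \<subseteq> V" "den (homology d M) \<subseteq> V"
proof -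
  show "num (homology d M) \<subseteq> V" using M(1) by (auto simp: num_homology)
  have "x + d y \<in> V" if "x \<in> den M" "y \<in> num M" for x y
    using that M by (intro submodule_add[OF V] d) auto
  then show "den (homology d M) \<subseteq> V" by (auto simp: den_homology)
qed

lemma homology_graded:
  fixes M :: "(int \<times> int \<times> int, 'b vec) grmod"
  assumes A: "graded_subring A"
    and M: "graded_submodule A deg (num M)" "graded_submodule A deg (den M)"
    and D: "\<And>b. D b \<in> gcmp deg (deg b + d)"
  shows "graded_submodule A deg (num (homology (linext D) M))"
    "graded_submodule A deg (den (homology (linext D) M))"
proof -
  interpret graded_subring A by (rule A)
  have deg: "linext D x \<in> gcmp deg (q + d)" if "x \<in> gcmp deg q" for x q
    using that D by (intro linext_gcmp[where A = UNIV and S = UNIV]) (auto simp: vecs_def)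
  show "graded_submodule A deg (num (homology (linext D) M))"
    unfolding num_homology
    using linear_over_linext M(1) deg M(2) by (rule graded_submodule_kernel)
  show "graded_submodule A deg (den (homology (linext D) M))"
    unfolding den_homology
    using M(2,1) linear_over_linext deg by (rule graded_submodule_plus_image)
qed

text \<open>One homology step preserves the expansion in \<open>X_1\<close>: the numerator is a
  preimage, the denominator a sum with an image, and the differential has values with
  \<open>invariant\<close> coefficients.\<close>

lemma homology_powspan:
  assumes num: "num M = powspan act_X1 (num M')" and den: "den M = powspan act_X1 (den M')"
    and M': "submodule A (num M')" "submodule A (den M')"
    and inv: "den M' \<subseteq> vecs invariant UNIV" "linext D ` num M' \<subseteq> vecs invariant UNIV"
  shows "num (homology (linext D) M) = powspan act_X1 (num (homology (linext D) M'))"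
    "den (homology (linext D) M) = powspan act_X1 (den (homology (linext D) M'))"
proof -
  show "num (homology (linext D) M) = powspan act_X1 (num (homology (linext D) M'))"
    unfolding num_homology num den
    by (intro vecs.powspan_kernel inv submodule_zero[OF M'(2)]) (simp add: linext_add linext_smult)
  show "den (homology (linext D) M) = powspan act_X1 (den (homology (linext D) M'))"
    unfolding den_homology num den
    by (intro vecs.powspan_plus_image linext_add linext_smult submodule_zero[OF M'(1)]
        submodule_zero[OF M'(2)] submodule_add[OF M'(1)] submodule_add[OF M'(2)])
qed

abbreviation edge_degree :: "braid \<Rightarrow> nat set \<times> nat set \<Rightarrow> int" where
  "edge_degree B c \<equiv> fst (gen_deg B c)"

lemma gen_deg_change:
  assumes t: "t < ncross B" and same: "\<And>u. u \<noteq> t \<Longrightarrow> deg_at B c' u = deg_at B c u"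
  shows "gen_deg B c' = gen_deg B c + (deg_at B c' t - deg_at B c t)"
proof -
  have "gen_deg B c' = deg_at B c' t + (\<Sum>u\<in>{..<ncross B} - {t}. deg_at B c' u)"
    "gen_deg B c = deg_at B c t + (\<Sum>u\<in>{..<ncross B} - {t}. deg_at B c u)"
    using t by (auto simp: gen_deg_def intro: sum.remove)
  moreover have "(\<Sum>u\<in>{..<ncross B} - {t}. deg_at B c' u) = (\<Sum>u\<in>{..<ncross B} - {t}. deg_at B c u)"
    by (intro sum.cong refl same) auto
  ultimately show ?thesis by simp
qed

definition basis_h :: "braid \<Rightarrow> (edge \<Rightarrow> nat) \<Rightarrow> nat set \<times> nat set \<Rightarrow> (nat set \<times> nat set) vec" where
  "basis_h B \<nu> c = (\<Sum>t\<in>{..<ncross B} - fst c.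
     Poly_Mapping.single (insert t (fst c), snd c) (sign_h B c t * coef_h B \<nu> t (t \<in> snd c)))"

definition basis_v :: "braid \<Rightarrow> (edge \<Rightarrow> nat) \<Rightarrow> nat set \<times> nat set \<Rightarrow> (nat set \<times> nat set) vec" where
  "basis_v B \<nu> c = (\<Sum>t\<in>{..<ncross B} - snd c.
     Poly_Mapping.single (fst c, insert t (snd c)) (sign_v B c t * coef_v B \<nu> t (t \<in> fst c)))"

lemma d_h_linext: "d_h B \<nu> = linext (basis_h B \<nu>)"
  by (rule ext) (simp add: d_h_def linext_def basis_h_def smult_sum smult_single mult.commute)

lemma d_v_linext: "d_v B \<nu> = linext (basis_v B \<nu>)"
  by (rule ext) (simp add: d_v_def linext_def basis_v_def smult_sum smult_single mult.commute)

lemma sign_cases: "sign_h B c t \<in> {1, - 1}" "sign_v B c t \<in> {1, - 1}"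
proof -
  have "(- 1) ^ k \<in> {1, - 1 :: mpoly}" for k by (induction k) auto
  then show "sign_h B c t \<in> {1, - 1}" "sign_v B c t \<in> {1, - 1}"
    unfolding sign_h_def sign_v_def by blast+
qed

lemma homogeneous_sign_mult: "s \<in> {1, - 1} \<Longrightarrow> homogeneous d f \<Longrightarrow> homogeneous d (s * f)"
  by (auto simp: homogeneous_uminus)

text \<open>The quadratic coefficients occur exactly in the rows where the first degree of the
  corner drops by 2, so the total change is always 2.\<close>

lemma basis_h_gcmp: "basis_h B \<nu> c \<in> gcmp (edge_degree B) (edge_degree B c + 2)"
  unfolding basis_h_def
proof (intro gcmp_sum gcmp_single homogeneous_sign_mult sign_cases)
  fix t assume t: "t \<in> {..<ncross B} - fst c"
  let ?c = "(insert t (fst c), snd c)"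
  have quad: "homogeneous 4 ((Xol B \<nu> t - Xil B \<nu> t) * (Xir B \<nu> t - Xol B \<nu> t))"
    using homogeneous_mult[of 2 _ 2]
    by (auto simp: Xol_def Xil_def Xir_def intro!: homogeneous_diff homogeneous_Var)
  have lin: "homogeneous 2 (Xol B \<nu> t - Xil B \<nu> t)"
    by (auto simp: Xol_def Xil_def intro!: homogeneous_diff homogeneous_Var)
  have "gen_deg B ?c = gen_deg B c + (deg_at B ?c t - deg_at B c t)"
    using t by (intro gen_deg_change) (auto simp: deg_at_def)
  then show "homogeneous (edge_degree B c + 2 - edge_degree B ?c) (coef_h B \<nu> t (t \<in> snd c))"
    using t quad lin by (cases "positive B t"; cases "t \<in> snd c") (auto simp: deg_at_def coef_h_def)
qed

text \<open>The linear coefficient sits exactly where the first degree drops by 2 down the column;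
  elsewhere degree and coefficient 1 agree.\<close>

lemma basis_v_gcmp: "basis_v B \<nu> c \<in> gcmp (edge_degree B) (edge_degree B c + 0)"
  unfolding basis_v_def
proof (intro gcmp_sum gcmp_single homogeneous_sign_mult sign_cases)
  fix t assume t: "t \<in> {..<ncross B} - snd c"
  let ?c = "(fst c, insert t (snd c))"
  have lin: "homogeneous 2 (Xir B \<nu> t - Xol B \<nu> t)"
    by (auto simp: Xol_def Xir_def intro!: homogeneous_diff homogeneous_Var)
  have const: "homogeneous 0 1" using homogeneous_Cst[of 1] by simp
  have "gen_deg B ?c = gen_deg B c + (deg_at B ?c t - deg_at B c t)"
    using t by (intro gen_deg_change) (auto simp: deg_at_def)
  then show "homogeneous (edge_degree B c + 0 - edge_degree B ?c) (coef_v B \<nu> t (t \<in> fst c))"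
    using t lin const by (cases "positive B t"; cases "t \<in> fst c") (auto simp: deg_at_def coef_v_def)
qed

lemma finite_corners: "finite (corners B)"
  by (simp add: corners_def)

text \<open>The last two degrees depend only on the generator, not on its coefficient, so fixing
  them is a condition on the support.\<close>

lemma row_eq:
  assumes W: "graded_submodule A (edge_degree B) W"
  shows "{\<Sum>i\<in>I. f i |I f. finite I \<and>
      (\<forall>i\<in>I. f i \<in> W \<inter> cmp (shift (a, b, c) (cplx B \<nu> A')) (i, j, k))} =
    {x \<in> W. Poly_Mapping.keys x \<subseteq> {g. snd (gen_deg B g) = (j - b, k - c)}}"
    (is "?L = {x \<in> W. Poly_Mapping.keys x \<subseteq> ?S}")
proof
  have cmp: "cmp (shift (a, b, c) (cplx B \<nu> A')) (i, j, k) =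
      {x. Poly_Mapping.keys x \<subseteq> ?S} \<inter> gcmp (edge_degree B) (i - a)" for i
    by (auto simp: shift_def cplx_def gcmp_def)
  have sub: "submodule A W" using W by (simp add: graded_submodule_def)
  show "?L \<subseteq> {x \<in> W. Poly_Mapping.keys x \<subseteq> ?S}"
  proof
    fix x assume "x \<in> ?L"
    then obtain I f where x: "x = (\<Sum>i\<in>I. f i)"
      and "\<forall>i\<in>I. f i \<in> W \<inter> cmp (shift (a, b, c) (cplx B \<nu> A')) (i, j, k)"
      by blast
    then have f: "\<And>i. i \<in> I \<Longrightarrow> f i \<in> W" "\<And>i. i \<in> I \<Longrightarrow> Poly_Mapping.keys (f i) \<subseteq> ?S"
      unfolding cmp by auto
    have "Poly_Mapping.keys x \<subseteq> ?S"
      unfolding x by (rule order_trans[OF keys_sum UN_least[OF f(2)]])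
    moreover have "x \<in> W" unfolding x by (rule submodule_sum[OF sub f(1)])
    ultimately show "x \<in> {x \<in> W. Poly_Mapping.keys x \<subseteq> ?S}" by simp
  qed
  show "{x \<in> W. Poly_Mapping.keys x \<subseteq> ?S} \<subseteq> ?L"
  proof
    fix x assume x: "x \<in> {x \<in> W. Poly_Mapping.keys x \<subseteq> ?S}"
    obtain Q where Q: "finite Q" "x = (\<Sum>q\<in>Q. gpart (edge_degree B) q x)"
      using gpart_decomp by blast
    let ?f = "\<lambda>i. gpart (edge_degree B) (i - a) x"
    have "x = (\<Sum>i\<in>(\<lambda>q. q + a) ` Q. ?f i)"
      using Q(2) by (subst sum.reindex) (auto simp: inj_on_def)
    moreover have "?f i \<in> W \<inter> cmp (shift (a, b, c) (cplx B \<nu> A')) (i, j, k)" for i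
      using x W gpart_gcmp keys_gpart[of "edge_degree B" "i - a" x]
      unfolding cmp graded_submodule_def by auto
    ultimately show "x \<in> ?L" using Q(1) by blast
  qed
qed

lemma row_shift:
  assumes M: "graded_submodule A (edge_degree B) (num M)" "graded_submodule A (edge_degree B) (den M)"
    and cmp: "cmp M = cmp (cplx B \<nu> A')"
  defines "S \<equiv> \<lambda>b c j k. {x. Poly_Mapping.keys x \<subseteq> {g. snd (gen_deg B g) = (j - b, k - c)}}"
  shows "num (row (shift (a, b, c) M) j k) = num M \<inter> S b c j k"
    "den (row (shift (a, b, c) M) j k) = den M \<inter> S b c j k"
    "cmp (shift (a, b, c) M) (i, j, k) = S b c j k \<inter> gcmp (\<lambda>g. edge_degree B g + a) i"
proof -
  have shift: "num (shift s M) = num M" "den (shift s M) = den M"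
    "cmp (shift s M) = cmp (shift s (cplx B \<nu> A'))" for s
    by (simp_all add: shift_def cmp)
  show "num (row (shift (a, b, c) M) j k) = num M \<inter> S b c j k"
    "den (row (shift (a, b, c) M) j k) = den M \<inter> S b c j k"
    unfolding row_def grmod.simps shift row_eq[OF M(1)] row_eq[OF M(2)] by (auto simp: S_def)
  show "cmp (shift (a, b, c) M) (i, j, k) = S b c j k \<inter> gcmp (\<lambda>g. edge_degree B g + a) i"
    unfolding gcmp_shift by (auto simp: S_def shift_def cmp cplx_def gcmp_def)
qed

text \<open>The smaller ring \<open>A''\<close> will be the component ring acting through the edge
  ring. Passing to a row loses no information about a single trigraded component.\<close>

lemma row_graded_module:
  assumes M: "graded_submodule A (edge_degree B) (num M)" "graded_submodule A (edge_degree B) (den M)"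
    and cmp: "cmp M = cmp (cplx B \<nu> A')" and A: "A'' \<subseteq> A"
  shows "graded_module A'' (\<lambda>g. edge_degree B g + a) (row (shift (a, b, c) M) j k)"
    "comp_dim (row (shift (a, b, c) M) j k) i = comp_dim (shift (a, b, c) M) (i, j, k)"
proof -
  let ?S = "{x :: (nat set \<times> nat set) vec.
    Poly_Mapping.keys x \<subseteq> {g. snd (gen_deg B g) = (j - b, k - c)}}"
  let ?deg = "\<lambda>g. edge_degree B g + a"
  have graded: "graded_submodule A'' ?deg (W \<inter> ?S)" if W: "graded_submodule A (edge_degree B) W" for W
  proof -
    have "gpart ?deg q x = gpart (edge_degree B) (q - a) x" for q x
      by (rule poly_mapping_eqI) (simp add: lookup_gpart algebra_simps)
    then have "gpart ?deg q x \<in> W \<inter> ?S" if "x \<in> W \<inter> ?S" for q x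
      using that W keys_gpart[of "edge_degree B" "q - a" x] by (auto simp: graded_submodule_def)
    moreover have "submodule A'' (W \<inter> ?S)"
      unfolding submodule_def
    proof (intro conjI ballI)
      have sub: "submodule A W" using W by (simp add: graded_submodule_def)
      show "0 \<in> W \<inter> ?S" using submodule_zero[OF sub] by simp
      show "x + y \<in> W \<inter> ?S" if "x \<in> W \<inter> ?S" "y \<in> W \<inter> ?S" for x y
        using that submodule_add[OF sub, of x y] keys_add[of x y] by blast
      show "smult f x \<in> W \<inter> ?S" if "f \<in> A''" "x \<in> W \<inter> ?S" for f x
        using that A submodule_smult[OF sub, of f x] keys_smult[of f x] by blast
    qed
    ultimately show ?thesis by (simp add: graded_submodule_def)
  qed
  note eqs = row_shift[OF M cmp]
  have cmp_row: "cmp (row (shift (a, b, c) M) j k) i = ?S \<inter> gcmp ?deg i" for i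
    unfolding row_def grmod.simps by (rule eqs(3))
  show "graded_module A'' ?deg (row (shift (a, b, c) M) j k)"
    unfolding graded_module_def eqs cmp_row using graded[OF M(1)] graded[OF M(2)] by blast
  have "num (shift (a, b, c) M) = num M" "den (shift (a, b, c) M) = den M"
    by (simp_all add: shift_def)
  then show "comp_dim (row (shift (a, b, c) M) j k) i = comp_dim (shift (a, b, c) M) (i, j, k)"
    unfolding comp_dim_def cmp_row eqs by (simp add: Int_assoc Int_left_absorb Int_absorb)
qed

text \<open>Being supported in \<open>S\<close> is lying in the kernel of the map \<open>?r\<close>
  that erases the coordinates in \<open>S\<close>, so this is an instance of
  \<open>powspan_kernel\<close>.\<close>

lemma powspan_keys_subset:
  assumes "U \<subseteq> vecs invariant UNIV"
  shows "powspan act_X1 U \<inter> {x. Poly_Mapping.keys x \<subseteq> S}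
    = powspan act_X1 (U \<inter> {x. Poly_Mapping.keys x \<subseteq> S})"
proof -
  let ?r = "Poly_Mapping.mapp (\<lambda>b f. f when b \<notin> S) :: 'a vec \<Rightarrow> 'a vec"
  have r: "Poly_Mapping.lookup (?r x) b = (if b \<in> S then 0 else Poly_Mapping.lookup x b)" for x b
    by (auto simp: lookup_mapp when_def in_keys_iff)
  have r0: "?r x \<in> powspan act_X1 {0} \<longleftrightarrow> Poly_Mapping.keys x \<subseteq> S"
    "?r x \<in> {0} \<longleftrightarrow> Poly_Mapping.keys x \<subseteq> S" for x
    unfolding vecs.powspan_zero
    by (auto simp: poly_mapping_eq_iff fun_eq_iff r in_keys_iff subset_iff)
  have "{x \<in> powspan act_X1 U. ?r x \<in> powspan act_X1 {0}} = powspan act_X1 {x \<in> U. ?r x \<in> {0}}"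
  proof (rule vecs.powspan_kernel)
    show "?r (x + act_X1 y) = ?r x + act_X1 (?r y)" for x y
      by (rule poly_mapping_eqI) (simp add: r lookup_add lookup_smult)
    show "?r ` U \<subseteq> vecs invariant UNIV"
      using assms by (auto simp: vecs_def r invariant_def)
  qed (auto simp: vecs_def invariant_def)
  then show ?thesis unfolding r0 Collect_conj_eq Collect_mem_eq .
qed

context
  fixes B :: braid and \<nu> :: "edge \<Rightarrow> nat"
  assumes B: "closed_braid B" and \<nu>: "edge_numbering B \<nu>"
begin

private abbreviation (input) "N \<equiv> nedges B"
private abbreviation (input) "G \<equiv> rho B \<nu> ` {..<ncross B}"

interpretation R: graded_subring "red_ring N" by (rule graded_subring_red_ring)

lemma N_pos: "1 \<le> N"
  using ncomp_bounds[OF B] by simp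

lemma edge_diff_in: "e \<in> edges B \<Longrightarrow> e' \<in> edges B \<Longrightarrow> Var (\<nu> e) - Var (\<nu> e') \<in> red_ring N"
  using \<nu> by (intro Var_diff_in_red_ring) (auto simp: edge_numbering_def bij_betw_def)

text \<open>Each relation has two outgoing and two incoming edges and pairs up into two differences
  of variables.\<close>

lemma rho_in: "G \<subseteq> red_ring N"
proof
  fix g assume "g \<in> G"
  then obtain t where t: "t < ncross B" "g = rho B \<nu> t" by auto
  then have "g = (Xol B \<nu> t - Xil B \<nu> t) + (Xor B \<nu> t - Xir B \<nu> t)"
    by (simp add: rho_def)
  then show "g \<in> red_ring N"
    using legs_in_edges[OF t(1)]
    by (auto simp: Xol_def Xil_def Xor_def Xir_def intro!: R.add_in edge_diff_in)
qed

lemma rho_homogeneous: "g \<in> G \<Longrightarrow> homogeneous 2 g"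
  by (auto simp: rho_def Xol_def Xil_def Xor_def Xir_def
      intro!: homogeneous_diff homogeneous_add homogeneous_Var)

lemma coef_in:
  assumes "t < ncross B"
  shows "coef_h B \<nu> t r \<in> red_ring N" "coef_v B \<nu> t r \<in> red_ring N"
  using legs_in_edges[OF assms]
  by (auto simp: coef_h_def coef_v_def Xol_def Xil_def Xir_def intro!: R.mult_in R.one_in edge_diff_in)

lemma sign_mult_in: "s \<in> {1, - 1} \<Longrightarrow> f \<in> red_ring N \<Longrightarrow> s * f \<in> red_ring N"
  using R.mult_in[OF R.minus_one_in] by auto

lemma single_in_vecs: "f \<in> red_ring N \<Longrightarrow> c \<in> S \<Longrightarrow> Poly_Mapping.single c f \<in> vecs (red_ring N) S"
  by (auto simp: vecs_def lookup_single when_def R.zero_in)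

lemma basis_h_in: "c \<in> corners B \<Longrightarrow> basis_h B \<nu> c \<in> vecs (red_ring N) (corners B)"
  unfolding basis_h_def
  by (intro submodule_sum[OF R.submodule_vecs_self] single_in_vecs sign_mult_in sign_cases coef_in)
    (auto simp: corners_def)

lemma basis_v_in: "c \<in> corners B \<Longrightarrow> basis_v B \<nu> c \<in> vecs (red_ring N) (corners B)"
  unfolding basis_v_def
  by (intro submodule_sum[OF R.submodule_vecs_self] single_in_vecs sign_mult_in sign_cases coef_in)
    (auto simp: corners_def)

private abbreviation (input) "H_tot A \<equiv> homology (d_v B \<nu>) (homology (d_h B \<nu>) (cplx B \<nu> A))"

text \<open>All facts are carried together through the horizontal and then the vertical homology,
  since the second step needs each of them for the first. The last two express
  \<open>H(B) = H_r(B) \<otimes> \<rat>[X_1]\<close> before the degree shifts.\<close>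

lemma H_tot_num_graded: "graded_submodule (red_ring N) (edge_degree B) (num (H_tot (red_ring N)))"
  and H_tot_den_graded: "graded_submodule (red_ring N) (edge_degree B) (den (H_tot (red_ring N)))"
  and H_tot_num_vecs: "num (H_tot (red_ring N)) \<subseteq> vecs (red_ring N) (corners B)"
  and H_tot_den_vecs: "den (H_tot (red_ring N)) \<subseteq> vecs (red_ring N) (corners B)"
  and H_tot_num_poly: "num (H_tot (poly_ring N)) = powspan act_X1 (num (H_tot (red_ring N)))"
  and H_tot_den_poly: "den (H_tot (poly_ring N)) = powspan act_X1 (den (H_tot (red_ring N)))"
proof -
  let ?V = "vecs (red_ring N) (corners B)"
  let ?J = "ideal_gen (red_ring N) G"
  let ?C = "cplx B \<nu> (red_ring N)" and ?C' = "cplx B \<nu> (poly_ring N)"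
  have V_inv: "?V \<subseteq> vecs invariant UNIV" by (intro vecs_mono red_ring_invariant) auto
  have J: "ideal_in (red_ring N) ?J" using rho_in by (rule R.ideal_in_ideal_gen)
  have C: "num ?C = ?V" "den ?C = vecs ?J (corners B)"
    and C': "num ?C' = vecs (poly_ring N) (corners B)"
      "den ?C' = vecs (ideal_gen (poly_ring N) G) (corners B)"
    by (simp_all add: cplx_def)
  have C_sub: "num ?C \<subseteq> ?V" "den ?C \<subseteq> ?V"
    using J unfolding C by (intro vecs_mono; simp add: ideal_in_def)+
  have h: "linext (basis_h B \<nu>) x \<in> ?V" and v: "linext (basis_v B \<nu>) x \<in> ?V" if "x \<in> ?V" for x
    using R.linext_vecs[OF R.ideal_in_self that] basis_h_in basis_v_in by blast+
  have C_num: "graded_submodule (red_ring N) (edge_degree B) (num ?C)"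
    unfolding C by (rule R.graded_submodule_vecs)
  have C_den: "graded_submodule (red_ring N) (edge_degree B) (den ?C)"
    unfolding C using J R.hpart_ideal_gen[OF rho_homogeneous]
    by (rule R.graded_submodule_vecs_ideal)
  have C'_num: "num ?C' = powspan act_X1 (num ?C)"
    unfolding C C' unfolding poly_ring_eq[OF N_pos] by (intro vecs_powspan R.zero_in R.add_in)
  have C'_den: "den ?C' = powspan act_X1 (den ?C)"
    unfolding C C' unfolding ideal_gen_poly_ring[OF N_pos rho_in]
    by (intro vecs_powspan ideal_gen.zero ideal_gen_add)
  let ?H = "homology (d_h B \<nu>) ?C" and ?H' = "homology (d_h B \<nu>) ?C'"
  note sub = graded_submodule_def[THEN iffD1, THEN conjunct1]
  have H_sub: "num ?H \<subseteq> ?V" "den ?H \<subseteq> ?V"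
    unfolding d_h_linext by (rule homology_subset[OF R.submodule_vecs_self C_sub h]; assumption)+
  have H: "graded_submodule (red_ring N) (edge_degree B) (num ?H)"
    "graded_submodule (red_ring N) (edge_degree B) (den ?H)"
    unfolding d_h_linext
    by (rule homology_graded[OF R.graded_subring_axioms C_num C_den basis_h_gcmp])+
  have H': "num ?H' = powspan act_X1 (num ?H)" "den ?H' = powspan act_X1 (den ?H)"
    unfolding d_h_linext
    by (rule homology_powspan[OF C'_num C'_den sub[OF C_num] sub[OF C_den]];
        use C_sub h V_inv in blast)+
  show "graded_submodule (red_ring N) (edge_degree B) (num (H_tot (red_ring N)))"
    "graded_submodule (red_ring N) (edge_degree B) (den (H_tot (red_ring N)))"
    unfolding d_v_linext
    by (rule homology_graded[OF R.graded_subring_axioms H basis_v_gcmp])+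
  show "num (H_tot (red_ring N)) \<subseteq> ?V" "den (H_tot (red_ring N)) \<subseteq> ?V"
    unfolding d_v_linext by (rule homology_subset[OF R.submodule_vecs_self H_sub v]; assumption)+
  show "num (H_tot (poly_ring N)) = powspan act_X1 (num (H_tot (red_ring N)))"
    "den (H_tot (poly_ring N)) = powspan act_X1 (den (H_tot (red_ring N)))"
    unfolding d_v_linext
    by (rule homology_powspan[OF H' sub[OF H(1)] sub[OF H(2)]]; use H_sub v V_inv in blast)+
qed

end

section \<open>Betti numbers\<close>

lemma poly_ring_mono: "m \<le> n \<Longrightarrow> poly_ring m \<subseteq> poly_ring n"
  and red_ring_mono: "m \<le> n \<Longrightarrow> red_ring m \<subseteq> red_ring n"
  unfolding poly_ring_def red_ring_def by (intro adjoin_subset; force intro: adjoin.gen)+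

lemma ring_eqs:
  "edge_poly B = poly_ring (nedges B)" "edge_poly_red B = red_ring (nedges B)"
  "comp_ring B = poly_ring (ncomp B)" "comp_ring_red B = red_ring (ncomp B)"
  by (simp_all add: edge_poly_def edge_poly_red_def comp_ring_def comp_ring_red_def poly_ring_def
      red_ring_def)

lemma max_ideal_eqs:
  "max_ideal B = const_ideal (poly_ring (ncomp B))"
  "max_ideal_red B = const_ideal (red_ring (ncomp B))"
proof -
  show "max_ideal B = const_ideal (poly_ring (ncomp B))"
    unfolding max_ideal_def comp_ring_def const_ideal_def poly_ring_def
    by (rule ideal_gen_cst) (auto intro: homogeneous_Var)
  show "max_ideal_red B = const_ideal (red_ring (ncomp B))"
    unfolding max_ideal_red_def comp_ring_red_def const_ideal_def red_ring_def
    by (rule ideal_gen_cst) (auto intro: homogeneous_Var homogeneous_diff simp: cst_diff)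
qed

context
  fixes B :: braid and \<nu> :: "edge \<Rightarrow> nat"
  assumes B: "closed_braid B" and \<nu>: "edge_numbering B \<nu>"
begin

text \<open>A resolution exists because the numerator consists of vectors over the finite set of
  corners and is therefore countable.\<close>

lemma H_red_row:
  "graded_module (red_ring (ncomp B))
     (\<lambda>g. edge_degree B g + (- writhe B + int (strands B) - 1)) (row (H_red B \<nu>) j k)"
  "comp_dim (row (H_red B \<nu>) j k) i = comp_dim (H_red B \<nu>) (i, j, k)"
  "\<exists>P. graded_free_resolution (red_ring (ncomp B)) (row (H_red B \<nu>) j k) P"
proof -
  note graded = H_tot_num_graded[OF B \<nu>] H_tot_den_graded[OF B \<nu>]
  note row = row_graded_module[OF graded _ red_ring_mono[OF ncomp_bounds(2)[OF B]],
      where \<nu> = \<nu> and A' = "red_ring (nedges B)"]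
  show M: "graded_module (red_ring (ncomp B))
     (\<lambda>g. edge_degree B g + (- writhe B + int (strands B) - 1)) (row (H_red B \<nu>) j k)"
    and "comp_dim (row (H_red B \<nu>) j k) i = comp_dim (H_red B \<nu>) (i, j, k)"
    unfolding H_red_def Cr_def ring_eqs Let_def by (rule row; simp)+
  have "num (row (H_red B \<nu>) j k) \<subseteq> vecs (red_ring (nedges B)) (corners B)"
    unfolding H_red_def Cr_def ring_eqs Let_def
    using H_tot_num_vecs[OF B \<nu>] by (subst row_shift(1)[OF graded]) auto
  then have "countable (num (row (H_red B \<nu>) j k))"
    using countable_vecs[OF countable_finite[OF finite_corners]] by (rule countable_subset)
  then show "\<exists>P. graded_free_resolution (red_ring (ncomp B)) (row (H_red B \<nu>) j k) P"
    using graded_subring.resolution_exists[OF graded_subring_red_ring M] by blast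
qed

lemma betti_eq_betti_red: "betti B \<nu> p q j k = betti_red B \<nu> p (q - 1) j k"
proof -
  let ?M = "row (H_mid B \<nu>) j k" and ?M' = "row (H_red B \<nu>) j k"
  note N_pos = N_pos[OF B \<nu>]
  note graded' = H_tot_num_graded[OF B \<nu>] H_tot_den_graded[OF B \<nu>]
  note graded = graded_submodule_powspan[OF N_pos graded'(1), folded H_tot_num_poly[OF B \<nu>]]
    graded_submodule_powspan[OF N_pos graded'(2), folded H_tot_den_poly[OF B \<nu>]]
  note sub = H_tot_num_vecs[OF B \<nu>] H_tot_den_vecs[OF B \<nu>]
  have inv: "vecs (red_ring (nedges B)) (corners B) \<subseteq> vecs invariant UNIV"
    by (intro vecs_mono red_ring_invariant) auto
  note rows = row_shift(1,2)[OF graded, where \<nu> = \<nu> and A' = "poly_ring (nedges B)"]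
    and rows' = row_shift(1,2)[OF graded', where \<nu> = \<nu> and A' = "red_ring (nedges B)"]
  have num: "num ?M = powspan act_X1 (num ?M')" "den ?M = powspan act_X1 (den ?M')"
    unfolding H_mid_def H_red_def C0_def Cr_def ring_eqs Let_def
    by (simp_all add: rows rows' H_tot_num_poly[OF B \<nu>] H_tot_den_poly[OF B \<nu>]
        powspan_keys_subset[OF order_trans[OF sub(1) inv]] powspan_keys_subset[OF order_trans[OF sub(2) inv]])
  have M'_inv: "num ?M' \<subseteq> vecs invariant UNIV" "den ?M' \<subseteq> vecs invariant UNIV"
    unfolding H_red_def Cr_def ring_eqs Let_def
    using order_trans[OF sub(1) inv] order_trans[OF sub(2) inv] by (auto simp: rows')
  have "graded_module (poly_ring (ncomp B)) (\<lambda>g. edge_degree B g + (- writhe B + int (strands B))) ?M"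
    unfolding H_mid_def C0_def ring_eqs Let_def
    by (rule row_graded_module(1)[OF graded _ poly_ring_mono[OF ncomp_bounds(2)[OF B]],
          where \<nu> = \<nu> and A' = "poly_ring (nedges B)"]) simp
  \<comment> \<open>The normalization \<open>- w + s\<close> of \<open>H(B)\<close> is rewritten as
    that of \<open>H_r(B)\<close> plus 1, the shift built into \<open>base_change\<close>.\<close>
  then have M: "graded_module (poly_ring (ncomp B))
      (\<lambda>g. edge_degree B g + (- writhe B + int (strands B) - 1) + 1) ?M"
    by (simp add: algebra_simps)
  obtain P where "graded_free_resolution (red_ring (ncomp B)) ?M' P" using H_red_row(3) by blast
  from Tor_base_change[OF ncomp_bounds(1)[OF B] num M'_inv H_red_row(1) M this]
  show ?thesis
    by (simp add: betti_def betti_red_def ring_eqs max_ideal_eqs)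
qed

lemma betti_red_knot:
  assumes "is_knot B"
  shows "betti_red B \<nu> 0 q j k = comp_dim (H_red B \<nu>) (q, j, k)" "betti_red B \<nu> (Suc p) q j k = 0"
proof -
  interpret R: graded_subring "red_ring 1" by (rule graded_subring_red_ring)
  have m: "ncomp B = 1" using assms by (simp add: is_knot_def)
  obtain P where P: "graded_free_resolution (red_ring 1) (row (H_red B \<nu>) j k) P"
    using H_red_row(3) unfolding m by blast
  note M = H_red_row(1)[unfolded m]
  have "ideal_in (red_ring 1) {0}"
    by (simp add: ideal_in_def R.zero_in)
  note Tor = R.Tor_dim[OF M P this] and trivial = R.tor_of_zero_ideal[OF M P]
  show "betti_red B \<nu> 0 q j k = comp_dim (H_red B \<nu>) (q, j, k)"
    unfolding betti_red_def ring_eqs max_ideal_eqs m const_ideal_red_ring_1 Tor trivial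
    by (rule H_red_row(2))
  show "betti_red B \<nu> (Suc p) q j k = 0"
    unfolding betti_red_def ring_eqs max_ideal_eqs m const_ideal_red_ring_1 Tor trivial ..
qed

end

theorem theorem1p7:
  fixes B :: braid and \<nu> :: "edge \<Rightarrow> nat"
  assumes "closed_braid B" and "edge_numbering B \<nu>"
  shows "(\<forall>(p::nat) (q::int) (j::int) (k::int). betti B \<nu> p q j k = betti_red B \<nu> p (q - 1) j k) \<and>
    (is_knot B \<longrightarrow>
      (\<forall>(q::int) (j::int) (k::int).
         betti B \<nu> 0 q j k = comp_dim (H_red B \<nu>) (q - 1, j, k) \<and>
         comp_dim (H_red B \<nu>) (q - 1, j, k) = comp_dim (H_bar B \<nu>) (q - 1, j, k)) \<and>
      (\<forall>(p::nat) (q::int) (j::int) (k::int). p > 0 \<longrightarrow> betti B \<nu> p q j k = 0))"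
proof (intro conjI allI impI)
  show eq: "betti B \<nu> p q j k = betti_red B \<nu> p (q - 1) j k" for p q j k
    using assms by (rule betti_eq_betti_red)
  assume knot: "is_knot B"
  note red = betti_red_knot[OF assms knot]
  show "betti B \<nu> 0 q j k = comp_dim (H_red B \<nu>) (q - 1, j, k)" for q j k
    unfolding eq by (rule red)
  \<comment> \<open>A knot diagram is connected, and there \<open>H_bar\<close> is given by the
    formula for \<open>H_red\<close>.\<close>
  show "comp_dim (H_red B \<nu>) (q - 1, j, k) = comp_dim (H_bar B \<nu>) (q - 1, j, k)" for q j k
    using knot_connected[OF knot] by (simp add: H_bar_def H_red_def)
  show "betti B \<nu> p q j k = 0" if "p > 0" for p q j k
    unfolding eq using red(2) that by (cases p) simp_all
qed

end
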